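(* Let $\phi:(\mathbb{P}^1)^3\dashrightarrow\mathbb{P}^3$ be a scaffold trilinear rational map (with $\Sigma_0,\Sigma_1$ the planar boundary surfaces) whose weights satisfy, up to a nonzero scalar multiplying all the weights, for every $0\le i,j,k\le1$, $$w_{ijk}=\alpha_{i0}\beta_{j0}\gamma_{k2}\Delta_{ijk}(0,y),\quad w_{ijk}=\alpha_{i1}\beta_{j1}\gamma_{k2}\Delta_{ijk}(1,y),\quad w_{ijk}=\alpha_{i0}\beta_{j2}\gamma_{k0}\Delta_{ijk}(0,z),\quad w_{ijk}=\alpha_{i1}\beta_{j2}\gamma_{k1}\Delta_{ijk}(1,z)$$ for some $(\alpha_{0m}:\alpha_{1m})$ ($m=0,1$), $(\beta_{0m}:\beta_{1m})$, $(\gamma_{0m}:\gamma_{1m})$ ($m=0,1,2$) in $\mathbb{P}^1_{\mathbb{R}}$. Then $\phi^{-1}$ is given by $$(x_0:x_1:x_2:x_3)\mapsto(\alpha_{1i}\lambda_{1i}\sigma_1:\alpha_{0i}\lambda_{0i}\sigma_0)\times(\beta_{12}\mu_1\tau_1:\beta_{02}\mu_0\tau_0)\times(\gamma_{12}\nu_1\upsilon_1:\gamma_{02}\nu_0\upsilon_0),$$ where any $i=0,1$ is valid. Additionally: 1. The base locus of $\phi$ is defined by the ideal $(a_0,b_0,c_0)\cap(a_1,b_1,c_1)\cap(b_2,c_2)$. 2. The base locus of $\phi^{-1}$ is $s\cup r_0\cup r_1\cup y\cup z$. 3. For each $i=0,1$, $\phi$ blows up the base point $(a_i,b_i,c_i)$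 to the plane $\Pi_i$. 4. $\phi$ blows up the base line $(b_2,c_2)$ to the smooth quadric $Q$.
   Context: Setting. $\mathbb{P}^n$ is complex and $\mathbb{P}^n_{\mathbb{R}}$ real projective $n$-space. $\phi:\mathbb{P}^1\times\mathbb{P}^1\times\mathbb{P}^1\dashrightarrow\mathbb{P}^3$ is the trilinear rational map given by $$\mathbf{f}=(f_0,f_1,f_2,f_3)=\sum_{0\le i,j,k\le 1} w_{ijk}\,\mathbf{P}_{ijk}\,s_it_ju_k,$$ with control points $\mathbf{P}_{ijk}=(1,x_{ijk},y_{ijk},z_{ijk})\in\mathbb{R}^4$ (identified with points of $\mathbb{P}^3$) and weights $w_{ijk}\in\mathbb{R}$. $\langle\cdot,\cdot\rangle$ is the usual scalar product. Boundary surfaces. $\Sigma_0$ (resp. $\Sigma_1$) is the closure of the image of $\phi$ restricted to $(s_0:s_1)=(1:0)$ (resp. $(0:1)$). $T_0,T_1$ and $Y_0,Y_1$ are defined in the same way using $(t_0:t_1)$ and $(u_0:u_1)$. So $\mathbf{P}_{ijk}\in\Sigma_i\cap T_j\cap Y_k$. Boundary lines: $s_{jk}$ joins $\mathbf{P}_{0jk},\mathbf{P}_{1jk}$; $t_{ik}$ joins $\mathbf{P}_{i0k},\mathbf{P}_{i1k}$; $u_{ij}$ joins $\mathbf{P}_{ij0},\mathbf{P}_{ij1}$ (images of the corresponding coordinate lines). Each boundary surface is a plane or a quadric; $\sigma_i,\tau_j,\upsilon_k$ denote the (linear or quadratic) forms in $\mathbf{x}=(x_0,\dots,x_3)$ defining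 $\Sigma_i,T_j,Y_k$. Standing nondegeneracy assumption: the surfaces $\Sigma_i,T_j,Y_k$ are smooth surfaces, pairwise distinct, and $s_{jk},t_{ik},u_{ij}$ are lines, pairwise distinct. $\phi$ is scaffold if all the boundary surfaces are quadrics except for one of the three parameters, for which (1) the two boundary surfaces are planes, that intersect at a line $\ell$, and (2) the four boundary lines intersect two lines $r_0,r_1$, and these two intersect $\ell$. Convention: this parameter is $s$, so $\Sigma_0,\Sigma_1$ are planes, $\ell=s:=\Sigma_0\cap\Sigma_1$, and $r_0,r_1$ meet $s_{jk}$ for all $0\le j,k\le1$. Let $y$ be the line through $u_{00}\cap u_{01}$ and $u_{10}\cap u_{11}$, and $z$ the line through $t_{00}\cap t_{01}$ and $t_{10}\cap t_{11}$. For $i,j,k\in\{0,1\}$: $\Pi_i$ is the plane containing $s$ and $r_i$, defined by $\pi_i=\boldsymbol{\pi}_i\cdot\mathbf{x}^T$, and $(\lambda_{0i}:\lambda_{1i})\in\mathbb{P}^1_{\mathbb{R}}$ is such that $\pi_i=\lambda_{0i}\sigma_0+\lambda_{1i}\sigma_1$; $\Theta_j$ is the plane containing $y$ and $r_j$, defined by $\boldsymbol{\theta}_j\cdot\mathbf{x}^T=0$; $P_k$ is the plane containing $z$ and $r_k$, defined by $\boldsymbol{\rho}_k\cdot\mathbf{x}^T=0$; here $\boldsymbol{\pi}_i,\boldsymbol{\theta}_j,\boldsymbol{\rho}_k\in\mathbb{R}^4$. For $l=0,1$ set $\Delta_{ijk}(l,y)=1/\langle\boldsymbol{\theta}_l,\mathbf{P}_{ijk}\rangle$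 and $\Delta_{ijk}(l,z)=1/\langle\boldsymbol{\rho}_l,\mathbf{P}_{ijk}\rangle$ (well defined). For weights as in the claim $\phi$ is birational of type $(1,2,2)$ (inverse given by linear forms on the first factor and quadratic forms on the other two), and the unique smooth quadric $Q$ containing $s,y,z$ belongs both to the pencil spanned by $T_0,T_1$ and to the pencil spanned by $Y_0,Y_1$; $Q$ is defined by $q=\mu_0\tau_0+\mu_1\tau_1=\nu_0\upsilon_0+\nu_1\upsilon_1$ with $(\mu_0:\mu_1),(\nu_0:\nu_1)\in\mathbb{P}^1_{\mathbb{R}}$. Put $a_i=\alpha_{0i}s_0+\alpha_{1i}s_1$ ($i=0,1$), $b_j=\beta_{0j}t_0+\beta_{1j}t_1$ and $c_k=\gamma_{0k}u_0+\gamma_{1k}u_1$ ($0\le j,k\le2$). $\phi$ blows up a subvariety $Z$ of its base locus (written via its defining ideal) to a surface $S\subset\mathbb{P}^3$ if $S$ is the image in $\mathbb{P}^3$ of the fibre over $Z$ of the closure of the graph of $\phi$ in $(\mathbb{P}^1)^3\times\mathbb{P}^3$.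
   Formalization: In items 1 and 3 the isolated base points are (a_0,b_1,c_1), blown up to Π_0, and (a_1,b_0,c_0), blown up to Π_1, instead of (a_i,b_i,c_i): with the stated weights φ does not vanish at (a_0,b_0,c_0) or (a_1,b_1,c_1). *)

theory Defs
  imports "HOL-Analysis.Analysis" "HOL-Library.Poly_Mapping"
begin

section \<open>Multiprojective algebraic geometry over the complex numbers\<close>

type_synonym 'v cpoly = "('v \<Rightarrow>\<^sub>0 nat) \<Rightarrow>\<^sub>0 complex"

definition Const :: "complex \<Rightarrow> 'v cpoly" where
  "Const c = Poly_Mapping.single 0 c"

definition Var :: "'v \<Rightarrow> 'v cpoly" where
  "Var v = Poly_Mapping.single (Poly_Mapping.single v 1) 1"

definition peval :: "('v::finite) cpoly \<Rightarrow> complex^'v \<Rightarrow> complex" where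
  "peval p x = (\<Sum>m\<in>Poly_Mapping.keys p.
     Poly_Mapping.lookup p m * (\<Prod>v\<in>UNIV. (x $ v) ^ Poly_Mapping.lookup m v))"

text \<open>
  A product of projective spaces is described by a map \<open>blk\<close> which sends each homogeneous
  coordinate to the factor it belongs to.  A point is given by a vector of homogeneous coordinates,
  with at least one nonzero entry in every block.  A subset of the product is always represented by
  the set of \<^emph>\<open>all\<close> homogeneous coordinate vectors of its points, so that equality and inclusion of
  subsets of the product are equality and inclusion of these (scaling invariant) sets of vectors.
\<close>

definition mproj :: "('v \<Rightarrow> 'b) \<Rightarrow> (complex^('v::finite)) set" where
  "mproj blk = {x. \<forall>b\<in>range blk. \<exists>v. blk v = b \<and> x $ v \<noteq> 0}"

definition same_point :: "('v \<Rightarrow> 'b) \<Rightarrow> complex^('v::finite) \<Rightarrow> complex^'v \<Rightarrow> bool" where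
  "same_point blk x y \<longleftrightarrow> (\<exists>c. (\<forall>b. c b \<noteq> 0) \<and> (\<forall>v. y $ v = c (blk v) * x $ v))"

definition multihom :: "('v \<Rightarrow> 'b) \<Rightarrow> ('b \<Rightarrow> nat) \<Rightarrow> ('v::finite) cpoly \<Rightarrow> bool" where
  "multihom blk d p \<longleftrightarrow>
     (\<forall>m\<in>Poly_Mapping.keys p. \<forall>b. (\<Sum>v | blk v = b. Poly_Mapping.lookup m v) = d b)"

definition zero_locus :: "('v \<Rightarrow> 'b) \<Rightarrow> ('v::finite) cpoly set \<Rightarrow> (complex^'v) set" where
  "zero_locus blk S = {x \<in> mproj blk. \<forall>p\<in>S. peval p x = 0}"

definition zariski_closed :: "('v \<Rightarrow> 'b) \<Rightarrow> (complex^('v::finite)) set \<Rightarrow> bool" where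
  "zariski_closed blk Z \<longleftrightarrow> (\<exists>S. (\<forall>p\<in>S. \<exists>d. multihom blk d p) \<and> Z = zero_locus blk S)"

definition zariski_closure :: "('v \<Rightarrow> 'b) \<Rightarrow> (complex^('v::finite)) set \<Rightarrow> (complex^'v) set" where
  "zariski_closure blk A = \<Inter>{Z. zariski_closed blk Z \<and> A \<subseteq> Z}"

text \<open>The ideal generated by \<open>G\<close>: the span of \<open>G\<close> in the ring viewed as a module over itself.\<close>

definition gen_ideal :: "('v cpoly) set \<Rightarrow> ('v cpoly) set" where
  "gen_ideal G = module.span (*) G"

text \<open>
  Saturation \<open>I : B\<^sup>\<infinity>\<close> with respect to the irrelevant ideal \<open>B\<close>, which is generated by the
  products of one coordinate from each block.  Two multihomogeneous ideals define the same closed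
  subscheme of the product of projective spaces iff they have the same saturation.
\<close>

definition saturation :: "('v \<Rightarrow> 'b::finite) \<Rightarrow> ('v cpoly) set \<Rightarrow> ('v cpoly) set" where
  "saturation blk I =
     {p. \<forall>c. (\<forall>b. blk (c b) = b) \<longrightarrow> (\<exists>n. (\<Prod>b\<in>UNIV. Var (c b)) ^ n * p \<in> I)}"

definition same_subscheme ::
    "('v \<Rightarrow> 'b::finite) \<Rightarrow> ('v cpoly) set \<Rightarrow> ('v cpoly) set \<Rightarrow> bool" where
  "same_subscheme blk I J \<longleftrightarrow> saturation blk I = saturation blk J"


subsection \<open>Rational maps\<close>

text \<open>
  A rational map is represented by a family \<open>F\<close> of polynomials, one for each homogeneous coordinate
  of the target.
\<close>

definition polymap :: "('w \<Rightarrow> ('v::finite) cpoly) \<Rightarrow> complex^'v \<Rightarrow> complex^('w::finite)" where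
  "polymap F x = (\<chi> w. peval (F w) x)"

definition rational_map ::
    "('v \<Rightarrow> 'b) \<Rightarrow> ('w \<Rightarrow> 'c) \<Rightarrow> ('w::finite \<Rightarrow> ('v::finite) cpoly) \<Rightarrow> bool" where
  "rational_map blkV blkW F \<longleftrightarrow>
     (\<forall>b. \<exists>d. \<forall>w. blkW w = b \<longrightarrow> multihom blkV d (F w)) \<and>
     (\<exists>x\<in>mproj blkV. polymap F x \<in> mproj blkW)"

definition same_rational_map ::
    "('w \<Rightarrow> 'c) \<Rightarrow> ('w::finite \<Rightarrow> ('v::finite) cpoly) \<Rightarrow> ('w \<Rightarrow> 'v cpoly) \<Rightarrow> bool" where
  "same_rational_map blkW F G \<longleftrightarrow> (\<forall>v w. blkW v = blkW w \<longrightarrow> F v * G w = F w * G v)"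

text \<open>The points at which no representative of the rational map is defined.\<close>

definition indeterminacy_locus ::
    "('v \<Rightarrow> 'b) \<Rightarrow> ('w \<Rightarrow> 'c) \<Rightarrow> ('w::finite \<Rightarrow> ('v::finite) cpoly) \<Rightarrow> (complex^'v) set" where
  "indeterminacy_locus blkV blkW F =
     {x \<in> mproj blkV. \<not> (\<exists>G. rational_map blkV blkW G \<and> same_rational_map blkW F G \<and>
        polymap G x \<in> mproj blkW)}"

text \<open>\<open>G\<close> after \<open>F\<close> is defined and equal to the identity on a nonempty Zariski open set.\<close>

definition left_inverse ::
    "('v \<Rightarrow> 'b) \<Rightarrow> ('w \<Rightarrow> 'c) \<Rightarrow> ('w::finite \<Rightarrow> ('v::finite) cpoly) \<Rightarrow> ('v \<Rightarrow> 'w cpoly) \<Rightarrow> bool" where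
  "left_inverse blkV blkW F G \<longleftrightarrow>
     (\<exists>Z. zariski_closed blkV Z \<and> Z \<noteq> mproj blkV \<and>
       (\<forall>x\<in>mproj blkV - Z. polymap F x \<in> mproj blkW \<and> polymap G (polymap F x) \<in> mproj blkV \<and>
          same_point blkV (polymap G (polymap F x)) x))"

definition birational_inverse ::
    "('v \<Rightarrow> 'b) \<Rightarrow> ('w \<Rightarrow> 'c) \<Rightarrow> ('w::finite \<Rightarrow> ('v::finite) cpoly) \<Rightarrow> ('v \<Rightarrow> 'w cpoly) \<Rightarrow> bool" where
  "birational_inverse blkV blkW F G \<longleftrightarrow>
     rational_map blkV blkW F \<and> rational_map blkW blkV G \<and>
     left_inverse blkV blkW F G \<and> left_inverse blkW blkV G F"

definition join_coords :: "complex^('v::finite) \<Rightarrow> complex^('w::finite) \<Rightarrow> complex^('v + 'w)" where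
  "join_coords z x = (\<chi> v. case v of Inl a \<Rightarrow> z $ a | Inr b \<Rightarrow> x $ b)"

definition graph_closure ::
    "('v \<Rightarrow> 'b) \<Rightarrow> ('w \<Rightarrow> 'c) \<Rightarrow> ('w::finite \<Rightarrow> ('v::finite) cpoly) \<Rightarrow> (complex^('v + 'w)) set" where
  "graph_closure blkV blkW F =
     zariski_closure (map_sum blkV blkW)
       {join_coords z (polymap F z) | z. z \<in> mproj blkV \<and> polymap F z \<in> mproj blkW}"

text \<open>
  The rational map \<open>F\<close> blows up the subvariety of its base locus cut out by the polynomials in \<open>I\<close>
  to \<open>S\<close>.
\<close>

definition blows_up_to ::
    "('v \<Rightarrow> 'b) \<Rightarrow> ('w \<Rightarrow> 'c) \<Rightarrow> ('w::finite \<Rightarrow> ('v::finite) cpoly) \<Rightarrow>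
     'v cpoly set \<Rightarrow> (complex^'w) set \<Rightarrow> bool" where
  "blows_up_to blkV blkW F I S \<longleftrightarrow>
     zero_locus blkV I \<subseteq> {z. polymap F z \<notin> mproj blkW} \<and>
     S = {x \<in> mproj blkW. \<exists>z\<in>zero_locus blkV I. join_coords z x \<in> graph_closure blkV blkW F}"


section \<open>The spaces \<open>P\<^sup>3\<close> and \<open>P\<^sup>1 \<times> P\<^sup>1 \<times> P\<^sup>1\<close>\<close>

text \<open>
  The coordinates of \<open>P\<^sup>3\<close> are indexed by \<^typ>\<open>4\<close>, with values 0, 1, 2, 3.  Those of
  \<open>(P\<^sup>1)\<^sup>3\<close> are indexed by \<^typ>\<open>3 \<times> 2\<close>: \<open>(0, i)\<close>, \<open>(1, i)\<close>, \<open>(2, i)\<close> stand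
  for \<open>s\<^sub>i\<close>, \<open>t\<^sub>i\<close>, \<open>u\<^sub>i\<close>.
\<close>

abbreviation P3 :: "4 \<Rightarrow> unit" where "P3 \<equiv> (\<lambda>_. ())"
abbreviation P111 :: "3 \<times> 2 \<Rightarrow> 3" where "P111 \<equiv> fst"

abbreviation rconst :: "real \<Rightarrow> 'v cpoly" where "rconst c \<equiv> Const (of_real c)"

definition linform :: "real^4 \<Rightarrow> 4 cpoly" where
  "linform n = (\<Sum>a\<in>UNIV. rconst (n $ a) * Var a)"

definition plane_of :: "real^4 \<Rightarrow> (complex^4) set" where
  "plane_of n = zero_locus P3 {linform n}"

definition surface_of :: "4 cpoly \<Rightarrow> (complex^4) set" where
  "surface_of F = zero_locus P3 {F}"

definition partial_deriv :: "4 cpoly \<Rightarrow> 4 \<Rightarrow> complex^4 \<Rightarrow> complex" where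
  "partial_deriv F a x = deriv (\<lambda>h. peval F (x + axis a h)) 0"

text \<open>Form of degree \<open>d\<close> satisfying the Jacobian criterion; it is automatically nonzero and reduced.\<close>

definition smooth_form :: "nat \<Rightarrow> 4 cpoly \<Rightarrow> bool" where
  "smooth_form d F \<longleftrightarrow>
     multihom P3 (\<lambda>_. d) F \<and> (\<forall>x\<in>surface_of F. \<exists>a. partial_deriv F a x \<noteq> 0)"

definition smooth_surface :: "nat \<Rightarrow> (complex^4) set \<Rightarrow> bool" where
  "smooth_surface d S \<longleftrightarrow> (\<exists>F. smooth_form d F \<and> S = surface_of F)"

definition pspan :: "(complex^4) set \<Rightarrow> (complex^4) set" where
  "pspan A = vec.span A - {0}"

definition is_line :: "(complex^4) set \<Rightarrow> bool" where
  "is_line L \<longleftrightarrow> (\<exists>V. vec.subspace V \<and> vec.dim V = 2 \<and> L = V - {0})"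

definition cvec :: "real^4 \<Rightarrow> complex^4" where
  "cvec v = (\<chi> a. of_real (v $ a))"


section \<open>Trilinear rational maps and their boundary\<close>

type_synonym weights = "2 \<Rightarrow> 2 \<Rightarrow> 2 \<Rightarrow> real"
type_synonym ctrl = "2 \<Rightarrow> 2 \<Rightarrow> 2 \<Rightarrow> real^4"

definition trilin :: "weights \<Rightarrow> ctrl \<Rightarrow> 4 \<Rightarrow> (3 \<times> 2) cpoly" where
  "trilin w P a = (\<Sum>i\<in>UNIV. \<Sum>j\<in>UNIV. \<Sum>k\<in>UNIV.
     rconst (w i j k * P i j k $ a) * Var (0, i) * Var (1, j) * Var (2, k))"

text \<open>
  Closure of the image of the restriction to the point \<open>(1:0)\<close> (if \<open>i = 0\<close>) or \<open>(0:1)\<close> (if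
  \<open>i = 1\<close>) of the factor \<open>b\<close>, i.e. to the vanishing of the other coordinate of that factor.
\<close>

definition bsurface :: "weights \<Rightarrow> ctrl \<Rightarrow> 3 \<Rightarrow> 2 \<Rightarrow> (complex^4) set" where
  "bsurface w P b i = zariski_closure P3
     {polymap (trilin w P) z | z. z \<in> mproj P111 \<and> z $ (b, 1 - i) = 0 \<and>
        polymap (trilin w P) z \<in> mproj P3}"

abbreviation Sigma_surface :: "weights \<Rightarrow> ctrl \<Rightarrow> 2 \<Rightarrow> (complex^4) set" where
  "Sigma_surface w P \<equiv> bsurface w P 0"
abbreviation T_surface :: "weights \<Rightarrow> ctrl \<Rightarrow> 2 \<Rightarrow> (complex^4) set" where
  "T_surface w P \<equiv> bsurface w P 1"
abbreviation Y_surface :: "weights \<Rightarrow> ctrl \<Rightarrow> 2 \<Rightarrow> (complex^4) set" where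
  "Y_surface w P \<equiv> bsurface w P 2"

definition s_line :: "ctrl \<Rightarrow> 2 \<Rightarrow> 2 \<Rightarrow> (complex^4) set" where
  "s_line P j k = pspan {cvec (P 0 j k), cvec (P 1 j k)}"

definition t_line :: "ctrl \<Rightarrow> 2 \<Rightarrow> 2 \<Rightarrow> (complex^4) set" where
  "t_line P i k = pspan {cvec (P i 0 k), cvec (P i 1 k)}"

definition u_line :: "ctrl \<Rightarrow> 2 \<Rightarrow> 2 \<Rightarrow> (complex^4) set" where
  "u_line P i j = pspan {cvec (P i j 0), cvec (P i j 1)}"

definition bline :: "ctrl \<Rightarrow> 3 \<Rightarrow> 2 \<Rightarrow> 2 \<Rightarrow> (complex^4) set" where
  "bline P b m n = (if b = 0 then s_line P m n else if b = 1 then t_line P m n else u_line P m n)"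

definition nondegenerate :: "weights \<Rightarrow> ctrl \<Rightarrow> bool" where
  "nondegenerate w P \<longleftrightarrow>
     (\<forall>b i. smooth_surface 1 (bsurface w P b i) \<or> smooth_surface 2 (bsurface w P b i)) \<and>
     inj (\<lambda>(b, i). bsurface w P b i) \<and>
     (\<forall>b m n. is_line (bline P b m n)) \<and>
     inj (\<lambda>(b, m, n). bline P b m n)"

definition ell :: "weights \<Rightarrow> ctrl \<Rightarrow> (complex^4) set" where
  "ell w P = Sigma_surface w P 0 \<inter> Sigma_surface w P 1"

text \<open>Scaffold, with distinguished parameter \<open>s\<close> and with the two transversal lines \<open>r 0\<close>, \<open>r 1\<close>.\<close>

definition scaffold :: "weights \<Rightarrow> ctrl \<Rightarrow> (2 \<Rightarrow> (complex^4) set) \<Rightarrow> bool" where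
  "scaffold w P r \<longleftrightarrow>
     (\<forall>i. smooth_surface 1 (Sigma_surface w P i)) \<and> is_line (ell w P) \<and>
     (\<forall>j. smooth_surface 2 (T_surface w P j)) \<and> (\<forall>k. smooth_surface 2 (Y_surface w P k)) \<and>
     (\<forall>l. is_line (r l)) \<and> r 0 \<noteq> r 1 \<and>
     (\<forall>l j k. r l \<inter> s_line P j k \<noteq> {}) \<and>
     (\<forall>l. r l \<inter> ell w P \<noteq> {})"

definition y_line :: "ctrl \<Rightarrow> (complex^4) set" where
  "y_line P = pspan ((u_line P 0 0 \<inter> u_line P 0 1) \<union> (u_line P 1 0 \<inter> u_line P 1 1))"

definition z_line :: "ctrl \<Rightarrow> (complex^4) set" where
  "z_line P = pspan ((t_line P 0 0 \<inter> t_line P 0 1) \<union> (t_line P 1 0 \<inter> t_line P 1 1))"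

definition Delta :: "real^4 \<Rightarrow> real^4 \<Rightarrow> real" where
  "Delta n p = 1 / (n \<bullet> p)"

text \<open>
  The linear form \<open>v\<^sub>0 z\<^sub>0 + v\<^sub>1 z\<^sub>1\<close> in the coordinates of the factor \<open>b\<close>.

  Pitfall: if the weights are \<open>\<alpha>\<^sub>i\<^sub>l \<beta>\<^sub>j\<^sub>l \<gamma>\<^sub>k\<^sub>2 \<Delta>\<^sub>i\<^sub>j\<^sub>k(l,y)\<close> and
  \<open>\<alpha>\<^sub>i\<^sub>l \<beta>\<^sub>j\<^sub>2 \<gamma>\<^sub>k\<^sub>l \<Delta>\<^sub>i\<^sub>j\<^sub>k(l,z)\<close>, then \<open>\<theta>\<^sub>l\<close> and \<open>\<rho>\<^sub>l\<close> pull back along the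
  trilinear map to \<open>a\<^sub>l b\<^sub>l c\<^sub>2\<close> and \<open>a\<^sub>l b\<^sub>2 c\<^sub>l\<close>.  Hence the isolated base points
  are \<open>(a\<^sub>0, b\<^sub>1, c\<^sub>1)\<close> and \<open>(a\<^sub>1, b\<^sub>0, c\<^sub>0)\<close>; at the point
  \<open>(a\<^sub>0, b\<^sub>0, c\<^sub>0)\<close> the form \<open>a\<^sub>1 b\<^sub>1 c\<^sub>2\<close> or the form
  \<open>a\<^sub>1 b\<^sub>2 c\<^sub>1\<close> does not vanish.
\<close>

definition facform :: "3 \<Rightarrow> real^2 \<Rightarrow> (3 \<times> 2) cpoly" where
  "facform b v = (\<Sum>e\<in>UNIV. rconst (v $ e) * Var (b, e))"

text \<open>
  The family of forms representing the inverse map,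
  \<open>(\<alpha>\<^sub>1 \<lambda>\<^sub>1 \<sigma>\<^sub>1 : \<alpha>\<^sub>0 \<lambda>\<^sub>0 \<sigma>\<^sub>0) \<times> (\<beta>\<^sub>1 \<mu>\<^sub>1 \<tau>\<^sub>1 : \<beta>\<^sub>0 \<mu>\<^sub>0 \<tau>\<^sub>0) \<times>
  (\<gamma>\<^sub>1 \<nu>\<^sub>1 \<upsilon>\<^sub>1 : \<gamma>\<^sub>0 \<nu>\<^sub>0 \<upsilon>\<^sub>0)\<close>.
\<close>

definition inv_factor :: "real^2 \<Rightarrow> real^2 \<Rightarrow> (2 \<Rightarrow> 4 cpoly) \<Rightarrow> 2 \<Rightarrow> 4 cpoly" where
  "inv_factor v l F e = rconst (v $ (1 - e) * l $ (1 - e)) * F (1 - e)"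

definition inv_forms ::
    "real^2 \<Rightarrow> real^2 \<Rightarrow> (2 \<Rightarrow> 4 cpoly) \<Rightarrow> real^2 \<Rightarrow> real^2 \<Rightarrow> (2 \<Rightarrow> 4 cpoly) \<Rightarrow>
     real^2 \<Rightarrow> real^2 \<Rightarrow> (2 \<Rightarrow> 4 cpoly) \<Rightarrow> 3 \<times> 2 \<Rightarrow> 4 cpoly" where
  "inv_forms \<alpha> l \<sigma> \<beta> \<mu> \<tau> \<gamma> \<nu> \<upsilon> = (\<lambda>(b, e).
     if b = 0 then inv_factor \<alpha> l \<sigma> e
     else if b = 1 then inv_factor \<beta> \<mu> \<tau> e
     else inv_factor \<gamma> \<nu> \<upsilon> e)"

end

theory Submission
  imports Defs "HOL-Computational_Algebra.Fundamental_Theorem_Algebra"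
begin

text \<open>
  Pulled back along \<open>\<phi>\<close>, the linear forms of the planes \<open>\<Theta>\<^sub>0, \<Theta>\<^sub>1, P\<^sub>0, P\<^sub>1\<close> become
  \<open>a\<^sub>0b\<^sub>0c\<^sub>2, a\<^sub>1b\<^sub>1c\<^sub>2, a\<^sub>0b\<^sub>2c\<^sub>0, a\<^sub>1b\<^sub>2c\<^sub>1\<close>.  If these four forms are coordinates \<open>A, B, C, D\<close> of
  \<open>P\<^sup>3\<close>, write \<open>b\<^sub>1 = y\<^sub>1b\<^sub>0 + xb\<^sub>2\<close> and \<open>c\<^sub>1 = z\<^sub>1c\<^sub>0 + yc\<^sub>2\<close>.  The forms \<open>U = yy\<^sub>1A - xz\<^sub>1C\<close>,
  \<open>V = yB - xD\<close> and \<open>Q = y\<^sub>1AD - z\<^sub>1BC\<close> pull back to \<open>a\<^sub>0E\<close>, \<open>a\<^sub>1E\<close> and \<open>a\<^sub>0a\<^sub>1b\<^sub>2c\<^sub>2E\<close> for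
  \<open>E = yy\<^sub>1b\<^sub>0c\<^sub>2 - xz\<^sub>1b\<^sub>2c\<^sub>0\<close>, so that the inverse is \<open>(a\<^sub>0:a\<^sub>1) = (U:V)\<close>, \<open>(b\<^sub>0:b\<^sub>2) = (AV:Q)\<close>,
  \<open>(c\<^sub>0:c\<^sub>2) = (CV:Q)\<close>, and all claims become explicit.  At most one of \<open>x\<close>, \<open>y\<close> may vanish:
  then the two isolated base points share a coordinate, and the line \<open>s\<close> is the line \<open>y\<close> or \<open>z\<close>.

  That \<open>A, B, C, D\<close> are coordinates is forced by the quadric.  The lines \<open>y\<close>, \<open>z\<close> on the given
  planes make \<open>\<phi>\<close> vanish on \<open>b\<^sub>2 = c\<^sub>2 = 0\<close>, and \<open>\<phi>\<close> maps \<open>a\<^sub>l = 0\<close> onto \<open>r\<^sub>l\<close>.  All quadrics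
  of the two pencils contain \<open>r\<^sub>0\<close> and \<open>r\<^sub>1\<close>, and if the coordinates were dependent, those in both
  pencils would be singular.
\<close>

section \<open>Polynomials and polynomial functions\<close>

text \<open>\<open>Delta\<close> is a reciprocal, so contracting theta_l or rho_l with a weighted
  control point cancels it and leaves one factor per index. That is why these planes pull back to
  products of three linear forms. An inverse that is linear on the first factor needs a pencil of
  planes. A and C are divisible by a_0, B and D by a_1; the coefficients of U and V are chosen so
  that the terms x y b_2 c_2 cancel and the two cofactors agree. The scalar x vanishes when b_0 and
  b_1 have the same zero, y when c_0 and c_1 do. If both vanished, the corners of Sigma_0 would
  satisfy two independent linear equations although they span a plane. The obstacle is that A, B, C,
  D are not assumed independent. This reduces to one fact on each r_l: the points where it meets the
  lines y and z are different. Only smoothness of Q gives it. Questions about closures and common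
  factors are settled by restriction to polynomial curves: C[t] is a domain, and a polynomial that
  vanishes off a finite set is zero.\<close>

lemma two_eq_zero: "(2::2) = 0" and three_eq_zero: "(3::3) = 0" and four_eq_zero: "(4::4) = 0"
  by simp_all

lemma sum_two: "sum f (UNIV :: 2 set) = f 0 + f 1"
  using sum_2[of f] by (simp only: two_eq_zero add.commute)

lemma all_two: "(\<forall>i::2. Q i) \<longleftrightarrow> Q 0 \<and> Q 1"
  using forall_2[of Q] by (simp only: two_eq_zero conj_commute)

lemma all_three: "(\<forall>i::3. Q i) \<longleftrightarrow> Q 0 \<and> Q 1 \<and> Q 2"
  using forall_3[of Q] by (simp only: three_eq_zero conj_ac)

definition monom_eval :: "('v::finite \<Rightarrow>\<^sub>0 nat) \<Rightarrow> complex^'v \<Rightarrow> complex" where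
  "monom_eval m x = (\<Prod>v\<in>UNIV. (x $ v) ^ Poly_Mapping.lookup m v)"

lemma monom_eval_add: "monom_eval (m + n) x = monom_eval m x * monom_eval n x"
  by (simp add: monom_eval_def lookup_add power_add prod.distrib)

lemma monom_eval_zero [simp]: "monom_eval 0 x = 1"
  by (simp add: monom_eval_def)

lemma monom_eval_single: "monom_eval (Poly_Mapping.single v k) x = (x $ v) ^ k"
proof -
  have "monom_eval (Poly_Mapping.single v k) x = (\<Prod>u\<in>UNIV. if u = v then (x $ v) ^ k else 1)"
    unfolding monom_eval_def by (rule prod.cong) (auto simp: lookup_single when_def)
  then show ?thesis by simp
qed

lemma peval_superset:
  assumes "finite S" "Poly_Mapping.keys p \<subseteq> S"
  shows "peval p x = (\<Sum>m\<in>S. Poly_Mapping.lookup p m * monom_eval m x)"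
  unfolding peval_def monom_eval_def
  by (rule sum.mono_neutral_left) (use assms in \<open>auto simp: in_keys_iff\<close>)

lemma peval_zero [simp]: "peval 0 x = 0"
  by (simp add: peval_def)

lemma peval_single: "peval (Poly_Mapping.single m c) x = c * monom_eval m x"
  by (subst peval_superset[of "{m}"]) auto

lemma peval_Const [simp]: "peval (Const c) x = c"
  by (simp add: Const_def peval_single)

lemma peval_Var [simp]: "peval (Var v) x = x $ v"
  by (simp add: Var_def peval_single monom_eval_single)

lemma peval_add [simp]: "peval (p + q) x = peval p x + peval q x"
proof -
  let ?S = "Poly_Mapping.keys p \<union> Poly_Mapping.keys q"
  have "peval (p + q) x = (\<Sum>m\<in>?S. Poly_Mapping.lookup (p + q) m * monom_eval m x)"
    by (rule peval_superset) (auto simp: Poly_Mapping.keys_add)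
  also have "\<dots> = peval p x + peval q x"
    by (simp add: lookup_add distrib_right sum.distrib peval_superset[of ?S])
  finally show ?thesis .
qed

lemma peval_uminus [simp]: "peval (- p) x = - peval p x"
  using peval_add[of p "- p" x] by (simp add: eq_neg_iff_add_eq_0 add.commute)

lemma peval_diff [simp]: "peval (p - q) x = peval p x - peval q x"
  using peval_add[of p "- q" x] by simp

lemma peval_sum: "peval (sum f A) x = (\<Sum>a\<in>A. peval (f a) x)"
  by (induction A rule: infinite_finite_induct) auto

lemma sum_singles: "(\<Sum>m\<in>Poly_Mapping.keys p. Poly_Mapping.single m (Poly_Mapping.lookup p m)) = p"
proof (rule poly_mapping_eqI)
  fix k
  show "Poly_Mapping.lookup (\<Sum>m\<in>Poly_Mapping.keys p. Poly_Mapping.single m (Poly_Mapping.lookup p m)) k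
      = Poly_Mapping.lookup p k"
  proof -
    have "(\<Sum>m\<in>Poly_Mapping.keys p. Poly_Mapping.lookup (Poly_Mapping.single m (Poly_Mapping.lookup p m)) k)
        = (\<Sum>m\<in>Poly_Mapping.keys p. if m = k then Poly_Mapping.lookup p k else 0)"
      by (rule sum.cong) (auto simp: lookup_single when_def)
    also have "\<dots> = Poly_Mapping.lookup p k"
      by (simp add: in_keys_iff)
    finally show ?thesis by (simp add: lookup_sum)
  qed
qed

lemma peval_mult [simp]: "peval (p * q) x = peval p x * peval q x"
proof -
  have *: "peval (Poly_Mapping.single m c * q) x = c * monom_eval m x * peval q x" for m c
  proof -
    have "Poly_Mapping.single m c * q
        = (\<Sum>n\<in>Poly_Mapping.keys q. Poly_Mapping.single m c * Poly_Mapping.single n (Poly_Mapping.lookup q n))"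
      by (subst sum_singles[of q, symmetric]) (simp add: sum_distrib_left)
    then have "peval (Poly_Mapping.single m c * q) x
        = (\<Sum>n\<in>Poly_Mapping.keys q. c * Poly_Mapping.lookup q n * monom_eval (m + n) x)"
      by (simp add: peval_sum mult_single peval_single)
    also have "\<dots> = c * monom_eval m x * peval q x"
      by (simp add: peval_superset[of "Poly_Mapping.keys q"] sum_distrib_left monom_eval_add mult_ac)
    finally show ?thesis .
  qed
  have "p * q = (\<Sum>m\<in>Poly_Mapping.keys p. Poly_Mapping.single m (Poly_Mapping.lookup p m) * q)"
    by (subst sum_singles[of p, symmetric]) (simp add: sum_distrib_right)
  then have "peval (p * q) x
      = (\<Sum>m\<in>Poly_Mapping.keys p. Poly_Mapping.lookup p m * monom_eval m x * peval q x)"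
    by (simp add: peval_sum *)
  also have "\<dots> = peval p x * peval q x"
    by (simp add: peval_superset[of "Poly_Mapping.keys p"] sum_distrib_right)
  finally show ?thesis .
qed

text \<open>Dedekind's argument for the independence of characters.\<close>

lemma monom_eval_independent:
  assumes "finite S" "\<And>x. (\<Sum>m\<in>S. c m * monom_eval m x) = 0" "m \<in> S"
  shows "c m = 0"
  using assms
proof (induction "card S" arbitrary: S c m)
  case 0
  then show ?case by simp
next
  case (Suc n)
  have vanish: "c m' = 0" if "m' \<in> S" "m' \<noteq> m0" "m0 \<in> S" for m' m0
  proof -
    obtain v where v: "Poly_Mapping.lookup m' v \<noteq> Poly_Mapping.lookup m0 v"
      using poly_mapping_eqI[of m' m0] \<open>m' \<noteq> m0\<close> by auto
    define x0 :: "complex^'a" where "x0 = (\<chi> u. if u = v then 2 else 1)"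
    have x0: "monom_eval k x0 = 2 ^ Poly_Mapping.lookup k v" for k
    proof -
      have "monom_eval k x0 = (\<Prod>u\<in>UNIV. if u = v then 2 ^ Poly_Mapping.lookup k v else 1)"
        unfolding monom_eval_def by (rule prod.cong) (auto simp: x0_def)
      then show ?thesis by simp
    qed
    have neq: "monom_eval m' x0 \<noteq> monom_eval m0 x0"
    proof -
      have "(2::nat) ^ Poly_Mapping.lookup m' v \<noteq> 2 ^ Poly_Mapping.lookup m0 v"
        using v by simp
      then have "of_nat (2 ^ Poly_Mapping.lookup m' v) \<noteq> (of_nat (2 ^ Poly_Mapping.lookup m0 v) :: complex)"
        unfolding of_nat_eq_iff .
      then show ?thesis by (simp add: x0)
    qed
    let ?c = "\<lambda>k. c k * (monom_eval k x0 - monom_eval m0 x0)"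
    have "(\<Sum>k\<in>S - {m0}. ?c k * monom_eval k x) = 0" for x
    proof -
      have pt: "monom_eval k (\<chi> u. x0 $ u * x $ u) = monom_eval k x0 * monom_eval k x" for k
        by (simp add: monom_eval_def power_mult_distrib prod.distrib)
      have "(\<Sum>k\<in>S. ?c k * monom_eval k x)
          = (\<Sum>k\<in>S. c k * monom_eval k (\<chi> u. x0 $ u * x $ u)) - monom_eval m0 x0 * (\<Sum>k\<in>S. c k * monom_eval k x)"
        unfolding pt sum_distrib_left sum_subtractf[symmetric]
        by (rule sum.cong) (auto simp: algebra_simps)
      also have "\<dots> = 0" using Suc.prems(2) by simp
      finally have "(\<Sum>k\<in>S. ?c k * monom_eval k x) = 0" .
      moreover have "(\<Sum>k\<in>S. ?c k * monom_eval k x) = (\<Sum>k\<in>S - {m0}. ?c k * monom_eval k x)"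
        by (rule sum.mono_neutral_right) (use Suc.prems(1) in auto)
      ultimately show ?thesis by simp
    qed
    moreover have "n = card (S - {m0})" "finite (S - {m0})" "m' \<in> S - {m0}"
      using Suc.hyps(2) Suc.prems(1) that by simp_all
    ultimately have "?c m' = 0"
      using Suc.hyps(1)[of "S - {m0}" ?c m'] by blast
    then show ?thesis using neq by simp
  qed
  show ?case
  proof (cases "S = {m}")
    case True
    then show ?thesis
      using Suc.prems(2)[of "\<chi> _. 1"] by (simp add: monom_eval_def)
  next
    case False
    then obtain m0 where "m0 \<in> S" "m \<noteq> m0" using Suc.prems(3) by auto
    then show ?thesis using vanish Suc.prems(3) by blast
  qed
qed

text \<open>The field is infinite, so values determine a polynomial. The polynomial identities
  behind the ideal memberships below are thereby checked pointwise.\<close>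

lemma cpoly_eqI:
  assumes "\<And>x. peval p x = peval q x"
  shows "p = q"
proof -
  have "(\<Sum>m\<in>Poly_Mapping.keys (p - q). Poly_Mapping.lookup (p - q) m * monom_eval m x) = 0" for x
    using assms peval_superset[of "Poly_Mapping.keys (p - q)" "p - q" x] by simp
  then have "Poly_Mapping.lookup (p - q) m = 0" for m
    using monom_eval_independent[of "Poly_Mapping.keys (p - q)" "Poly_Mapping.lookup (p - q)" m]
    by (cases "m \<in> Poly_Mapping.keys (p - q)") (auto simp: in_keys_iff)
  then have "p - q = 0" by (intro poly_mapping_eqI) simp
  then show ?thesis by simp
qed

section \<open>Restriction of polynomials to curves\<close>

lemma peval_poly_curve:
  obtains Q where "\<And>t. poly Q t = peval p (\<chi> v. poly (g v) t)"
proof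
  show "poly (\<Sum>m\<in>Poly_Mapping.keys p. [:Poly_Mapping.lookup p m:] *
      (\<Prod>v\<in>UNIV. g v ^ Poly_Mapping.lookup m v)) t = peval p (\<chi> v. poly (g v) t)" for t
    by (simp add: peval_def poly_sum poly_prod)
qed

lemma peval_line:
  obtains Q where "\<And>t. poly Q t = peval p (u + t *s v)"
proof -
  obtain Q where "\<And>t. poly Q t = peval p (\<chi> i. poly [:u $ i, v $ i:] t)"
    using peval_poly_curve[where g="\<lambda>i. [:u $ i, v $ i:]" and p=p] by blast
  moreover have "(\<chi> i. poly [:u $ i, v $ i:] t) = u + t *s v" for t
    by (simp add: vec_eq_iff)
  ultimately show ?thesis using that[of Q] by metis
qed

lemma poly_zero_of_cofinite:
  fixes Q :: "complex poly"
  assumes "finite S" "\<And>t. t \<notin> S \<Longrightarrow> poly Q t = 0"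
  shows "Q = 0"
proof (rule ccontr)
  assume "Q \<noteq> 0"
  then have "finite {t. poly Q t = 0}" by (rule poly_roots_finite)
  moreover have "UNIV = S \<union> {t. poly Q t = 0}" using assms(2) by auto
  ultimately have "finite (UNIV :: complex set)" using assms(1) by (metis finite_UnI)
  then show False by (simp add: infinite_UNIV_char_0)
qed

section \<open>Multihomogeneous polynomials\<close>

lemma multihom_Const_mult:
  assumes "multihom blk d p"
  shows "multihom blk d (Const c * p)"
proof -
  have "Poly_Mapping.keys (Const c * p) \<subseteq> Poly_Mapping.keys p"
    using keys_mult[of "Const c" p] by (auto simp: Const_def split: if_splits)
  then show ?thesis using assms by (auto simp: multihom_def)
qed

lemma multihom_zero [simp]: "multihom blk d 0"
  by (simp add: multihom_def)

lemma multihom_add: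
  assumes "multihom blk d p" "multihom blk d q"
  shows "multihom blk d (p + q)"
  using assms Poly_Mapping.keys_add[of p q] by (auto simp: multihom_def)

lemma multihom_sum:
  assumes "\<And>a. a \<in> A \<Longrightarrow> multihom blk d (f a)"
  shows "multihom blk d (sum f A)"
  using assms by (induction A rule: infinite_finite_induct) (auto intro: multihom_add)

lemma multihom_diff:
  assumes "multihom blk d p" "multihom blk d q"
  shows "multihom blk d (p - q)"
proof -
  have "p - q = p + Const (- 1) * q" by (rule cpoly_eqI) simp
  then show ?thesis using assms by (metis multihom_add multihom_Const_mult)
qed

lemma multihom_mult:
  assumes "multihom blk d p" "multihom blk e q"
  shows "multihom blk (\<lambda>b. d b + e b) (p * q)"
  unfolding multihom_def
proof (intro ballI allI)
  fix m b assume "m \<in> Poly_Mapping.keys (p * q)"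
  then obtain m1 m2 where "m1 \<in> Poly_Mapping.keys p" "m2 \<in> Poly_Mapping.keys q" "m = m1 + m2"
    using keys_mult[of p q] by auto
  then show "(\<Sum>v | blk v = b. Poly_Mapping.lookup m v) = d b + e b"
    using assms by (simp add: multihom_def lookup_add sum.distrib)
qed

lemma multihom_Var: "multihom blk (\<lambda>b. if b = blk v then 1 else 0) (Var v)"
proof -
  have "(\<Sum>u | blk u = b. Poly_Mapping.lookup (Poly_Mapping.single v (1::nat)) u)
      = (if b = blk v then 1 else 0)" for b
  proof -
    have "(\<Sum>u | blk u = b. Poly_Mapping.lookup (Poly_Mapping.single v (1::nat)) u)
       = (\<Sum>u | blk u = b. if u = v then 1 else 0)"
      by (rule sum.cong) (auto simp: lookup_single when_def)
    also have "\<dots> = (if b = blk v then 1 else 0)" by (auto simp: sum.delta)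
    finally show ?thesis .
  qed
  then show ?thesis by (simp add: multihom_def Var_def)
qed

lemma peval_scale:
  fixes blk :: "'v::finite \<Rightarrow> 'b::finite"
  assumes "multihom blk d p"
  shows "peval p (\<chi> v. c (blk v) * x $ v) = (\<Prod>b\<in>UNIV. c b ^ d b) * peval p x"
proof -
  have "monom_eval m (\<chi> v. c (blk v) * x $ v) = (\<Prod>b\<in>UNIV. c b ^ d b) * monom_eval m x"
    if "m \<in> Poly_Mapping.keys p" for m
  proof -
    have "(\<Prod>v\<in>UNIV. c (blk v) ^ Poly_Mapping.lookup m v)
        = (\<Prod>b\<in>UNIV. \<Prod>v | v \<in> UNIV \<and> blk v = b. c (blk v) ^ Poly_Mapping.lookup m v)"
      by (rule prod.group[symmetric]) auto
    also have "\<dots> = (\<Prod>b\<in>UNIV. c b ^ d b)"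
    proof (rule prod.cong)
      fix b
      have "(\<Prod>v | v \<in> UNIV \<and> blk v = b. c (blk v) ^ Poly_Mapping.lookup m v)
          = (\<Prod>v | blk v = b. c b ^ Poly_Mapping.lookup m v)"
        by (rule prod.cong) auto
      also have "\<dots> = c b ^ (\<Sum>v | blk v = b. Poly_Mapping.lookup m v)"
        by (simp add: power_sum)
      also have "\<dots> = c b ^ d b" using assms that by (simp add: multihom_def)
      finally show "(\<Prod>v | v \<in> UNIV \<and> blk v = b. c (blk v) ^ Poly_Mapping.lookup m v) = c b ^ d b" .
    qed simp
    finally show ?thesis
      by (simp add: monom_eval_def power_mult_distrib prod.distrib)
  qed
  then show ?thesis
    by (simp add: peval_superset[of "Poly_Mapping.keys p"] sum_distrib_left mult_ac)
qed

section \<open>Linear and quadratic forms\<close>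

definition cdot :: "complex^'n \<Rightarrow> complex^'n \<Rightarrow> complex" where
  "cdot n x = (\<Sum>a\<in>UNIV. n $ a * x $ a)"

lemma cdot_add [simp]: "cdot n (x + y) = cdot n x + cdot n y" "cdot (m + n) x = cdot m x + cdot n x"
  by (simp_all add: cdot_def algebra_simps sum.distrib)

lemma cdot_diff [simp]: "cdot n (x - y) = cdot n x - cdot n y" "cdot (m - n) x = cdot m x - cdot n x"
  by (simp_all add: cdot_def algebra_simps sum_subtractf)

lemma cdot_scale [simp]: "cdot n (c *s x) = c * cdot n x" "cdot (c *s n) x = c * cdot n x"
  by (simp_all add: cdot_def sum_distrib_left mult_ac)

lemma cdot_zero [simp]: "cdot n 0 = 0" "cdot 0 x = 0"
  by (simp_all add: cdot_def)

lemma cdot_sum: "cdot n (sum f A) = (\<Sum>a\<in>A. cdot n (f a))"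
  by (induction A rule: infinite_finite_induct) auto

lemma cdot_axis [simp]: "cdot n (axis a 1) = n $ a"
  by (simp add: cdot_def axis_def if_distrib[of "\<lambda>c. _ * c"] cong: if_cong)

lemma cdot_eq_0_imp: "(\<And>x. cdot n x = 0) \<Longrightarrow> n = 0"
  by (subst vec_eq_iff) (metis cdot_axis zero_index)

section \<open>Duality between vectors and linear functionals\<close>

lemma cdot_proportional:
  assumes "\<And>x. x \<noteq> 0 \<Longrightarrow> cdot m x = 0 \<Longrightarrow> cdot n x = 0"
  shows "\<exists>k. n = k *s m"
proof (cases "m = 0")
  case True
  then have "cdot n x = 0" for x using assms[of x] by (cases "x = 0") auto
  then have "n = 0" by (rule cdot_eq_0_imp)
  then show ?thesis by (metis vector_smult_lzero)
next
  case False
  then obtain a where a: "m $ a \<noteq> 0" by (auto simp: vec_eq_iff)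
  have "n $ b = n $ a / m $ a * m $ b" for b
  proof -
    let ?v = "m $ a *s axis b 1 - m $ b *s axis a 1"
    have "cdot n ?v = 0"
    proof (cases "?v = 0")
      case True
      show ?thesis unfolding True by simp
    next
      case False
      show ?thesis by (rule assms[OF False]) simp
    qed
    then show ?thesis using a by (simp add: field_simps)
  qed
  then have "n = (n $ a / m $ a) *s m" unfolding vec_eq_iff vector_smult_component by blast
  then show ?thesis ..
qed

text \<open>The index type is a second type of the same cardinality, so that four vectors of C^4 can
  be indexed by pairs. A bijection \<open>h\<close> makes them the rows of a square matrix; trivial
  kernel, independent rows and surjectivity are then all invertibility.\<close>

lemma annihilator_iff_independent:
  fixes v :: "'i::finite \<Rightarrow> complex^'n"
  assumes card: "CARD('i) = CARD('n)"
  shows "(\<forall>n. (\<forall>i. cdot n (v i) = 0) \<longrightarrow> n = 0) \<longleftrightarrow>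
         (\<forall>c. (\<Sum>i\<in>UNIV. c i *s v i) = 0 \<longrightarrow> (\<forall>i. c i = 0))" (is ?equiv)
    and "(\<forall>n. (\<forall>i. cdot n (v i) = 0) \<longrightarrow> n = 0) \<Longrightarrow> \<exists>c. x = (\<Sum>i\<in>UNIV. c i *s v i)"
    and "(\<forall>n. (\<forall>i. cdot n (v i) = 0) \<longrightarrow> n = 0) \<Longrightarrow> \<exists>n. \<forall>i. cdot n (v i) = d i"
proof -
  obtain h :: "'n \<Rightarrow> 'i" where h: "bij h"
    using finite_same_card_bij[OF finite finite, of "UNIV :: 'n set" "UNIV :: 'i set"] card by metis
  define M :: "complex^'n^'n" where "M = (\<chi> i. v (h i))"
  have Mn: "M *v n = (\<chi> i. cdot n (v (h i)))" for n
    by (simp add: M_def matrix_vector_mult_def cdot_def vec_eq_iff mult.commute)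
  have ker: "(\<forall>n. M *v n = 0 \<longrightarrow> n = 0) \<longleftrightarrow> (\<forall>n. (\<forall>i. cdot n (v i) = 0) \<longrightarrow> n = 0)"
    unfolding Mn by (simp add: vec_eq_iff) (metis h bij_pointE)
  have sums: "(\<Sum>i\<in>UNIV. c (h i) *s v (h i)) = (\<Sum>i\<in>UNIV. c i *s v i)" for c
    by (rule sum.reindex_bij_betw) (use h in simp)
  have row: "row i M = v (h i)" for i
    by (simp add: row_def M_def)
  have inv: "(\<forall>n. M *v n = 0 \<longrightarrow> n = 0) \<longleftrightarrow> invertible M"
    by (simp add: invertible_left_inverse matrix_left_invertible_ker)
  have ind: "invertible M \<longleftrightarrow> (\<forall>c. (\<Sum>i\<in>UNIV. c i *s row i M) = 0 \<longrightarrow> (\<forall>i. c i = 0))"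
    by (simp add: invertible_right_inverse matrix_right_invertible_independent_rows)
  have "(\<forall>c. (\<Sum>i\<in>UNIV. c i *s row i M) = 0 \<longrightarrow> (\<forall>i. c i = 0)) \<longleftrightarrow>
        (\<forall>c. (\<Sum>i\<in>UNIV. c i *s v i) = 0 \<longrightarrow> (\<forall>i. c i = 0))"
  proof (intro iffI allI impI)
    fix c i assume *: "\<forall>c. (\<Sum>i\<in>UNIV. c i *s row i M) = 0 \<longrightarrow> (\<forall>i. c i = 0)"
      and "(\<Sum>i\<in>UNIV. c i *s v i) = 0"
    then have "(\<Sum>i\<in>UNIV. (c \<circ> h) i *s row i M) = 0" using sums[of c] by (simp add: row)
    then have "\<forall>i. (c \<circ> h) i = 0" using * by blast
    then show "c i = 0" by (metis h bij_pointE comp_apply)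
  next
    fix c i assume *: "\<forall>c. (\<Sum>i\<in>UNIV. c i *s v i) = 0 \<longrightarrow> (\<forall>i. c i = 0)"
      and "(\<Sum>i\<in>UNIV. c i *s row i M) = 0"
    then have "(\<Sum>i\<in>UNIV. (c \<circ> inv h) i *s v i) = 0"
      using sums[of "c \<circ> inv h"] h by (simp add: row bij_is_inj)
    then have "\<forall>i. (c \<circ> inv h) i = 0" using * by blast
    then show "c i = 0" by (metis h bij_is_inj comp_apply inv_f_f)
  qed
  then show ?equiv using ker inv ind by blast
  assume "\<forall>n. (\<forall>i. cdot n (v i) = 0) \<longrightarrow> n = 0"
  then have M: "invertible M" using ker inv by blast
  then have "surj ((*v) M)"
    by (simp add: invertible_right_inverse matrix_right_invertible_surjective)
  then obtain n where "(\<chi> i. d (h i)) = M *v n" by (rule surjE)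
  then have "cdot n (v (h i)) = d (h i)" for i unfolding Mn by (simp add: vec_eq_iff)
  then show "\<exists>n. \<forall>i. cdot n (v i) = d i" by (metis h bij_pointE)
  have "\<exists>B. transpose M ** B = mat 1"
    using M by (simp add: right_invertible_transpose invertible_left_inverse)
  then have "surj ((*v) (transpose M))" by (simp add: matrix_right_invertible_surjective)
  then obtain c where c: "x = transpose M *v c" by (rule surjE)
  have "x = (\<Sum>i\<in>UNIV. (($) c \<circ> inv h) (h i) *s v (h i))"
    using h unfolding c by (simp add: M_def matrix_vector_mult_def transpose_def vec_eq_iff bij_is_inj mult.commute)
  then show "\<exists>c. x = (\<Sum>i\<in>UNIV. c i *s v i)" unfolding sums by blast
qed

lemma span_pair: "vec.span {x, y} = {c *s x + d *s y | c d. True}" for x y :: "complex^'n"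
  by (auto simp: vec.span_insert vec.span_singleton algebra_simps)

lemma subspace_dim2_pair:
  fixes V :: "(complex^'n) set"
  assumes "vec.subspace V" "vec.dim V = 2" "x \<in> V" "y \<in> V"
    and ind: "\<And>c d. c *s x + d *s y = 0 \<Longrightarrow> c = 0 \<and> d = 0"
    and "z \<in> V"
  shows "\<exists>c d. z = c *s x + d *s y"
proof -
  have xy: "x \<noteq> y" using ind[of 1 "-1"] by auto
  have "y \<noteq> 0" using ind[of 0 1] by auto
  moreover have "x \<notin> vec.span {y}"
  proof
    assume "x \<in> vec.span {y}"
    then obtain k where "x = k *s y" by (auto simp: vec.span_singleton)
    then show False using ind[of 1 "-k"] by simp
  qed
  ultimately have "vec.independent {x, y}"
    by (simp add: vec.independent_insert xy)
  then have "V \<subseteq> vec.span {x, y}"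
    using assms xy by (intro vec.card_ge_dim_independent) auto
  then show ?thesis using \<open>z \<in> V\<close> unfolding span_pair by auto
qed

section \<open>Symmetric bilinear forms, quadrics and smoothness\<close>

definition sbilinear :: "(complex^'n \<Rightarrow> complex^'n \<Rightarrow> complex) \<Rightarrow> bool" where
  "sbilinear B \<longleftrightarrow> (\<forall>x y. B x y = B y x) \<and> (\<forall>x y z. B (x + y) z = B x z + B y z) \<and>
     (\<forall>c x y. B (c *s x) y = c * B x y)"

lemma sbilinearD:
  assumes "sbilinear B"
  shows "B (x + y) z = B x z + B y z" "B z (x + y) = B z x + B z y"
    "B (c *s x) y = c * B x y" "B y (c *s x) = c * B y x" "B 0 x = 0" "B x 0 = 0"
proof -
  note S = assms[unfolded sbilinear_def]
  show "B (x + y) z = B x z + B y z" "B z (x + y) = B z x + B z y"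
    "B (c *s x) y = c * B x y" "B y (c *s x) = c * B y x" using S by metis+
  show "B 0 x = 0" "B x 0 = 0" using S by (metis vector_smult_lzero mult_zero_left)+
qed

lemma sbilinear_sym: "sbilinear B \<Longrightarrow> B x y = B y x"
  by (simp add: sbilinear_def)

lemma monom_degree_pos:
  fixes m :: "'v::finite \<Rightarrow>\<^sub>0 nat"
  assumes "(\<Sum>v\<in>UNIV. Poly_Mapping.lookup m v) = Suc k"
  obtains a m' where "m = Poly_Mapping.single a 1 + m'" "(\<Sum>v\<in>UNIV. Poly_Mapping.lookup m' v) = k"
proof -
  obtain a where a: "Poly_Mapping.lookup m a > 0"
    using assms by (metis sum.neutral nat.distinct(1) bot_nat_0.not_eq_extremum)
  define m' where "m' = m - Poly_Mapping.single a 1"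
  have *: "m = Poly_Mapping.single a 1 + m'"
    using a by (intro poly_mapping_eqI) (auto simp: m'_def lookup_add lookup_minus lookup_single when_def)
  have "(\<Sum>v\<in>UNIV. Poly_Mapping.lookup (Poly_Mapping.single a (1::nat)) v) = (\<Sum>v\<in>UNIV. if v = a then 1 else 0)"
    by (rule sum.cong) (auto simp: lookup_single when_def)
  then have "(\<Sum>v\<in>UNIV. Poly_Mapping.lookup m' v) = k"
    using assms by (subst (asm) *) (simp add: lookup_add sum.distrib)
  with * show ?thesis by (rule that)
qed

lemma monom_degree_0:
  fixes m :: "'v::finite \<Rightarrow>\<^sub>0 nat"
  assumes "(\<Sum>v\<in>UNIV. Poly_Mapping.lookup m v) = 0"
  shows "m = 0"
  using assms by (intro poly_mapping_eqI) simp

lemma linear_form_cdot: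
  assumes "multihom P3 (\<lambda>_. 1) F"
  obtains n where "\<And>x. peval F x = cdot n x"
proof -
  have "\<exists>a. m = Poly_Mapping.single a 1" if "m \<in> Poly_Mapping.keys F" for m
  proof -
    have "(\<Sum>v\<in>UNIV. Poly_Mapping.lookup m v) = Suc 0"
      using assms that by (simp add: multihom_def)
    then show ?thesis by (metis monom_degree_pos monom_degree_0 add.right_neutral)
  qed
  then obtain \<alpha> where \<alpha>: "\<And>m. m \<in> Poly_Mapping.keys F \<Longrightarrow> m = Poly_Mapping.single (\<alpha> m) 1" by metis
  have "peval F x = cdot (\<Sum>m\<in>Poly_Mapping.keys F. Poly_Mapping.lookup F m *s axis (\<alpha> m) 1) x" for x
  proof -
    have "monom_eval m x = x $ (\<alpha> m)" if "m \<in> Poly_Mapping.keys F" for m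
      by (subst \<alpha>[OF that]) (simp add: monom_eval_single)
    moreover have "cdot (axis a 1) x = x $ a" for a
      by (simp add: cdot_def axis_def if_distrib[of "\<lambda>c. c * _"] cong: if_cong)
    moreover have "cdot (sum f S) x = (\<Sum>a\<in>S. cdot (f a) x)" for f and S :: "(4 \<Rightarrow>\<^sub>0 nat) set"
      by (induction S rule: infinite_finite_induct) auto
    ultimately show ?thesis by (simp add: peval_superset[of "Poly_Mapping.keys F"])
  qed
  then show ?thesis using that by blast
qed

lemma quadratic_form_sbilinear:
  assumes "multihom P3 (\<lambda>_. 2) F"
  obtains B where "sbilinear B" "\<And>x. peval F x = B x x"
proof -
  have "\<exists>a b. m = Poly_Mapping.single a 1 + Poly_Mapping.single b 1" if "m \<in> Poly_Mapping.keys F" for m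
  proof -
    have "(\<Sum>v\<in>UNIV. Poly_Mapping.lookup m v) = Suc (Suc 0)"
      using assms that by (simp add: multihom_def)
    then show ?thesis by (metis monom_degree_pos monom_degree_0 add.right_neutral)
  qed
  then obtain \<alpha> \<beta> where *: "\<And>m. m \<in> Poly_Mapping.keys F \<Longrightarrow>
      m = Poly_Mapping.single (\<alpha> m) 1 + Poly_Mapping.single (\<beta> m) 1" by metis
  \<comment> \<open>Averaging over the exchange of the two coordinates of each monomial makes the
    form symmetric and keeps its diagonal values.\<close>
  define B :: "complex^4 \<Rightarrow> complex^4 \<Rightarrow> complex" where
    "B x y = (\<Sum>m\<in>Poly_Mapping.keys F. Poly_Mapping.lookup F m *
      ((x $ \<alpha> m * y $ \<beta> m + y $ \<alpha> m * x $ \<beta> m) / 2))" for x y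
  have "sbilinear B"
    unfolding sbilinear_def
  proof (intro conjI allI)
    show "B x y = B y x" for x y
      unfolding B_def by (rule sum.cong) (auto simp: algebra_simps)
    show "B (x + y) z = B x z + B y z" for x y z
      unfolding B_def sum.distrib[symmetric] by (rule sum.cong) (auto simp: field_simps)
    show "B (c *s x) y = c * B x y" for c x y
      unfolding B_def sum_distrib_left by (rule sum.cong) (auto simp: field_simps)
  qed
  moreover have "peval F x = B x x" for x
  proof -
    have "monom_eval m x = x $ (\<alpha> m) * x $ \<beta> m" if "m \<in> Poly_Mapping.keys F" for m
      by (subst *[OF that]) (simp add: monom_eval_single monom_eval_add)
    then show ?thesis by (simp add: peval_superset[of "Poly_Mapping.keys F"] B_def mult.commute)
  qed
  ultimately show ?thesis using that by blast
qed

lemma mem_mproj_P3: "x \<in> mproj P3 \<longleftrightarrow> x \<noteq> 0"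
  by (auto simp: mproj_def vec_eq_iff)

lemma mem_surface_of: "x \<in> surface_of F \<longleftrightarrow> x \<noteq> 0 \<and> peval F x = 0"
  by (simp add: surface_of_def zero_locus_def mem_mproj_P3)

lemma axis_scale: "axis a h = h *s axis a (1::complex)"
  by (simp add: vec_eq_iff axis_def)

text \<open>At a vector of the radical, F restricted to each axis direction is h^2 times a constant,
  so every partial derivative vanishes there.\<close>

lemma smooth_form_2D:
  assumes "smooth_form 2 F" "sbilinear B" "\<And>x. peval F x = B x x" "x \<noteq> 0" "B x x = 0"
  shows "\<exists>y. B x y \<noteq> 0"
proof (rule ccontr)
  assume "\<not> ?thesis"
  then have 0: "B x y = 0" "B y x = 0" for y using sbilinear_sym[OF assms(2)] by metis+
  have "partial_deriv F a x = 0" for a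
  proof -
    have "peval F (x + axis a h) = h ^ 2 * B (axis a 1) (axis a 1)" for h
      by (simp add: assms(3) axis_scale[of a h] sbilinearD[OF assms(2)] 0 power2_eq_square)
    moreover have "((\<lambda>h. h ^ 2 * B (axis a 1) (axis a 1)) has_field_derivative 0) (at 0)"
      by (auto intro!: derivative_eq_intros)
    ultimately show ?thesis by (simp add: partial_deriv_def DERIV_imp_deriv)
  qed
  moreover have "x \<in> surface_of F" using assms by (simp add: mem_surface_of)
  ultimately show False using assms(1) by (auto simp: smooth_form_def)
qed

lemma smooth_form_1D:
  assumes "smooth_form 1 F" "\<And>x. peval F x = cdot n x"
  shows "n \<noteq> 0"
proof
  assume "n = 0"
  then have "peval F x = 0" for x by (simp add: assms(2))
  then have "partial_deriv F a x = 0" for a x by (simp add: partial_deriv_def)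
  moreover have "axis 0 1 \<in> surface_of F" 
    using \<open>\<And>x. peval F x = 0\<close> by (simp add: mem_surface_of)
  ultimately show False using assms(1) by (auto simp: smooth_form_def)
qed

lemma kernel_vector:
  fixes n :: "complex^4"
  obtains v where "v \<noteq> 0" "cdot n v = 0"
proof (cases "n $ 0 = 0")
  case True
  then show ?thesis using that[of "axis 0 1"] by simp
next
  case False
  have "(n $ 0 *s axis 1 1 - n $ 1 *s axis 0 1 :: complex^4) $ 1 = n $ 0"
    by (simp add: axis_def)
  then have "n $ 0 *s axis 1 1 - n $ 1 *s axis 0 1 \<noteq> (0 :: complex^4)" using False by force
  then show ?thesis by (rule that) simp
qed

text \<open>Take p off the plane. For v in the plane, F(p + tv) has no zero in t, so it is constant
  by the fundamental theorem of algebra and B(p, v) = B(v, v) = 0. Every vector of the plane then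
  lies in the radical of B, which smoothness forbids.\<close>

lemma smooth_quadric_not_in_plane:
  assumes "smooth_form 2 F" "\<And>x. x \<in> surface_of F \<Longrightarrow> cdot n x = 0"
  shows "n = 0"
proof (rule ccontr)
  assume "n \<noteq> 0"
  then obtain p where p: "cdot n p \<noteq> 0" using cdot_eq_0_imp by blast
  obtain B where B: "sbilinear B" "\<And>x. peval F x = B x x"
    using assms(1) quadratic_form_sbilinear[of F] by (auto simp: smooth_form_def)
  note bil = sbilinearD[OF B(1)]
  have ker: "B p v = 0 \<and> B v v = 0" if "cdot n v = 0" for v
  proof -
    let ?Q = "[:B p p, 2 * B p v, B v v:]"
    have "poly ?Q t \<noteq> 0" for t
    proof
      assume "poly ?Q t = 0"
      then have "peval F (p + t *s v) = 0"
        using sbilinear_sym[OF B(1), of v p] by (simp add: B(2) bil algebra_simps)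
      moreover have neq: "cdot n (p + t *s v) \<noteq> 0" using p that by simp
      then have "p + t *s v \<noteq> 0" by (metis cdot_zero(1))
      ultimately show False using assms(2)[of "p + t *s v"] neq by (auto simp: mem_surface_of)
    qed
    then have "constant (poly ?Q)" using fundamental_theorem_of_algebra by blast
    then have "degree ?Q = 0" by (simp add: constant_degree)
    then show ?thesis by (auto split: if_splits)
  qed
  obtain v where v: "v \<noteq> 0" "cdot n v = 0" using kernel_vector by blast
  obtain y where y: "B v y \<noteq> 0"
    using smooth_form_2D[OF assms(1) B v(1)] ker[OF v(2)] by blast
  define u where "u = y - (cdot n y / cdot n p) *s p"
  have u: "cdot n u = 0" using p by (simp add: u_def)
  have "B (v + u) (v + u) = 0" using ker[of "v + u"] u v by simp
  then have "B v u = 0"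
    using ker[OF u] ker[OF v(2)] sbilinear_sym[OF B(1), of u v] by (simp add: bil)
  moreover have "y = u + (cdot n y / cdot n p) *s p" by (simp add: u_def)
  then have "B v y = B v u + (cdot n y / cdot n p) * B v p" by (metis bil(2,4))
  ultimately show False using y ker[OF v(2)] sbilinear_sym[OF B(1), of v p] by simp
qed

section \<open>The normal form of the trilinear map\<close>

definition lf :: "3 \<Rightarrow> real^2 \<Rightarrow> complex^(3 \<times> 2) \<Rightarrow> complex" where
  "lf b v z = of_real (v $ 0) * z $ (b, 0) + of_real (v $ 1) * z $ (b, 1)"

lemma peval_facform: "peval (facform b v) z = lf b v z"
  by (simp add: facform_def peval_sum sum_two lf_def)

lemma multihom_facform: "multihom P111 (\<lambda>b'. if b' = b then 1 else 0) (facform b v)"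
proof -
  have "multihom P111 (\<lambda>b'. if b' = b then 1 else 0) (Var (b, e))" for e
    using multihom_Var[of P111 "(b, e)"] by simp
  then show ?thesis
    unfolding facform_def by (intro multihom_sum multihom_Const_mult)
qed

definition lincp :: "complex^4 \<Rightarrow> 4 cpoly" where
  "lincp n = (\<Sum>a\<in>UNIV. Const (n $ a) * Var a)"

lemma peval_lincp [simp]: "peval (lincp n) v = cdot n v"
  by (simp add: lincp_def peval_sum cdot_def)

lemma multihom_lincp: "multihom P3 (\<lambda>_. 1) (lincp n)"
proof -
  have "multihom P3 (\<lambda>_. 1) (Var a)" for a
    using multihom_Var[of P3 a] by simp
  then show ?thesis
    unfolding lincp_def by (intro multihom_sum multihom_Const_mult)
qed

lemma zariski_closed_single: "multihom blk d p \<Longrightarrow> zariski_closed blk (zero_locus blk {p})"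
  unfolding zariski_closed_def by blast

lemma mem_mproj_P111: "z \<in> mproj P111 \<longleftrightarrow> (\<forall>b. z $ (b, 0) \<noteq> 0 \<or> z $ (b, 1) \<noteq> 0)"
proof -
  have "range P111 = UNIV" by (auto simp: surj_def)
  then have "z \<in> mproj P111 \<longleftrightarrow> (\<forall>b. \<exists>e. z $ (b, e) \<noteq> 0)"
    unfolding mproj_def by (auto; metis fst_conv prod.collapse)
  also have "\<dots> \<longleftrightarrow> (\<forall>b. z $ (b, 0) \<noteq> 0 \<or> z $ (b, 1) \<noteq> 0)"
    using all_two[of "\<lambda>e. z $ (b, e) = 0" for b] by metis
  finally show ?thesis .
qed

definition det2 :: "real^2 \<Rightarrow> real^2 \<Rightarrow> real" where
  "det2 u v = u $ 0 * v $ 1 - u $ 1 * v $ 0"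

lemma det2_complex:
  "det2 u v \<noteq> 0 \<Longrightarrow> complex_of_real (u $ 0) * of_real (v $ 1) - of_real (u $ 1) * of_real (v $ 0) \<noteq> 0"
  unfolding det2_def by (metis of_real_diff of_real_eq_0_iff of_real_mult)

lemma lf_eq_imp_eq:
  assumes "det2 u v \<noteq> 0" "lf b u z = k * lf b u z'" "lf b v z = k * lf b v z'"
  shows "z $ (b, e) = k * z' $ (b, e)"
proof -
  have d: "complex_of_real (u $ 0) * of_real (v $ 1) - of_real (u $ 1) * of_real (v $ 0) \<noteq> 0"
    by (rule det2_complex[OF assms(1)])
  have "(complex_of_real (u $ 0) * of_real (v $ 1) - of_real (u $ 1) * of_real (v $ 0)) * (z $ (b, 0) - k * z' $ (b, 0)) = 0"
    "(complex_of_real (u $ 0) * of_real (v $ 1) - of_real (u $ 1) * of_real (v $ 0)) * (z $ (b, 1) - k * z' $ (b, 1)) = 0"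
    using assms(2,3) unfolding lf_def by algebra+
  then have "z $ (b, 0) = k * z' $ (b, 0)" "z $ (b, 1) = k * z' $ (b, 1)" using d by auto
  then show ?thesis using all_two[of "\<lambda>e. z $ (b, e) = k * z' $ (b, e)"] by blast
qed

lemma lf_zero_iff:
  assumes "det2 u v \<noteq> 0"
  shows "lf b u z = 0 \<and> lf b v z = 0 \<longleftrightarrow> z $ (b, 0) = 0 \<and> z $ (b, 1) = 0"
proof
  assume "lf b u z = 0 \<and> lf b v z = 0"
  then have "z $ (b, e) = 0 * z $ (b, e)" for e
    by (intro lf_eq_imp_eq[OF assms]) simp_all
  then show "z $ (b, 0) = 0 \<and> z $ (b, 1) = 0" by (metis mult_zero_left)
qed (simp add: lf_def)

lemma lf_solve:
  assumes "det2 u v \<noteq> 0"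
  obtains r where "of_real (u $ 0) * r 0 + of_real (u $ 1) * r 1 = (p :: complex)"
    "of_real (v $ 0) * r 0 + of_real (v $ 1) * r (1::2) = p'"
proof
  let ?d = "complex_of_real (u $ 0) * of_real (v $ 1) - of_real (u $ 1) * of_real (v $ 0)"
  have d: "?d \<noteq> 0"
    by (rule det2_complex[OF assms])
  let ?r = "\<lambda>e::2. if e = 0 then (of_real (v $ 1) * p - of_real (u $ 1) * p') / ?d
    else (of_real (u $ 0) * p' - of_real (v $ 0) * p) / ?d"
  show "of_real (u $ 0) * ?r 0 + of_real (u $ 1) * ?r 1 = p"
    "of_real (v $ 0) * ?r 0 + of_real (v $ 1) * ?r 1 = p'"
    using d by (simp_all add: divide_simps) (simp_all add: algebra_simps)
qed

text \<open>All that is used of the map is condensed into four pullbacks and a dual basis, which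
  keeps control points and boundary surfaces out of the geometry. The relations \<open>b1\<close>
  and \<open>c1\<close> are the linear dependences of three forms on a projective line.\<close>

locale normal_form =
  fixes \<phi> :: "4 \<Rightarrow> (3 \<times> 2) cpoly"
    and \<alpha> :: "2 \<Rightarrow> real^2" and \<beta> \<gamma> :: "3 \<Rightarrow> real^2"
    and nA nB nC nD eA eB eC eD :: "complex^4"
    and x y y1 z1 :: complex
  assumes hom: "multihom P111 (\<lambda>_. 1) (\<phi> i)"
    and A_phi: "cdot nA (polymap \<phi> z) = lf 0 (\<alpha> 0) z * lf 1 (\<beta> 0) z * lf 2 (\<gamma> 2) z"
    and B_phi: "cdot nB (polymap \<phi> z) = lf 0 (\<alpha> 1) z * lf 1 (\<beta> 1) z * lf 2 (\<gamma> 2) z"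
    and C_phi: "cdot nC (polymap \<phi> z) = lf 0 (\<alpha> 0) z * lf 1 (\<beta> 2) z * lf 2 (\<gamma> 0) z"
    and D_phi: "cdot nD (polymap \<phi> z) = lf 0 (\<alpha> 1) z * lf 1 (\<beta> 2) z * lf 2 (\<gamma> 1) z"
    and expand: "v = cdot nA v *s eA + cdot nB v *s eB + cdot nC v *s eC + cdot nD v *s eD"
    and dual: "cdot nA eA = 1" "cdot nA eB = 0" "cdot nA eC = 0" "cdot nA eD = 0"
      "cdot nB eA = 0" "cdot nB eB = 1" "cdot nB eC = 0" "cdot nB eD = 0"
      "cdot nC eA = 0" "cdot nC eB = 0" "cdot nC eC = 1" "cdot nC eD = 0"
      "cdot nD eA = 0" "cdot nD eB = 0" "cdot nD eC = 0" "cdot nD eD = 1"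
    and b1: "lf 1 (\<beta> 1) z = y1 * lf 1 (\<beta> 0) z + x * lf 1 (\<beta> 2) z"
    and c1: "lf 2 (\<gamma> 1) z = z1 * lf 2 (\<gamma> 0) z + y * lf 2 (\<gamma> 2) z"
    and y1: "y1 \<noteq> 0" and z1: "z1 \<noteq> 0" and xy: "x \<noteq> 0 \<or> y \<noteq> 0"
    and det: "det2 (\<alpha> 0) (\<alpha> 1) \<noteq> 0" "det2 (\<beta> 0) (\<beta> 2) \<noteq> 0" "det2 (\<gamma> 0) (\<gamma> 2) \<noteq> 0"
begin

abbreviation "a \<equiv> \<lambda>l. lf 0 (\<alpha> l)"
abbreviation "b \<equiv> \<lambda>m. lf 1 (\<beta> m)"
abbreviation "c \<equiv> \<lambda>m. lf 2 (\<gamma> m)"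
abbreviation "A \<equiv> cdot nA"
abbreviation "B \<equiv> cdot nB"
abbreviation "C \<equiv> cdot nC"
abbreviation "D \<equiv> cdot nD"
abbreviation "f \<equiv> polymap \<phi>"

definition U where "U v = y * y1 * A v - x * z1 * C v"
definition V where "V v = y * B v - x * D v"
definition Q where "Q v = y1 * A v * D v - z1 * B v * C v"
definition E where "E z = y * y1 * b 0 z * c 2 z - x * z1 * b 2 z * c 0 z"

lemma eq_by_coords:
  assumes "A v = A v'" "B v = B v'" "C v = C v'" "D v = D v'"
  shows "v = v'"
  by (subst expand[of v], subst expand[of v'], simp only: assms)

lemma coords_zero_iff: "v = 0 \<longleftrightarrow> A v = 0 \<and> B v = 0 \<and> C v = 0 \<and> D v = 0"
  using eq_by_coords[of v 0] by auto

lemma U_f: "U (f z) = a 0 z * E z"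
  by (simp add: U_def E_def A_phi C_phi algebra_simps)

lemma V_f: "V (f z) = a 1 z * E z"
  by (simp add: V_def E_def B_phi D_phi b1 c1 algebra_simps)

lemma Q_f: "Q (f z) = a 0 z * a 1 z * b 2 z * c 2 z * E z"
  by (simp add: Q_def E_def A_phi B_phi C_phi D_phi b1 c1 algebra_simps)

text \<open>As b_1 = y_1 b_0 + x b_2, this turns (b_0 : b_2) = (AV : Q) into (b_1 : b_2) = (BU : Q).
  With \<open>DU\<close> it lets the coordinates B and D be recovered like A and C.\<close>

lemma BU: "B v * U v = y1 * A v * V v + x * Q v"
  by (simp add: U_def V_def Q_def algebra_simps)

lemma DU: "D v * U v = z1 * C v * V v + y * Q v"
  by (simp add: U_def V_def Q_def algebra_simps)

text \<open>These six forms are linear coordinates on C^6, so points and tangent directions may be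
  prescribed by their values.\<close>

lemma obtain_point:
  obtains z where "a 0 z = p0" "a 1 z = p1" "b 0 z = q0" "b 2 z = q2" "c 0 z = r0" "c 2 z = r2"
proof -
  obtain rs :: "2 \<Rightarrow> complex" where rs: "of_real (\<alpha> 0 $ 0) * rs 0 + of_real (\<alpha> 0 $ 1) * rs 1 = p0"
    "of_real (\<alpha> 1 $ 0) * rs 0 + of_real (\<alpha> 1 $ 1) * rs 1 = p1"
    by (rule lf_solve[OF det(1), of p0 p1])
  obtain rt :: "2 \<Rightarrow> complex" where rt: "of_real (\<beta> 0 $ 0) * rt 0 + of_real (\<beta> 0 $ 1) * rt 1 = q0"
    "of_real (\<beta> 2 $ 0) * rt 0 + of_real (\<beta> 2 $ 1) * rt 1 = q2"
    by (rule lf_solve[OF det(2), of q0 q2])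
  obtain ru :: "2 \<Rightarrow> complex" where ru: "of_real (\<gamma> 0 $ 0) * ru 0 + of_real (\<gamma> 0 $ 1) * ru 1 = r0"
    "of_real (\<gamma> 2 $ 0) * ru 0 + of_real (\<gamma> 2 $ 1) * ru 1 = r2"
    by (rule lf_solve[OF det(3), of r0 r2])
  show ?thesis
    by (rule that[of "\<chi> v. if fst v = 0 then rs (snd v) else if fst v = 1 then rt (snd v) else ru (snd v)"])
      (use rs rt ru in \<open>simp_all add: lf_def\<close>)
qed

lemma mem_mproj_z: "z \<in> mproj P111 \<longleftrightarrow>
    (a 0 z \<noteq> 0 \<or> a 1 z \<noteq> 0) \<and> (b 0 z \<noteq> 0 \<or> b 2 z \<noteq> 0) \<and> (c 0 z \<noteq> 0 \<or> c 2 z \<noteq> 0)"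
  unfolding mem_mproj_P111 all_three
  using lf_zero_iff[OF det(1), of 0 z] lf_zero_iff[OF det(2), of 1 z] lf_zero_iff[OF det(3), of 2 z]
  by blast

text \<open>Each case kills one term of E: b_0 = 0 leaves - x z_1, and c_0 = 0 leaves y y_1.\<close>

lemma generic_point:
  obtains z where "z \<in> mproj P111" "a 0 z \<noteq> 0" "a 1 z \<noteq> 0" "b 2 z \<noteq> 0" "c 2 z \<noteq> 0" "E z \<noteq> 0"
proof (cases "y = 0")
  case True
  obtain z where z: "a 0 z = 1" "a 1 z = 1" "b 0 z = 0" "b 2 z = 1" "c 0 z = 1" "c 2 z = 1"
    using obtain_point by blast
  have "E z \<noteq> 0" unfolding E_def using z True xy z1 by simp
  then show ?thesis
    by (intro that[of z]) (use z in \<open>auto simp: mem_mproj_z\<close>)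
next
  case False
  obtain z where z: "a 0 z = 1" "a 1 z = 1" "b 0 z = 1" "b 2 z = 1" "c 0 z = 0" "c 2 z = 1"
    using obtain_point by blast
  have "E z \<noteq> 0" unfolding E_def using z False y1 by simp
  then show ?thesis
    by (intro that[of z]) (use z in \<open>auto simp: mem_mproj_z\<close>)
qed

lemma rational_map_phi: "rational_map P111 P3 \<phi>"
proof -
  obtain z where z: "z \<in> mproj P111" "a 0 z \<noteq> 0" "a 1 z \<noteq> 0" "b 2 z \<noteq> 0" "c 2 z \<noteq> 0" "E z \<noteq> 0"
    by (rule generic_point)
  have "f z \<noteq> 0"
  proof
    assume "f z = 0"
    then have "Q (f z) = 0" by (simp add: Q_def)
    then show False using z by (simp add: Q_f)
  qed
  then have "f z \<in> mproj P3" by (simp add: mem_mproj_P3)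
  then show ?thesis
    unfolding rational_map_def using hom z(1) by metis
qed

section \<open>The inverse map in normal form\<close>

definition Up where "Up = Const (y * y1) * lincp nA - Const (x * z1) * lincp nC"
definition Vp where "Vp = Const y * lincp nB - Const x * lincp nD"
definition Qp where "Qp = Const y1 * (lincp nA * lincp nD) - Const z1 * (lincp nB * lincp nC)"
definition Ep where "Ep = Const (y * y1) * (facform 1 (\<beta> 0) * facform 2 (\<gamma> 2)) -
  Const (x * z1) * (facform 1 (\<beta> 2) * facform 2 (\<gamma> 0))"

lemma peval_UVQE: "peval Up v = U v" "peval Vp v = V v" "peval Qp v = Q v" "peval Ep z = E z"
  by (simp_all add: Up_def U_def Vp_def V_def Qp_def Q_def Ep_def E_def peval_facform)

lemma multihom_UVQ: "multihom P3 (\<lambda>_. 1) Up" "multihom P3 (\<lambda>_. 1) Vp" "multihom P3 (\<lambda>_. 1 + 1) Qp"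
  unfolding Up_def Vp_def Qp_def
  by (intro multihom_diff multihom_Const_mult multihom_lincp multihom_mult)+

text \<open>The forms a_l, b_m, c_m serve as coordinates on the target, and the three constants are
  the freedom of scaling on each factor. The claimed formula will satisfy this predicate for both
  values of i.\<close>

definition inverse_family :: "(3 \<times> 2 \<Rightarrow> 4 cpoly) \<Rightarrow> bool" where
  "inverse_family \<psi> \<longleftrightarrow>
     (\<forall>b'. \<exists>d. \<forall>w. fst w = b' \<longrightarrow> multihom P3 d (\<psi> w)) \<and>
     (\<exists>k0 k1 k2. k0 \<noteq> 0 \<and> k1 \<noteq> 0 \<and> k2 \<noteq> 0 \<and> (\<forall>v.
        a 0 (polymap \<psi> v) = k0 * U v \<and> a 1 (polymap \<psi> v) = k0 * V v \<and>
        b 0 (polymap \<psi> v) = k1 * (A v * V v) \<and> b 2 (polymap \<psi> v) = k1 * Q v \<and>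
        c 0 (polymap \<psi> v) = k2 * (C v * V v) \<and> c 2 (polymap \<psi> v) = k2 * Q v))"

lemma inverse_family_mproj:
  assumes "inverse_family \<psi>"
  shows "polymap \<psi> v \<in> mproj P111 \<longleftrightarrow>
    (U v \<noteq> 0 \<or> V v \<noteq> 0) \<and> (A v * V v \<noteq> 0 \<or> Q v \<noteq> 0) \<and> (C v * V v \<noteq> 0 \<or> Q v \<noteq> 0)"
  using assms unfolding inverse_family_def by (auto simp: mem_mproj_z)

lemma rational_map_inverse:
  assumes "inverse_family \<psi>"
  shows "rational_map P3 P111 \<psi>"
proof -
  obtain z where z: "z \<in> mproj P111" "a 0 z \<noteq> 0" "a 1 z \<noteq> 0" "b 2 z \<noteq> 0" "c 2 z \<noteq> 0" "E z \<noteq> 0"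
    by (rule generic_point)
  have q: "Q (f z) \<noteq> 0" "U (f z) \<noteq> 0" using z by (simp_all add: Q_f U_f)
  then have "f z \<noteq> 0" by (auto simp: Q_def)
  moreover have "polymap \<psi> (f z) \<in> mproj P111"
    unfolding inverse_family_mproj[OF assms] using q by blast
  ultimately have "\<exists>v\<in>mproj P3. polymap \<psi> v \<in> mproj P111" by (auto simp: mem_mproj_P3)
  then show ?thesis using assms unfolding rational_map_def inverse_family_def by blast
qed

lemma left_inverse_phi:
  assumes "inverse_family \<psi>"
  shows "left_inverse P111 P3 \<phi> \<psi>"
proof -
  obtain k0 k1 k2 where k: "k0 \<noteq> 0" "k1 \<noteq> 0" "k2 \<noteq> 0"
    and psi: "\<And>v. a 0 (polymap \<psi> v) = k0 * U v" "\<And>v. a 1 (polymap \<psi> v) = k0 * V v"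
      "\<And>v. b 0 (polymap \<psi> v) = k1 * (A v * V v)" "\<And>v. b 2 (polymap \<psi> v) = k1 * Q v"
      "\<And>v. c 0 (polymap \<psi> v) = k2 * (C v * V v)" "\<And>v. c 2 (polymap \<psi> v) = k2 * Q v"
    using assms unfolding inverse_family_def by blast
  \<comment> \<open>Outside the zero set of this product none of the three scalars \<open>?h\<close>
    vanishes.\<close>
  let ?p = "facform 0 (\<alpha> 0) * facform 0 (\<alpha> 1) * facform 1 (\<beta> 2) * facform 2 (\<gamma> 2) * Ep"
  let ?u = "\<lambda>b b'. if b' = b then 1 else (0::nat)"
  have Ehom: "multihom P111 (\<lambda>b'. ?u 1 b' + ?u 2 b') Ep"
    unfolding Ep_def by (intro multihom_diff multihom_Const_mult multihom_mult multihom_facform)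
  have "multihom P111 (\<lambda>b'. ?u 0 b' + ?u 0 b' + ?u 1 b' + ?u 2 b' + (?u 1 b' + ?u 2 b')) ?p"
    by (intro multihom_mult multihom_facform Ehom)
  then have closed: "zariski_closed P111 (zero_locus P111 {?p})"
    by (rule zariski_closed_single)
  have p: "peval ?p z = a 0 z * a 1 z * b 2 z * c 2 z * E z" for z
    by (simp add: peval_facform peval_UVQE)
  show ?thesis
    unfolding left_inverse_def
  proof (intro exI conjI ballI)
    show "zariski_closed P111 (zero_locus P111 {?p})" by (rule closed)
    obtain z where z: "z \<in> mproj P111" "a 0 z \<noteq> 0" "a 1 z \<noteq> 0" "b 2 z \<noteq> 0" "c 2 z \<noteq> 0" "E z \<noteq> 0"
      by (rule generic_point)
    then have "z \<notin> zero_locus P111 {?p}" by (simp add: zero_locus_def p del: peval_mult)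
    with z(1) show "zero_locus P111 {?p} \<noteq> mproj P111" by blast
    fix z assume "z \<in> mproj P111 - zero_locus P111 {?p}"
    then have z: "z \<in> mproj P111" "a 0 z \<noteq> 0" "a 1 z \<noteq> 0" "b 2 z \<noteq> 0" "c 2 z \<noteq> 0" "E z \<noteq> 0"
      by (auto simp: zero_locus_def p simp del: peval_mult)
    have "Q (f z) \<noteq> 0" using z by (simp add: Q_f)
    then have "f z \<noteq> 0" by (auto simp: Q_def)
    then show "f z \<in> mproj P3" by (simp add: mem_mproj_P3)
    show "polymap \<psi> (f z) \<in> mproj P111"
      unfolding inverse_family_mproj[OF assms] using z by (simp add: Q_f U_f)
    let ?h = "\<lambda>b'::3. if b' = 0 then k0 * E z else if b' = 1 then k1 * a 0 z * a 1 z * c 2 z * E z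
      else k2 * a 0 z * a 1 z * b 2 z * E z"
    have "polymap \<psi> (f z) $ (b', e) = ?h b' * z $ (b', e)" for b' e
    proof -
      have "polymap \<psi> (f z) $ (0, e) = k0 * E z * z $ (0, e)"
        by (rule lf_eq_imp_eq[OF det(1)]) (simp_all add: psi U_f V_f)
      moreover have "polymap \<psi> (f z) $ (1, e) = k1 * a 0 z * a 1 z * c 2 z * E z * z $ (1, e)"
        by (rule lf_eq_imp_eq[OF det(2)]) (simp_all add: psi Q_f V_f A_phi)
      moreover have "polymap \<psi> (f z) $ (2, e) = k2 * a 0 z * a 1 z * b 2 z * E z * z $ (2, e)"
        by (rule lf_eq_imp_eq[OF det(3)]) (simp_all add: psi Q_f V_f C_phi)
      ultimately show ?thesis
        using all_three[of "\<lambda>b'. polymap \<psi> (f z) $ (b', e) = ?h b' * z $ (b', e)"] by simp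
    qed
    moreover have h: "?h b' \<noteq> 0" for b' using z k by simp
    ultimately have "z $ v = inverse (?h (fst v)) * polymap \<psi> (f z) $ v" for v
      by (cases v) (simp only: fst_conv mult.assoc[symmetric] left_inverse[OF h] mult_1)
    then show "same_point P111 (polymap \<psi> (f z)) z"
      unfolding same_point_def
      by (intro exI[of _ "\<lambda>b'. inverse (?h b')"]) (use h in \<open>auto simp del: inverse_mult_distrib\<close>)
  qed
qed

lemma left_inverse_psi:
  assumes "inverse_family \<psi>"
  shows "left_inverse P3 P111 \<psi> \<phi>"
proof -
  obtain k0 k1 k2 where k: "k0 \<noteq> 0" "k1 \<noteq> 0" "k2 \<noteq> 0"
    and psi: "\<And>v. a 0 (polymap \<psi> v) = k0 * U v" "\<And>v. a 1 (polymap \<psi> v) = k0 * V v"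
      "\<And>v. b 0 (polymap \<psi> v) = k1 * (A v * V v)" "\<And>v. b 2 (polymap \<psi> v) = k1 * Q v"
      "\<And>v. c 0 (polymap \<psi> v) = k2 * (C v * V v)" "\<And>v. c 2 (polymap \<psi> v) = k2 * Q v"
    using assms unfolding inverse_family_def by blast
  let ?p = "Up * Vp * Qp"
  have "multihom P3 (\<lambda>_. 1 + 1 + (1 + 1)) ?p" by (intro multihom_mult multihom_UVQ)
  then have closed: "zariski_closed P3 (zero_locus P3 {?p})" by (rule zariski_closed_single)
  have p: "peval ?p v = U v * V v * Q v" for v by (simp add: peval_UVQE)
  show ?thesis
    unfolding left_inverse_def
  proof (intro exI conjI ballI)
    show "zariski_closed P3 (zero_locus P3 {?p})" by (rule closed)
    obtain z where z: "a 0 z \<noteq> 0" "a 1 z \<noteq> 0" "b 2 z \<noteq> 0" "c 2 z \<noteq> 0" "E z \<noteq> 0"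
      by (rule generic_point)
    then have "U (f z) * V (f z) * Q (f z) \<noteq> 0" by (simp add: U_f V_f Q_f)
    moreover from this have "f z \<noteq> 0" by (auto simp: Q_def)
    ultimately have "f z \<notin> zero_locus P3 {?p}" "f z \<in> mproj P3"
      by (simp_all add: zero_locus_def p mem_mproj_P3 del: peval_mult)
    then show "zero_locus P3 {?p} \<noteq> mproj P3" by blast
    fix v assume "v \<in> mproj P3 - zero_locus P3 {?p}"
    then have v: "U v \<noteq> 0" "V v \<noteq> 0" "Q v \<noteq> 0" "v \<noteq> 0" by (auto simp: zero_locus_def p mem_mproj_P3 simp del: peval_mult)
    show "polymap \<psi> v \<in> mproj P111"
      unfolding inverse_family_mproj[OF assms] using v by simp
    \<comment> \<open>Every coordinate of the composite is multiplied by U V Q and the three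
      constants; for B and D this rests on \<open>BU\<close> and \<open>DU\<close>.\<close>
    let ?k = "k0 * k1 * k2 * U v * V v * Q v"
    have b1': "b 1 (polymap \<psi> v) = k1 * (B v * U v)" and c1': "c 1 (polymap \<psi> v) = k2 * (D v * U v)"
      by (simp_all add: b1 c1 psi BU DU algebra_simps)
    have fv: "f (polymap \<psi> v) = ?k *s v"
      by (rule eq_by_coords) (simp_all add: A_phi B_phi C_phi D_phi psi b1' c1')
    have k': "?k \<noteq> 0" using k v by simp
    show "f (polymap \<psi> v) \<in> mproj P3"
      unfolding fv mem_mproj_P3 using k' v(4) by (metis vector_mul_eq_0)
    show "same_point P3 (f (polymap \<psi> v)) v"
    proof -
      have "v = inverse k *s (k *s v)" if "k \<noteq> 0" for k :: complex using that by simp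
      from this[OF k'] k' show ?thesis
        unfolding same_point_def fv
        by (intro exI[of _ "\<lambda>_. inverse ?k"]) (metis inverse_zero_imp_zero vector_smult_component)
    qed
  qed
qed

lemma birational_inverse_normal:
  assumes "inverse_family \<psi>"
  shows "birational_inverse P111 P3 \<phi> \<psi>"
  unfolding birational_inverse_def
  using assms rational_map_phi rational_map_inverse left_inverse_phi left_inverse_psi by blast

end

subsection \<open>Ideals and saturation\<close>

lemma module_times: "module ((*) :: 'a::comm_ring_1 \<Rightarrow> 'a \<Rightarrow> 'a)"
  by unfold_locales (auto simp: algebra_simps)

lemma gen_ideal_base: "g \<in> G \<Longrightarrow> g \<in> gen_ideal G"
  unfolding gen_ideal_def by (rule module.span_base[OF module_times])

lemma gen_ideal_add: "p \<in> gen_ideal G \<Longrightarrow> q \<in> gen_ideal G \<Longrightarrow> p + q \<in> gen_ideal G"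
  unfolding gen_ideal_def by (rule module.span_add[OF module_times])

lemma gen_ideal_diff: "p \<in> gen_ideal G \<Longrightarrow> q \<in> gen_ideal G \<Longrightarrow> p - q \<in> gen_ideal G"
  unfolding gen_ideal_def by (rule module.span_diff[OF module_times])

lemma gen_ideal_mult: "p \<in> gen_ideal G \<Longrightarrow> q * p \<in> gen_ideal G"
  unfolding gen_ideal_def by (rule module.span_scale[OF module_times])

lemma gen_ideal_mult_right: "p \<in> gen_ideal G \<Longrightarrow> p * q \<in> gen_ideal G"
  using gen_ideal_mult[of p G q] by (simp add: mult.commute)

lemma gen_ideal_sum: "(\<And>i. i \<in> S \<Longrightarrow> h i \<in> gen_ideal G) \<Longrightarrow> sum h S \<in> gen_ideal G"
  unfolding gen_ideal_def by (rule module.span_sum[OF module_times])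

text \<open>The p with q p in an ideal form a colon ideal, so it is enough to test
  generators.\<close>

lemma gen_ideal_mult_into:
  assumes "\<And>g. g \<in> G \<Longrightarrow> q * g \<in> gen_ideal H" "p \<in> gen_ideal G"
  shows "q * p \<in> gen_ideal H"
proof -
  have "module.subspace (*) {p. q * p \<in> gen_ideal H}"
    unfolding module.subspace_def[OF module_times]
  proof (intro conjI ballI allI)
    show "0 \<in> {p. q * p \<in> gen_ideal H}"
      unfolding gen_ideal_def by (simp add: module.span_zero[OF module_times])
    show "p + p' \<in> {p. q * p \<in> gen_ideal H}"
      if "p \<in> {p. q * p \<in> gen_ideal H}" "p' \<in> {p. q * p \<in> gen_ideal H}" for p p'
      using that by (simp add: distrib_left gen_ideal_add)
    show "k * p \<in> {p. q * p \<in> gen_ideal H}" if "p \<in> {p. q * p \<in> gen_ideal H}" for k p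
      using that gen_ideal_mult[of "q * p" H k] by (simp add: mult.left_commute)
  qed
  then have "gen_ideal G \<subseteq> {p. q * p \<in> gen_ideal H}"
    unfolding gen_ideal_def using assms(1)
    by (intro module.span_minimal[OF module_times]) (auto simp: gen_ideal_def)
  then show ?thesis using assms(2) by blast
qed

lemma gen_ideal_mono_into:
  assumes "\<And>g. g \<in> G \<Longrightarrow> g \<in> gen_ideal H"
  shows "gen_ideal G \<subseteq> gen_ideal H"
  using gen_ideal_mult_into[of G 1 H] assms by auto

text \<open>If one multiplication by each irrelevant generator carries J into I, then an exponent
  that works for J works for I after adding one.\<close>

lemma same_subschemeI:
  assumes "I \<subseteq> J"
    and "\<And>p c. p \<in> J \<Longrightarrow> (\<And>b. blk (c b) = b) \<Longrightarrow> (\<Prod>b\<in>UNIV. Var (c b)) * p \<in> I"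
  shows "same_subscheme blk I J"
  unfolding same_subscheme_def
proof
  show "saturation blk I \<subseteq> saturation blk J"
    using assms(1) unfolding saturation_def by blast
  show "saturation blk J \<subseteq> saturation blk I"
  proof
    fix p assume p: "p \<in> saturation blk J"
    show "p \<in> saturation blk I"
      unfolding saturation_def
    proof (intro CollectI allI impI)
      fix c assume c: "\<forall>b. blk (c b) = b"
      then obtain n where "(\<Prod>b\<in>UNIV. Var (c b)) ^ n * p \<in> J"
        using p unfolding saturation_def by blast
      then have "(\<Prod>b\<in>UNIV. Var (c b)) * ((\<Prod>b\<in>UNIV. Var (c b)) ^ n * p) \<in> I"
        using c by (intro assms(2)) auto
      then have "(\<Prod>b\<in>UNIV. Var (c b)) ^ Suc n * p \<in> I" by (simp add: mult.assoc)
      then show "\<exists>n. (\<Prod>b\<in>UNIV. Var (c b)) ^ n * p \<in> I" by blast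
    qed
  qed
qed

lemma prod_three: "prod g (UNIV :: 3 set) = g 0 * g 1 * g 2"
proof -
  have "(UNIV :: 3 set) = {0, 1, 2}"
    using UNIV_3 by (simp only: three_eq_zero) auto
  moreover have "prod g {0, 1, 2} = g 0 * g 1 * g 2" by (simp add: mult_ac)
  ultimately show ?thesis by metis
qed

lemma Var_combination:
  assumes "det2 u v \<noteq> 0"
  obtains k k' where "Var (b, e) = Const k * facform b u + Const k' * facform b v"
proof -
  let ?d = "complex_of_real (u $ 0) * of_real (v $ 1) - of_real (u $ 1) * of_real (v $ 0)"
  have d: "?d \<noteq> 0"
    by (rule det2_complex[OF assms])
  have "Var (b, 0) = Const (of_real (v $ 1) / ?d) * facform b u + Const (- of_real (u $ 1) / ?d) * facform b v"
    by (rule cpoly_eqI) (use d in \<open>simp add: peval_facform lf_def divide_simps, simp add: algebra_simps\<close>)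
  moreover have "Var (b, 1) = Const (- of_real (v $ 0) / ?d) * facform b u + Const (of_real (u $ 0) / ?d) * facform b v"
    by (rule cpoly_eqI) (use d in \<open>simp add: peval_facform lf_def divide_simps, simp add: algebra_simps\<close>)
  ultimately have "\<forall>e. \<exists>k k'. Var (b, e) = Const k * facform b u + Const k' * facform b v"
    unfolding all_two by blast
  then show ?thesis using that by blast
qed

context normal_form
begin

abbreviation "fa \<equiv> \<lambda>l. facform 0 (\<alpha> l)"
abbreviation "fb \<equiv> \<lambda>m. facform 1 (\<beta> m)"
abbreviation "fc \<equiv> \<lambda>m. facform 2 (\<gamma> m)"
abbreviation "I \<equiv> gen_ideal (range \<phi>)"

lemma coords_in_ideal:
  "fa 0 * fb 0 * fc 2 \<in> I" "fa 1 * fb 1 * fc 2 \<in> I" "fa 0 * fb 2 * fc 0 \<in> I" "fa 1 * fb 2 * fc 1 \<in> I"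
proof -
  have *: "(\<Sum>i\<in>UNIV. Const (n $ i) * \<phi> i) \<in> I" for n :: "complex^4"
    by (intro gen_ideal_sum gen_ideal_mult gen_ideal_base) simp
  have **: "peval (\<Sum>i\<in>UNIV. Const (n $ i) * \<phi> i) z = cdot n (f z)" for n z
    by (simp add: peval_sum cdot_def polymap_def)
  have "fa 0 * fb 0 * fc 2 = (\<Sum>i\<in>UNIV. Const (nA $ i) * \<phi> i)"
    by (rule cpoly_eqI) (simp add: ** A_phi peval_facform)
  with * show "fa 0 * fb 0 * fc 2 \<in> I" by simp
  have "fa 1 * fb 1 * fc 2 = (\<Sum>i\<in>UNIV. Const (nB $ i) * \<phi> i)"
    by (rule cpoly_eqI) (simp add: ** B_phi peval_facform)
  with * show "fa 1 * fb 1 * fc 2 \<in> I" by simp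
  have "fa 0 * fb 2 * fc 0 = (\<Sum>i\<in>UNIV. Const (nC $ i) * \<phi> i)"
    by (rule cpoly_eqI) (simp add: ** C_phi peval_facform)
  with * show "fa 0 * fb 2 * fc 0 \<in> I" by simp
  have "fa 1 * fb 2 * fc 1 = (\<Sum>i\<in>UNIV. Const (nD $ i) * \<phi> i)"
    by (rule cpoly_eqI) (simp add: ** D_phi peval_facform)
  with * show "fa 1 * fb 2 * fc 1 \<in> I" by simp
qed

text \<open>The dual basis inverts the passage from the components of the map to the four products.
  Together with \<open>coords_in_ideal\<close>, both families generate the same ideal.\<close>

lemma phi_in_ideal:
  assumes "fa 0 * fb 0 * fc 2 \<in> gen_ideal G" "fa 1 * fb 1 * fc 2 \<in> gen_ideal G"
    "fa 0 * fb 2 * fc 0 \<in> gen_ideal G" "fa 1 * fb 2 * fc 1 \<in> gen_ideal G"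
  shows "I \<subseteq> gen_ideal G"
proof (rule gen_ideal_mono_into, elim rangeE, hypsubst)
  fix i
  have "\<phi> i = Const (eA $ i) * (fa 0 * fb 0 * fc 2) + Const (eB $ i) * (fa 1 * fb 1 * fc 2) +
      Const (eC $ i) * (fa 0 * fb 2 * fc 0) + Const (eD $ i) * (fa 1 * fb 2 * fc 1)"
  proof (rule cpoly_eqI)
    fix z
    have "peval (\<phi> i) z = f z $ i" by (simp add: polymap_def)
    then show "peval (\<phi> i) z = peval (Const (eA $ i) * (fa 0 * fb 0 * fc 2) + Const (eB $ i) * (fa 1 * fb 1 * fc 2) +
      Const (eC $ i) * (fa 0 * fb 2 * fc 0) + Const (eD $ i) * (fa 1 * fb 2 * fc 1)) z"
      by (subst (asm) expand[of "f z"]) (simp add: A_phi B_phi C_phi D_phi peval_facform mult_ac)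
  qed
  then show "\<phi> i \<in> gen_ideal G"
    by (simp only:) (intro gen_ideal_add gen_ideal_mult[where q="Const k" for k] assms)
qed

text \<open>Eliminating b_0 from the first two products leaves b_1 - y_1 b_0 = x b_2. If x = 0,
  eliminating c_0 from the other two leaves c_1 - z_1 c_0 = y c_2.\<close>

lemma a0a1b2c2_in_ideal: "fa 0 * fa 1 * fb 2 * fc 2 \<in> I"
proof (cases "x = 0")
  case False
  have "fa 0 * fa 1 * fb 2 * fc 2 = Const (1 / x) *
      (fa 0 * (fa 1 * fb 1 * fc 2) - Const y1 * (fa 1 * (fa 0 * fb 0 * fc 2)))"
    by (rule cpoly_eqI) (use False in \<open>simp add: peval_facform b1 field_simps\<close>)
  then show ?thesis
    by (simp only:) (rule gen_ideal_mult, rule gen_ideal_diff[OF gen_ideal_mult gen_ideal_mult[OF gen_ideal_mult]], rule coords_in_ideal(2), rule coords_in_ideal(1))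
next
  case True
  then have y: "y \<noteq> 0" using xy by simp
  have "fa 0 * fa 1 * fb 2 * fc 2 = Const (1 / y) *
      (fa 0 * (fa 1 * fb 2 * fc 1) - Const z1 * (fa 1 * (fa 0 * fb 2 * fc 0)))"
    by (rule cpoly_eqI) (use y in \<open>simp add: peval_facform c1 field_simps\<close>)
  then show ?thesis
    by (simp only:) (rule gen_ideal_mult, rule gen_ideal_diff[OF gen_ideal_mult gen_ideal_mult[OF gen_ideal_mult]], rule coords_in_ideal(4), rule coords_in_ideal(3))
qed

text \<open>An irrelevant generator is expanded in b_0, b_2, c_0, c_2 next to a_0 and in b_1, b_2,
  c_1, c_2 next to a_1. Of the eight products obtained, four lie in \<open>I\<close>, and each of
  the other four carries one of the three ideals into \<open>I\<close>.\<close>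

lemma base_scheme:
  "same_subscheme P111 I
    (gen_ideal {fa 0, fb 1, fc 1} \<inter> gen_ideal {fa 1, fb 0, fc 0} \<inter> gen_ideal {fb 2, fc 2})"
proof (rule same_subschemeI)
  have "I \<subseteq> gen_ideal {fa 0, fb 1, fc 1}"
    by (rule phi_in_ideal)
      (simp_all add: gen_ideal_base gen_ideal_mult gen_ideal_mult_right)
  moreover have "I \<subseteq> gen_ideal {fa 1, fb 0, fc 0}"
    by (rule phi_in_ideal)
      (simp_all add: gen_ideal_base gen_ideal_mult gen_ideal_mult_right)
  moreover have "I \<subseteq> gen_ideal {fb 2, fc 2}"
    by (rule phi_in_ideal)
      (simp_all add: gen_ideal_base gen_ideal_mult gen_ideal_mult_right)
  ultimately show "I \<subseteq> gen_ideal {fa 0, fb 1, fc 1} \<inter> gen_ideal {fa 1, fb 0, fc 0} \<inter> gen_ideal {fb 2, fc 2}"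
    by blast
next
  fix p and s :: "3 \<Rightarrow> 3 \<times> 2"
  assume "p \<in> gen_ideal {fa 0, fb 1, fc 1} \<inter> gen_ideal {fa 1, fb 0, fc 0} \<inter> gen_ideal {fb 2, fc 2}"
    and s: "\<And>b. fst (s b) = (b :: 3)"
  then have J: "p \<in> gen_ideal {fa 0, fb 1, fc 1}" "p \<in> gen_ideal {fa 1, fb 0, fc 0}" "p \<in> gen_ideal {fb 2, fc 2}"
    by auto
  have s': "s b = (b, snd (s b))" for b using s[of b] by (metis prod.collapse)
  note ci = coords_in_ideal a0a1b2c2_in_ideal
  have into: "q * p \<in> I" if "\<And>g. g \<in> G \<Longrightarrow> q * g \<in> I" "p \<in> gen_ideal G" for q G
    using that by (rule gen_ideal_mult_into)
  have t000: "fa 0 * fb 0 * fc 0 * p \<in> I"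
  proof (rule into[OF _ J(3)])
    fix g assume "g \<in> {fb 2, fc 2}"
    then have "fa 0 * fb 0 * fc 0 * g = fb 0 * (fa 0 * fb 2 * fc 0) \<or>
      fa 0 * fb 0 * fc 0 * g = fc 0 * (fa 0 * fb 0 * fc 2)" by (auto simp: mult_ac)
    then show "fa 0 * fb 0 * fc 0 * g \<in> I" using ci by (metis gen_ideal_mult)
  qed
  have t111: "fa 1 * fb 1 * fc 1 * p \<in> I"
  proof (rule into[OF _ J(3)])
    fix g assume "g \<in> {fb 2, fc 2}"
    then have "fa 1 * fb 1 * fc 1 * g = fb 1 * (fa 1 * fb 2 * fc 1) \<or>
      fa 1 * fb 1 * fc 1 * g = fc 1 * (fa 1 * fb 1 * fc 2)" by (auto simp: mult_ac)
    then show "fa 1 * fb 1 * fc 1 * g \<in> I" using ci by (metis gen_ideal_mult)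
  qed
  have t022: "fa 0 * fb 2 * fc 2 * p \<in> I"
  proof (rule into[OF _ J(2)])
    fix g assume "g \<in> {fa 1, fb 0, fc 0}"
    then have "fa 0 * fb 2 * fc 2 * g = fa 0 * fa 1 * fb 2 * fc 2 \<or>
      fa 0 * fb 2 * fc 2 * g = fb 2 * (fa 0 * fb 0 * fc 2) \<or>
      fa 0 * fb 2 * fc 2 * g = fc 2 * (fa 0 * fb 2 * fc 0)" by (auto simp: mult_ac)
    then show "fa 0 * fb 2 * fc 2 * g \<in> I" using ci by (metis gen_ideal_mult)
  qed
  have t122: "fa 1 * fb 2 * fc 2 * p \<in> I"
  proof (rule into[OF _ J(1)])
    fix g assume "g \<in> {fa 0, fb 1, fc 1}"
    then have "fa 1 * fb 2 * fc 2 * g = fa 0 * fa 1 * fb 2 * fc 2 \<or>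
      fa 1 * fb 2 * fc 2 * g = fb 2 * (fa 1 * fb 1 * fc 2) \<or>
      fa 1 * fb 2 * fc 2 * g = fc 2 * (fa 1 * fb 2 * fc 1)" by (auto simp: mult_ac)
    then show "fa 1 * fb 2 * fc 2 * g \<in> I" using ci by (metis gen_ideal_mult)
  qed
  obtain k0 k1 where k: "Var (s 0) = Const k0 * fa 0 + Const k1 * fa 1"
    using Var_combination[OF det(1), of 0 "snd (s 0)"] s'[of 0] by metis
  obtain l0 l2 where l: "Var (s 1) = Const l0 * fb 0 + Const l2 * fb 2"
    using Var_combination[OF det(2), of 1 "snd (s 1)"] s'[of 1] by metis
  obtain m0 m2 where m: "Var (s 2) = Const m0 * fc 0 + Const m2 * fc 2"
    using Var_combination[OF det(3), of 2 "snd (s 2)"] s'[of 2] by metis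
  have "(\<Prod>b\<in>UNIV. Var (s b)) * p = Var (s 0) * Var (s 1) * Var (s 2) * p"
    by (simp add: prod_three)
  also have "\<dots> = Const (k0 * l0 * m0) * (fa 0 * fb 0 * fc 0 * p) + Const (k0 * l0 * m2) * (fa 0 * fb 0 * fc 2 * p)
    + Const (k0 * l2 * m0) * (fa 0 * fb 2 * fc 0 * p) + Const (k0 * l2 * m2) * (fa 0 * fb 2 * fc 2 * p)
    + Const (k1 * (l0 / y1) * (m0 / z1)) * (fa 1 * fb 1 * fc 1 * p)
    + Const (k1 * (l0 / y1) * (m2 - m0 * y / z1)) * (fa 1 * fb 1 * fc 2 * p)
    + Const (k1 * (l2 - l0 * x / y1) * (m0 / z1)) * (fa 1 * fb 2 * fc 1 * p)
    + Const (k1 * (l2 - l0 * x / y1) * (m2 - m0 * y / z1)) * (fa 1 * fb 2 * fc 2 * p)" (is "_ = ?r")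
  proof (rule cpoly_eqI)
    fix z
    \<comment> \<open>The coefficients next to a_1 come from b_0 = (b_1 - x b_2) / y_1 and, below,
      c_0 = (c_1 - y c_2) / z_1.\<close>
    have "l0 * b 0 z + l2 * b 2 z = (l0 / y1) * b 1 z + (l2 - l0 * x / y1) * b 2 z"
      using y1 by (simp add: b1 field_simps)
    moreover have "m0 * c 0 z + m2 * c 2 z = (m0 / z1) * c 1 z + (m2 - m0 * y / z1) * c 2 z"
      using z1 by (simp add: c1 field_simps)
    moreover have "peval (Var (s 0) * Var (s 1) * Var (s 2) * p) z
      = k0 * a 0 z * (l0 * b 0 z + l2 * b 2 z) * (m0 * c 0 z + m2 * c 2 z) * peval p z
      + k1 * a 1 z * (l0 * b 0 z + l2 * b 2 z) * (m0 * c 0 z + m2 * c 2 z) * peval p z"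
      unfolding k l m by (simp add: peval_facform algebra_simps)
    ultimately have *: "peval (Var (s 0) * Var (s 1) * Var (s 2) * p) z
      = k0 * a 0 z * (l0 * b 0 z + l2 * b 2 z) * (m0 * c 0 z + m2 * c 2 z) * peval p z
      + k1 * a 1 z * ((l0 / y1) * b 1 z + (l2 - l0 * x / y1) * b 2 z) *
        ((m0 / z1) * c 1 z + (m2 - m0 * y / z1) * c 2 z) * peval p z"
      by (simp only:)
    have expand: "k0 * a0 * (l0 * b0 + l2 * b2) * (m0 * c0 + m2 * c2) * p'
      + k1 * a1 * (l * b1 + l' * b2) * (m * c1 + m' * c2) * p'
      = k0 * l0 * m0 * (a0 * b0 * c0 * p') + k0 * l0 * m2 * (a0 * b0 * c2 * p')
      + k0 * l2 * m0 * (a0 * b2 * c0 * p') + k0 * l2 * m2 * (a0 * b2 * c2 * p')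
      + k1 * l * m * (a1 * b1 * c1 * p') + k1 * l * m' * (a1 * b1 * c2 * p')
      + k1 * l' * m * (a1 * b2 * c1 * p') + k1 * l' * m' * (a1 * b2 * c2 * p')"
      for a0 a1 b0 b1 b2 c0 c1 c2 l l' m m' p' :: complex
      by algebra
    show "peval (Var (s 0) * Var (s 1) * Var (s 2) * p) z = peval ?r z"
      unfolding * expand unfolding peval_add peval_mult peval_Const peval_facform ..
  qed
  also have "\<dots> \<in> I"
    by (intro gen_ideal_add gen_ideal_mult[where q="Const k" for k] t000 t022 t111 t122 ci(1-4)[THEN gen_ideal_mult_right])
  finally show "(\<Prod>b\<in>UNIV. Var (s b)) * p \<in> I" .
qed

end

subsection \<open>Indeterminacy\<close>

text \<open>A curve matters only through the restriction of polynomials to it, so it is described by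
  these restrictions lying in C[t].\<close>

definition poly_curve :: "(complex \<Rightarrow> complex^4) \<Rightarrow> bool" where
  "poly_curve g \<longleftrightarrow> (\<forall>G. \<exists>R. \<forall>t. poly R t = peval G (g t))"

lemma poly_curve_line: "poly_curve (\<lambda>t. u + t *s v)"
  unfolding poly_curve_def
proof
  fix G :: "4 cpoly"
  obtain R where "\<And>t. poly R t = peval G (u + t *s v)" using peval_line[of G u v] by blast
  then show "\<exists>R. \<forall>t. poly R t = peval G (u + t *s v)" by blast
qed

lemma poly_curve_comb:
  "poly_curve (\<lambda>t. poly p1 t *s v1 + poly p2 t *s v2 + poly p3 t *s v3 + poly p4 t *s v4)"
  unfolding poly_curve_def
proof
  fix G :: "4 cpoly"
  obtain R where R: "\<And>t. poly R t = peval G (\<chi> i. poly (p1 * [:v1 $ i:] + p2 * [:v2 $ i:] + p3 * [:v3 $ i:] + p4 * [:v4 $ i:]) t)"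
    using peval_poly_curve[where p=G and g="\<lambda>i. p1 * [:v1 $ i:] + p2 * [:v2 $ i:] + p3 * [:v3 $ i:] + p4 * [:v4 $ i:]"]
    by blast
  have "(\<chi> i. poly (p1 * [:v1 $ i:] + p2 * [:v2 $ i:] + p3 * [:v3 $ i:] + p4 * [:v4 $ i:]) t)
    = poly p1 t *s v1 + poly p2 t *s v2 + poly p3 t *s v3 + poly p4 t *s v4" for t
    by (simp add: vec_eq_iff)
  then show "\<exists>R. \<forall>t. poly R t = peval G (poly p1 t *s v1 + poly p2 t *s v2 + poly p3 t *s v3 + poly p4 t *s v4)"
    using R by auto
qed

text \<open>C[t] is a domain, and F restricts to a nonzero element of it.\<close>

lemma vanish_along_curve:
  assumes "poly_curve g" "\<And>t. peval F (g t) * peval G (g t) = 0" "peval F (g t0) \<noteq> 0"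
  shows "peval G (g t) = 0"
proof -
  obtain R S where RS: "\<And>t. poly R t = peval F (g t)" "\<And>t. poly S t = peval G (g t)"
    using assms(1) unfolding poly_curve_def by metis
  have "poly (R * S) t = 0" for t using assms(2) by (simp add: RS)
  then have "R * S = 0" using poly_zero_of_cofinite[of "{}"] by blast
  moreover have "R \<noteq> 0" using assms(3) RS(1)[of t0] by auto
  ultimately have "S = 0" by simp
  then show ?thesis using RS(2)[of t] by simp
qed

lemma poly_nonzero_value:
  fixes P :: "complex poly"
  assumes "P \<noteq> 0"
  obtains t where "poly P t \<noteq> 0"
  using assms poly_all_0_iff_0 by blast

definition lf_comb :: "3 \<Rightarrow> real^2 \<Rightarrow> (3 \<times> 2 \<Rightarrow> 4 cpoly) \<Rightarrow> 4 cpoly" where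
  "lf_comb b u G = rconst (u $ 0) * G (b, 0) + rconst (u $ 1) * G (b, 1)"

lemma peval_lf_comb: "peval (lf_comb b u G) v = lf b u (polymap G v)"
  by (simp add: lf_comb_def lf_def polymap_def)

text \<open>The minor formed with two linear forms is the coordinate minor times their
  determinant.\<close>

lemma same_rational_map_cross:
  assumes "same_rational_map P111 F G"
  shows "lf b u (polymap F v) * lf b u' (polymap G v) = lf b u' (polymap F v) * lf b u (polymap G v)"
proof -
  have "F (b, 0) * G (b, 1) = F (b, 1) * G (b, 0)"
    using assms by (simp add: same_rational_map_def)
  then have "peval (F (b, 0)) v * peval (G (b, 1)) v = peval (F (b, 1)) v * peval (G (b, 0)) v"
    by (metis peval_mult)
  then show ?thesis unfolding lf_def polymap_def by (simp; algebra)
qed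

context normal_form
begin

text \<open>The matrix with rows (A, C) and (B / y_1, D / z_1) has determinant Q / (y_1 z_1). On the
  quadric it is therefore an outer product of (p, q) and (m, n), the parameters of the two
  rulings.\<close>

lemma quadric_param:
  assumes "Q v = 0"
  obtains p q m n where "A v = p * m" "B v = y1 * q * m" "C v = p * n" "D v = z1 * q * n"
proof -
  have Q: "y1 * A v * D v = z1 * B v * C v" using assms by (simp add: Q_def)
  show ?thesis
  proof (cases "A v = 0 \<and> B v = 0")
    case True
    show ?thesis by (rule that[of "C v" 0 "D v / z1" 1]) (use True z1 in auto)
  next
    case False
    then consider "A v \<noteq> 0" | "A v = 0" "B v \<noteq> 0" by blast
    then show ?thesis
    proof cases
      case 1
      then have "D v = z1 * (B v / y1) * (C v / A v)" using Q y1 by (simp add: field_simps)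
      then show ?thesis using 1 y1 by (intro that[of "A v" 1 "B v / y1" "C v / A v"]) auto
    next
      case 2
      then have "C v = 0" using Q z1 by simp
      then show ?thesis using 2 y1 z1 by (intro that[of 0 1 "B v / y1" "D v * y1 / (z1 * B v)"]) (auto simp: field_simps)
    qed
  qed
qed

text \<open>Moving the ruling parameters linearly stays on the quadric. This gives a curve through v
  that leaves the planes A = 0, C = 0 and V = 0.\<close>

lemma quadric_curve:
  assumes "Q v = 0"
  obtains g t0 where "poly_curve g" "g 0 = v" "\<And>t. Q (g t) = 0" "A (g t0) * V (g t0) \<noteq> 0" "C (g t0) * V (g t0) \<noteq> 0"
proof -
  obtain p q m n where v: "A v = p * m" "B v = y1 * q * m" "C v = p * n" "D v = z1 * q * n"
    by (rule quadric_param[OF assms])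
  \<comment> \<open>On the quadric V = q (y y_1 m - x z_1 n); \<open>\<nu>\<close> is the speed of n
    and keeps the leading coefficient of the second factor nonzero.\<close>
  obtain \<nu> where \<nu>: "\<nu> \<noteq> 0" "y * y1 - x * z1 * \<nu> \<noteq> 0"
  proof (cases "y * y1 - x * z1 = 0")
    case True
    then have "x \<noteq> 0" using xy y1 z1 by auto
    moreover have "y * y1 - x * z1 * 2 = - (x * z1)" using True by (simp add: algebra_simps)
    ultimately show ?thesis using that[of 2] z1 by simp
  qed (use that[of 1] in simp)
  let ?P = "[:p, 1:]" and ?R = "[:q, 1:]" and ?M = "[:m, 1:]" and ?N = "[:n, \<nu>:]"
  define g where "g t = poly (?P * ?M) t *s eA + poly ([:y1:] * ?R * ?M) t *s eB + poly (?P * ?N) t *s eC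
    + poly ([:z1:] * ?R * ?N) t *s eD" for t
  have coords: "A (g t) = poly ?P t * poly ?M t" "B (g t) = y1 * poly ?R t * poly ?M t"
    "C (g t) = poly ?P t * poly ?N t" "D (g t) = z1 * poly ?R t * poly ?N t" for t
    unfolding g_def poly_mult by (simp_all add: dual)
  have "?P * ?R * ?M * ?N * [:y * y1 * m - x * z1 * n, y * y1 - x * z1 * \<nu>:] \<noteq> 0"
    using \<nu> by (simp add: algebra_simps)
  then obtain t0 where "poly (?P * ?R * ?M * ?N * [:y * y1 * m - x * z1 * n, y * y1 - x * z1 * \<nu>:]) t0 \<noteq> 0"
    using poly_nonzero_value by blast
  then have t0: "poly ?P t0 \<noteq> 0" "poly ?R t0 \<noteq> 0" "poly ?M t0 \<noteq> 0" "poly ?N t0 \<noteq> 0"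
    "poly [:y * y1 * m - x * z1 * n, y * y1 - x * z1 * \<nu>:] t0 \<noteq> 0"
    by (simp_all only: poly_mult mult_eq_0_iff de_Morgan_disj not_False_eq_True)
  have V: "V (g t) = poly ?R t * poly [:y * y1 * m - x * z1 * n, y * y1 - x * z1 * \<nu>:] t" for t
    by (simp add: V_def coords) (simp add: algebra_simps)
  show ?thesis
  proof (rule that)
    show "poly_curve g" unfolding g_def by (rule poly_curve_comb)
    show "g 0 = v" by (rule eq_by_coords) (simp_all add: coords v)
    show "Q (g t) = 0" for t by (simp add: Q_def coords)
    show "A (g t0) * V (g t0) \<noteq> 0" "C (g t0) * V (g t0) \<noteq> 0"
      unfolding V coords using t0 by (simp_all only: mult_eq_0_iff de_Morgan_disj not_False_eq_True simp_thms)
  qed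
qed

text \<open>The direction e lies in V = 0, and Q(e) is - z_1 x or y_1 y. This is the nonzero
  coefficient of t^2 in Q(v + te).\<close>

lemma V_line:
  assumes "V v = 0"
  obtains e t0 where "\<And>t. V (v + t *s e) = 0" "Q (v + t0 *s e) \<noteq> 0"
proof -
  define e where "e = x *s eB + y *s eD + (if y = 0 then eC else eA)"
  have ce: "A e = (if y = 0 then 0 else 1)" "B e = x" "C e = (if y = 0 then 1 else 0)" "D e = y"
    by (simp_all add: e_def dual)
  have "V (v + t *s e) = 0" for t
    using assms by (simp add: V_def ce algebra_simps)
  moreover have "\<exists>t0. Q (v + t0 *s e) \<noteq> 0"
  proof (cases "y = 0")
    case True
    then have "x \<noteq> 0" using xy by simp
    let ?P = "[:y1 * A v * D v - z1 * B v * C v, - z1 * (B v + x * C v), - z1 * x:]"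
    have "?P \<noteq> 0" using \<open>x \<noteq> 0\<close> z1 by simp
    then obtain t where "poly ?P t \<noteq> 0" by (rule poly_nonzero_value)
    then have "Q (v + t *s e) \<noteq> 0" using True by (simp add: Q_def ce algebra_simps)
    then show ?thesis ..
  next
    case False
    let ?P = "[:y1 * A v * D v - z1 * B v * C v, y1 * (y * A v + D v) - z1 * x * C v, y1 * y:]"
    have "?P \<noteq> 0" using False y1 by simp
    then obtain t where "poly ?P t \<noteq> 0" by (rule poly_nonzero_value)
    then have "Q (v + t *s e) \<noteq> 0" using False by (simp add: Q_def ce algebra_simps)
    then show ?thesis ..
  qed
  ultimately show ?thesis using that by blast
qed

text \<open>Along e_B + e_C inside A = 0, Q becomes - z_1 (B + t) (C + t).\<close>

lemma A_line:
  assumes "A v = 0"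
  obtains e t0 where "\<And>t. A (v + t *s e) = 0" "Q (v + t0 *s e) \<noteq> 0"
proof -
  let ?e = "eB + eC"
  let ?P = "[:B v, 1:] * [:C v, 1:]"
  have "?P \<noteq> 0" by (simp only: mult_eq_0_iff) simp
  then obtain t where "poly ?P t \<noteq> 0" by (rule poly_nonzero_value)
  moreover have "Q (v + t *s ?e) = - z1 * poly ?P t"
    using assms by (simp add: Q_def dual algebra_simps)
  ultimately have "Q (v + t *s ?e) \<noteq> 0" using z1 by (simp only: mult_eq_0_iff neg_equal_0_iff_equal) simp
  moreover have "A (v + t *s ?e) = 0" for t using assms by (simp add: dual)
  ultimately show ?thesis using that by blast
qed

lemma C_line:
  assumes "C v = 0"
  obtains e t0 where "\<And>t. C (v + t *s e) = 0" "Q (v + t0 *s e) \<noteq> 0"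
proof -
  let ?e = "eA + eD"
  let ?P = "[:A v, 1:] * [:D v, 1:]"
  have "?P \<noteq> 0" by (simp only: mult_eq_0_iff) simp
  then obtain t where "poly ?P t \<noteq> 0" by (rule poly_nonzero_value)
  moreover have "Q (v + t *s ?e) = y1 * poly ?P t"
    using assms by (simp add: Q_def dual algebra_simps)
  ultimately have "Q (v + t *s ?e) \<noteq> 0" using y1 by (simp only: mult_eq_0_iff neg_equal_0_iff_equal) simp
  moreover have "C (v + t *s ?e) = 0" for t using assms by (simp add: dual)
  ultimately show ?thesis using that by blast
qed

lemma UV_lines:
  obtains eU eV where "U eU \<noteq> 0" "V eU = 0" "U eV = 0" "V eV \<noteq> 0"
proof (cases "y = 0")
  case True
  then have "U eC \<noteq> 0" "V eC = 0" "U eD = 0" "V eD \<noteq> 0"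
    unfolding U_def V_def using xy z1 by (simp_all add: dual)
  then show ?thesis by (rule that)
next
  case False
  then have "U eA \<noteq> 0" "V eA = 0" "U eB = 0" "V eB \<noteq> 0"
    unfolding U_def V_def using y1 by (simp_all add: dual)
  then show ?thesis by (rule that)
qed

lemma UV_add: "U (v + t *s e) = U v + t * U e" "V (v + t *s e) = V v + t * V e"
  by (simp_all add: U_def V_def algebra_simps)

text \<open>Another representative G has vanishing minors with (U, V), (AV, Q), (CV, Q). On a curve
  through v where one entry of a pair vanishes identically and the other does not, the minor forces
  a component of G to vanish at v. Doing this for both entries shows that G is undefined at v; the
  curves express that the pairs have no common factor.\<close>

lemma indeterminacy_normal:
  assumes inv: "inverse_family \<psi>"
  shows "indeterminacy_locus P3 P111 \<psi> =
    {v. v \<noteq> 0 \<and> (U v = 0 \<and> V v = 0 \<or> Q v = 0 \<and> (A v * V v = 0 \<or> C v * V v = 0))}" (is "_ = ?S")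
proof -
  obtain k0 k1 k2 where k: "k0 \<noteq> 0" "k1 \<noteq> 0" "k2 \<noteq> 0"
    and psi: "\<And>v. a 0 (polymap \<psi> v) = k0 * U v" "\<And>v. a 1 (polymap \<psi> v) = k0 * V v"
      "\<And>v. b 0 (polymap \<psi> v) = k1 * (A v * V v)" "\<And>v. b 2 (polymap \<psi> v) = k1 * Q v"
      "\<And>v. c 0 (polymap \<psi> v) = k2 * (C v * V v)" "\<And>v. c 2 (polymap \<psi> v) = k2 * Q v"
    using inv unfolding inverse_family_def by blast
  have "v \<in> ?S" if "v \<in> indeterminacy_locus P3 P111 \<psi>" for v
  proof -
    have v: "v \<in> mproj P3" using that by (simp add: indeterminacy_locus_def)
    have "polymap \<psi> v \<notin> mproj P111"
      using that rational_map_inverse[OF inv]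
      unfolding indeterminacy_locus_def same_rational_map_def by (auto simp: mult.commute)
    then show ?thesis using v unfolding inverse_family_mproj[OF inv] by (auto simp: mem_mproj_P3)
  qed
  moreover have "v \<in> indeterminacy_locus P3 P111 \<psi>" if v: "v \<in> ?S" for v
  proof -
    have "polymap G v \<notin> mproj P111" if G: "same_rational_map P111 \<psi> G" for G
    proof -
      let ?g = "\<lambda>b u. lf_comb b u G"
      have s: "U w * peval (?g 0 (\<alpha> 1)) w = V w * peval (?g 0 (\<alpha> 0)) w" for w
        using same_rational_map_cross[OF G, of 0 "\<alpha> 0" w "\<alpha> 1"] k by (simp add: psi peval_lf_comb)
      have t: "A w * V w * peval (?g 1 (\<beta> 2)) w = Q w * peval (?g 1 (\<beta> 0)) w" for w
        using same_rational_map_cross[OF G, of 1 "\<beta> 0" w "\<beta> 2"] k by (simp add: psi peval_lf_comb mult.assoc)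
      have u: "C w * V w * peval (?g 2 (\<gamma> 2)) w = Q w * peval (?g 2 (\<gamma> 0)) w" for w
        using same_rational_map_cross[OF G, of 2 "\<gamma> 0" w "\<gamma> 2"] k by (simp add: psi peval_lf_comb mult.assoc)
      consider "U v = 0" "V v = 0" | "Q v = 0" "A v * V v = 0" | "Q v = 0" "C v * V v = 0"
        using v by blast
      then show ?thesis
      proof cases
        case 1
        obtain eU eV where e: "U eU \<noteq> 0" "V eU = 0" "U eV = 0" "V eV \<noteq> 0" by (rule UV_lines)
        have "V (v + t *s eU) = 0" "U (v + t *s eV) = 0" "U (v + 1 *s eU) \<noteq> 0" "V (v + 1 *s eV) \<noteq> 0" for t
          unfolding UV_add using 1 e by simp_all
        note e' = this
        have "peval (?g 0 (\<alpha> 1)) (v + 0 *s eU) = 0"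
          by (rule vanish_along_curve[OF poly_curve_line, where F=Up and ?t0.0=1])
            (simp_all only: peval_UVQE s e' mult_zero_left not_False_eq_True)
        moreover have "peval (?g 0 (\<alpha> 0)) (v + 0 *s eV) = 0"
          by (rule vanish_along_curve[OF poly_curve_line, where F=Vp and ?t0.0=1])
            (simp_all only: peval_UVQE s[symmetric] e' mult_zero_left not_False_eq_True)
        ultimately show ?thesis by (simp add: peval_lf_comb mem_mproj_z)
      next
        case 2
        obtain g t0 where g: "poly_curve g" "g 0 = v" "\<And>t. Q (g t) = 0" "A (g t0) * V (g t0) \<noteq> 0"
          using quadric_curve[OF 2(1)] by blast
        have "peval (?g 1 (\<beta> 2)) (g 0) = 0"
          by (rule vanish_along_curve[OF g(1), where F="lincp nA * Vp" and ?t0.0=t0])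
            (use t g in \<open>simp_all add: peval_UVQE\<close>)
        moreover have "\<exists>e t0. (\<forall>t. A (v + t *s e) * V (v + t *s e) = 0) \<and> Q (v + t0 *s e) \<noteq> 0"
          using 2(2) A_line[of v] V_line[of v] by (metis mult_eq_0_iff)
        then obtain e t0 where e: "\<And>t. A (v + t *s e) * V (v + t *s e) = 0" "Q (v + t0 *s e) \<noteq> 0" by blast
        have "peval (?g 1 (\<beta> 0)) (v + 0 *s e) = 0"
          by (rule vanish_along_curve[OF poly_curve_line, where F=Qp and ?t0.0=t0])
            (use t[symmetric] e in \<open>simp_all only: peval_UVQE mult_zero_left not_False_eq_True\<close>)
        ultimately show ?thesis using g(2) by (simp add: peval_lf_comb mem_mproj_z)
      next
        case 3
        obtain g t0 where g: "poly_curve g" "g 0 = v" "\<And>t. Q (g t) = 0" "C (g t0) * V (g t0) \<noteq> 0"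
          using quadric_curve[OF 3(1)] by blast
        have "peval (?g 2 (\<gamma> 2)) (g 0) = 0"
          by (rule vanish_along_curve[OF g(1), where F="lincp nC * Vp" and ?t0.0=t0])
            (use u g in \<open>simp_all add: peval_UVQE\<close>)
        moreover have "\<exists>e t0. (\<forall>t. C (v + t *s e) * V (v + t *s e) = 0) \<and> Q (v + t0 *s e) \<noteq> 0"
          using 3(2) C_line[of v] V_line[of v] by (metis mult_eq_0_iff)
        then obtain e t0 where e: "\<And>t. C (v + t *s e) * V (v + t *s e) = 0" "Q (v + t0 *s e) \<noteq> 0" by blast
        have "peval (?g 2 (\<gamma> 0)) (v + 0 *s e) = 0"
          by (rule vanish_along_curve[OF poly_curve_line, where F=Qp and ?t0.0=t0])
            (use u[symmetric] e in \<open>simp_all only: peval_UVQE mult_zero_left not_False_eq_True\<close>)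
        ultimately show ?thesis using g(2) by (simp add: peval_lf_comb mem_mproj_z)
      qed
    qed
    then show ?thesis using v unfolding indeterminacy_locus_def by (auto simp: mem_mproj_P3)
  qed
  ultimately show ?thesis by blast
qed

text \<open>Each of the planes V = 0, A = 0, C = 0 cuts the quadric in two lines: s and r_1, y and
  r_0, z and r_0.\<close>

lemma base_locus_lines:
  "{v. v \<noteq> 0 \<and> (U v = 0 \<and> V v = 0 \<or> Q v = 0 \<and> (A v * V v = 0 \<or> C v * V v = 0))} =
   {v. v \<noteq> 0 \<and> U v = 0 \<and> V v = 0} \<union> {v. v \<noteq> 0 \<and> A v = 0 \<and> C v = 0} \<union> {v. v \<noteq> 0 \<and> B v = 0 \<and> D v = 0}
   \<union> {v. v \<noteq> 0 \<and> A v = 0 \<and> B v = 0} \<union> {v. v \<noteq> 0 \<and> C v = 0 \<and> D v = 0}"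
proof -
  have "(U v = 0 \<and> V v = 0 \<or> Q v = 0 \<and> (A v * V v = 0 \<or> C v * V v = 0)) \<longleftrightarrow>
    U v = 0 \<and> V v = 0 \<or> A v = 0 \<and> C v = 0 \<or> B v = 0 \<and> D v = 0 \<or> A v = 0 \<and> B v = 0 \<or> C v = 0 \<and> D v = 0" for v
  proof
    assume "U v = 0 \<and> V v = 0 \<or> Q v = 0 \<and> (A v * V v = 0 \<or> C v * V v = 0)"
    \<comment> \<open>With V = Q = 0, the identities \<open>BU\<close> and \<open>DU\<close> read BU
      = DU = 0.\<close>
    moreover have "V v = 0 \<Longrightarrow> Q v = 0 \<Longrightarrow> U v = 0 \<or> B v = 0 \<and> D v = 0"
      using BU[of v] DU[of v] by auto
    moreover have "A v = 0 \<Longrightarrow> Q v = 0 \<Longrightarrow> B v = 0 \<or> C v = 0" "C v = 0 \<Longrightarrow> Q v = 0 \<Longrightarrow> A v = 0 \<or> D v = 0"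
      using y1 z1 by (auto simp: Q_def)
    ultimately show "U v = 0 \<and> V v = 0 \<or> A v = 0 \<and> C v = 0 \<or> B v = 0 \<and> D v = 0 \<or> A v = 0 \<and> B v = 0 \<or> C v = 0 \<and> D v = 0"
      by auto
  qed (auto simp: Q_def U_def V_def)
  then show ?thesis by auto
qed

end

subsection \<open>Blow-ups\<close>

lemma join_coords_nth [simp]: "join_coords z v $ Inl w = z $ w" "join_coords z v $ Inr i = v $ i"
  by (simp_all add: join_coords_def)

lemma mem_mproj_join:
  "join_coords z v \<in> mproj (map_sum P111 P3) \<longleftrightarrow> z \<in> mproj P111 \<and> v \<in> mproj P3"
proof -
  have join: "join_coords z v \<in> mproj (map_sum P111 P3) \<longleftrightarrow>
      (\<forall>w'. \<exists>w. map_sum P111 P3 w = map_sum P111 P3 w' \<and> join_coords z v $ w \<noteq> 0)"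
    by (simp add: mproj_def)
  have "(\<exists>w. map_sum P111 P3 w = map_sum P111 P3 (Inl u) \<and> join_coords z v $ w \<noteq> 0) \<longleftrightarrow>
      (\<exists>w. fst w = fst u \<and> z $ w \<noteq> 0)" for u
    by (subst split_sum_ex) simp
  moreover have "(\<exists>w. map_sum P111 P3 w = map_sum P111 P3 (Inr i) \<and> join_coords z v $ w \<noteq> 0) \<longleftrightarrow>
      (\<exists>w. v $ w \<noteq> 0)" for i
    by (subst split_sum_ex) simp
  ultimately show ?thesis
    unfolding join split_sum_all by (simp add: mproj_def)
qed

definition lfJ :: "3 \<Rightarrow> real^2 \<Rightarrow> ((3 \<times> 2) + 4) cpoly" where
  "lfJ b u = (\<Sum>e\<in>UNIV. rconst (u $ e) * Var (Inl (b, e)))"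

definition linJ :: "complex^4 \<Rightarrow> ((3 \<times> 2) + 4) cpoly" where
  "linJ n = (\<Sum>i\<in>UNIV. Const (n $ i) * Var (Inr i))"

lemma peval_join [simp]:
  "peval (lfJ b u) (join_coords z v) = lf b u z" "peval (linJ n) (join_coords z v) = cdot n v"
  by (simp_all add: lfJ_def linJ_def peval_sum sum_two lf_def cdot_def)

lemma multihom_join:
  "multihom (map_sum P111 P3) (\<lambda>k. if k = Inl b then 1 else 0) (lfJ b u)"
  "multihom (map_sum P111 P3) (\<lambda>k. if k = Inr () then 1 else 0) (linJ n)"
proof -
  have "multihom (map_sum P111 P3) (\<lambda>k. if k = Inl b then 1 else 0) (Var (Inl (b, e)))" for e
    using multihom_Var[of "map_sum P111 P3" "Inl (b, e)"] by simp
  then show "multihom (map_sum P111 P3) (\<lambda>k. if k = Inl b then 1 else 0) (lfJ b u)"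
    unfolding lfJ_def by (intro multihom_sum multihom_Const_mult)
  have "multihom (map_sum P111 P3) (\<lambda>k. if k = Inr () then 1 else 0) (Var (Inr i))" for i
    using multihom_Var[of "map_sum P111 P3" "Inr i"] by simp
  then show "multihom (map_sum P111 P3) (\<lambda>k. if k = Inr () then 1 else 0) (linJ n)"
    unfolding linJ_def by (intro multihom_sum multihom_Const_mult)
qed

text \<open>Bihomogeneous equations of the graph survive in its closure; they bound the blow-ups
  from above.\<close>

lemma graph_closure_equation:
  assumes "join_coords z v \<in> graph_closure P111 P3 F" "multihom (map_sum P111 P3) d h"
    and "\<And>z. peval h (join_coords z (polymap F z)) = 0"
  shows "peval h (join_coords z v) = 0"
proof -
  let ?Z = "zero_locus (map_sum P111 P3) {h}"
  have "zariski_closed (map_sum P111 P3) ?Z"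
    by (rule zariski_closed_single[OF assms(2)])
  moreover have "{join_coords z (polymap F z) |z. z \<in> mproj P111 \<and> polymap F z \<in> mproj P3} \<subseteq> ?Z"
    using assms(3) by (auto simp: zero_locus_def mem_mproj_join)
  ultimately have "join_coords z v \<in> ?Z"
    using assms(1) unfolding graph_closure_def zariski_closure_def by blast
  then show ?thesis by (simp add: zero_locus_def)
qed

lemma peval_scale_join:
  assumes "multihom (map_sum P111 P3) d h"
  shows "peval h (join_coords z (k *s v)) = k ^ d (Inr ()) * peval h (join_coords z v)"
proof -
  let ?c = "\<lambda>w. case w of Inl _ \<Rightarrow> 1 | Inr _ \<Rightarrow> k"
  have "join_coords z (k *s v) = (\<chi> w. ?c (map_sum P111 P3 w) * join_coords z v $ w)"
    by (auto simp: vec_eq_iff join_coords_def split: sum.split)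
  then have "peval h (join_coords z (k *s v)) = (\<Prod>w\<in>UNIV. ?c w ^ d w) * peval h (join_coords z v)"
    using peval_scale[OF assms, of ?c "join_coords z v"] by simp
  also have "(\<Prod>w\<in>UNIV. ?c w ^ d w) = (\<Prod>w\<in>{Inr ()}. ?c w ^ d w)"
    by (rule prod.mono_neutral_right) (auto split: sum.splits)
  finally show ?thesis by simp
qed

lemma mproj_P111_near:
  assumes "z \<in> mproj P111"
  obtains S where "finite S" "\<And>t. t \<notin> S \<Longrightarrow> z + t *s w \<in> mproj P111"
proof -
  have "\<forall>b. \<exists>e. z $ (b, e) \<noteq> 0" using assms by (auto simp: mem_mproj_P111)
  then obtain e where e: "\<And>b. z $ (b, e b) \<noteq> 0" by metis
  let ?S = "\<Union>b. {t. poly [:z $ (b, e b), w $ (b, e b):] t = 0}"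
  have "finite ?S"
    by (intro finite_UN_I finite poly_roots_finite) (use e in auto)
  moreover have "z + t *s w \<in> mproj P111" if "t \<notin> ?S" for t
  proof -
    have "(z + t *s w) $ (b, e b) \<noteq> 0" for b using that by auto
    then have "\<not> (\<forall>e. (z + t *s w) $ (b, e) = 0)" for b by blast
    then show ?thesis unfolding mem_mproj_P111 all_two by blast
  qed
  ultimately show ?thesis by (rule that)
qed

text \<open>For small nonzero t the image of z + tw is the point v + t r(t), which tends to v.
  Algebraically, an equation of the graph restricts to a polynomial in t that vanishes off a finite
  set, hence also at t = 0.\<close>

lemma graph_closure_limit:
  assumes z: "z \<in> mproj P111" and v: "v \<noteq> 0"
    and lim: "\<And>t. polymap F (z + t *s w) = t *s (v + t *s r t)"
    and r: "\<And>i. \<exists>p. \<forall>t. poly p t = r t $ i"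
  shows "join_coords z v \<in> graph_closure P111 P3 F"
  unfolding graph_closure_def zariski_closure_def
proof (intro InterI, clarify)
  fix Z assume "zariski_closed (map_sum P111 P3) Z"
    and sub: "{join_coords z (polymap F z) |z. z \<in> mproj P111 \<and> polymap F z \<in> mproj P3} \<subseteq> Z"
  then obtain H where H: "\<And>h. h \<in> H \<Longrightarrow> \<exists>d. multihom (map_sum P111 P3) d h"
    and Z: "Z = zero_locus (map_sum P111 P3) H"
    unfolding zariski_closed_def by blast
  obtain p where p: "\<And>i t. poly (p i) t = r t $ i" using r by metis
  obtain S where S: "finite S" "\<And>t. t \<notin> S \<Longrightarrow> z + t *s w \<in> mproj P111"
    using mproj_P111_near[OF z, where w=w] by blast
  obtain i where i: "v $ i \<noteq> 0" using v by (auto simp: vec_eq_iff)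
  \<comment> \<open>One coordinate of v + t r(t), nonzero at t = 0; its finitely many zeros are
    avoided so that the image is a point.\<close>
  let ?P = "[:v $ i:] + [:0, 1:] * p i"
  have "poly ?P 0 \<noteq> 0" using i by simp
  then have "?P \<noteq> 0" by (metis poly_0)
  then have finP: "finite {t. poly ?P t = 0}" by (rule poly_roots_finite)
  have "peval h (join_coords z v) = 0" if "h \<in> H" for h
  proof -
    obtain d where d: "multihom (map_sum P111 P3) d h" using H \<open>h \<in> H\<close> by blast
    let ?g = "\<lambda>k. case k of Inl u \<Rightarrow> [:z $ u, w $ u:] | Inr j \<Rightarrow> [:v $ j:] + [:0, 1:] * p j"
    obtain R where R: "\<And>t. poly R t = peval h (\<chi> k. poly (?g k) t)"
      using peval_poly_curve[where p=h and g="?g"] by blast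
    have curve: "(\<chi> k. poly (?g k) t) = join_coords (z + t *s w) (v + t *s r t)" for t
      by (auto simp: vec_eq_iff join_coords_def p split: sum.split)
    have "R = 0"
    proof (rule poly_zero_of_cofinite)
      show "finite (insert 0 (S \<union> {t. poly ?P t = 0}))" using S(1) finP by simp
      fix t assume t: "t \<notin> insert 0 (S \<union> {t. poly ?P t = 0})"
      then have "(v + t *s r t) $ i \<noteq> 0" by (simp add: p)
      then have "v + t *s r t \<noteq> 0" by (metis zero_index)
      then have "polymap F (z + t *s w) \<in> mproj P3"
        using t unfolding mem_mproj_P3 lim vector_mul_eq_0 by blast
      then have "join_coords (z + t *s w) (polymap F (z + t *s w)) \<in> Z"
        using sub S(2)[of t] t by blast
      then have "peval h (join_coords (z + t *s w) (t *s (v + t *s r t))) = 0"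
        using \<open>h \<in> H\<close> unfolding Z zero_locus_def lim by blast
      then have "peval h (join_coords (z + t *s w) (v + t *s r t)) = 0"
        using t unfolding peval_scale_join[OF d] by simp
      then show "poly R t = 0" by (simp add: R curve)
    qed
    then have "peval h (join_coords (z + 0 *s w) (v + 0 *s r 0)) = 0"
      using R[of 0] curve[of 0] by simp
    then show ?thesis by simp
  qed
  then show "join_coords z v \<in> Z"
    using z v by (simp add: Z zero_locus_def mem_mproj_join mem_mproj_P3)
qed

lemma blows_up_toI:
  assumes "\<And>z. z \<in> zero_locus P111 I \<Longrightarrow> polymap F z = 0"
    and "\<And>v. v \<noteq> 0 \<Longrightarrow> R v \<Longrightarrow> \<exists>z\<in>zero_locus P111 I. join_coords z v \<in> graph_closure P111 P3 F"
    and "\<And>z v. z \<in> zero_locus P111 I \<Longrightarrow> join_coords z v \<in> graph_closure P111 P3 F \<Longrightarrow> R v"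
  shows "blows_up_to P111 P3 F I {v. v \<noteq> 0 \<and> R v}"
  unfolding blows_up_to_def mem_mproj_P3 using assms by blast

context normal_form
begin

lemma graph_closure_limit_coords:
  assumes "z \<in> mproj P111" "v \<noteq> 0"
    and "\<And>t. A (f (z + t *s w)) = t * (A v + t * poly pA t)" "\<And>t. B (f (z + t *s w)) = t * (B v + t * poly pB t)"
      "\<And>t. C (f (z + t *s w)) = t * (C v + t * poly pC t)" "\<And>t. D (f (z + t *s w)) = t * (D v + t * poly pD t)"
  shows "join_coords z v \<in> graph_closure P111 P3 \<phi>"
proof (rule graph_closure_limit[OF assms(1,2)])
  let ?r = "\<lambda>t. poly pA t *s eA + poly pB t *s eB + poly pC t *s eC + poly pD t *s eD"
  show "f (z + t *s w) = t *s (v + t *s ?r t)" for t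
    by (rule eq_by_coords) (simp_all add: assms dual distrib_left)
  show "\<exists>p. \<forall>t. poly p t = ?r t $ i" for i
    by (rule exI[of _ "pA * [:eA $ i:] + pB * [:eB $ i:] + pC * [:eC $ i:] + pD * [:eD $ i:]"]) simp
qed

lemma lf_add: "lf b' u (z + t *s w) = lf b' u z + t * lf b' u w"
  by (simp add: lf_def algebra_simps)

lemma f_eq_0_iff: "f z = 0 \<longleftrightarrow> a 0 z * b 0 z * c 2 z = 0 \<and> a 1 z * b 1 z * c 2 z = 0 \<and>
    a 0 z * b 2 z * c 0 z = 0 \<and> a 1 z * b 2 z * c 1 z = 0"
  unfolding coords_zero_iff[of "f z"] A_phi B_phi C_phi D_phi ..

text \<open>On the graph both sides equal a_0 a_1 E. Over a point with a_0 = 0 only U = 0 remains,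
  over one with a_1 = 0 only V = 0.\<close>

lemma graph_closure_UV:
  assumes "join_coords z v \<in> graph_closure P111 P3 \<phi>"
  shows "a 1 z * U v = a 0 z * V v"
proof -
  let ?h = "lfJ 0 (\<alpha> 1) * linJ ((y * y1) *s nA - (x * z1) *s nC) - lfJ 0 (\<alpha> 0) * linJ (y *s nB - x *s nD)"
  have h: "peval ?h (join_coords z v) = a 1 z * U v - a 0 z * V v" for z v
    by (simp add: U_def V_def)
  have "peval ?h (join_coords z v) = 0"
  proof (rule graph_closure_equation[OF assms])
    show "multihom (map_sum P111 P3) (\<lambda>k. (if k = Inl 0 then 1 else 0) + (if k = Inr () then 1 else 0)) ?h"
      by (intro multihom_diff multihom_mult multihom_join)
    show "peval ?h (join_coords z' (f z')) = 0" for z' unfolding h by (simp add: U_f V_f)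
  qed
  then show ?thesis unfolding h by simp
qed

lemma blows_up_point0:
  "blows_up_to P111 P3 \<phi> {fa 0, fb 1, fc 1} {v. v \<noteq> 0 \<and> U v = 0}"
proof (rule blows_up_toI)
  fix z assume "z \<in> zero_locus P111 {fa 0, fb 1, fc 1}"
  then show "f z = 0"
    by (simp add: zero_locus_def peval_facform f_eq_0_iff)
next
  fix v assume v: "v \<noteq> 0" "U v = 0"
  \<comment> \<open>The values of b_0 and c_0 solve b_1 = c_1 = 0 with b_2 = c_2 = 1.\<close>
  obtain z where z: "a 0 z = 0" "a 1 z = 1" "b 0 z = - x / y1" "b 2 z = 1" "c 0 z = - y / z1" "c 2 z = 1"
    by (rule obtain_point)
  have z': "b 1 z = 0" "c 1 z = 0" using y1 z1 by (simp_all add: b1 c1 z)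
  \<comment> \<open>\<open>X\<close> is the a_0-component of the tangent direction: to first order A
    and C become - X x / y_1 and - X y / z_1. One X serves for both exactly because U v = 0.\<close>
  obtain X where X: "- X * x = y1 * A v" "- X * y = z1 * C v"
  proof (cases "x = 0")
    case False
    then have "y * (y1 * A v / x) = z1 * C v" using v(2) by (simp add: U_def field_simps)
    then show ?thesis using False by (intro that[of "- (y1 * A v / x)"]) (simp_all add: mult.commute)
  next
    case True
    then have "y \<noteq> 0" using xy by simp
    then have "A v = 0" using v(2) True y1 unfolding U_def by simp
    then show ?thesis using \<open>y \<noteq> 0\<close> True by (intro that[of "- (z1 * C v / y)"]) simp_all
  qed
  have X': "A v = - X * x / y1" "C v = - X * y / z1" using X y1 z1 by (simp_all add: field_simps)
  obtain w where w: "a 0 w = X" "a 1 w = 0" "b 0 w = B v / y1" "b 2 w = 0" "c 0 w = D v / z1" "c 2 w = 0"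
    by (rule obtain_point)
  have w': "b 1 w = B v" "c 1 w = D v" using y1 z1 by (simp_all add: b1 c1 w)
  have zp: "z \<in> mproj P111" by (simp add: mem_mproj_z z)
  have "join_coords z v \<in> graph_closure P111 P3 \<phi>"
    by (rule graph_closure_limit_coords[OF zp v(1), where w=w and pA="[:X * B v / y1:]" and pB=0 and pC="[:X * D v / z1:]" and pD=0])
      (use y1 z1 in \<open>simp_all add: A_phi B_phi C_phi D_phi lf_add z w z' w' X' field_simps\<close>)
  moreover have "z \<in> zero_locus P111 {fa 0, fb 1, fc 1}"
    using zp by (simp add: zero_locus_def peval_facform z z')
  ultimately show "\<exists>z\<in>zero_locus P111 {fa 0, fb 1, fc 1}. join_coords z v \<in> graph_closure P111 P3 \<phi>" by blast
next
  fix z v assume z: "z \<in> zero_locus P111 {fa 0, fb 1, fc 1}"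
    and graph: "join_coords z v \<in> graph_closure P111 P3 \<phi>"
  have "a 0 z = 0" "a 1 z \<noteq> 0" using z by (auto simp: zero_locus_def peval_facform mem_mproj_z)
  then show "U v = 0" using graph_closure_UV[OF graph] by simp
qed

lemma blows_up_point1:
  "blows_up_to P111 P3 \<phi> {fa 1, fb 0, fc 0} {v. v \<noteq> 0 \<and> V v = 0}"
proof (rule blows_up_toI)
  fix z assume "z \<in> zero_locus P111 {fa 1, fb 0, fc 0}"
  then show "f z = 0"
    by (simp add: zero_locus_def peval_facform f_eq_0_iff)
next
  fix v assume v: "v \<noteq> 0" "V v = 0"
  obtain z where z: "a 0 z = 1" "a 1 z = 0" "b 0 z = 0" "b 2 z = 1" "c 0 z = 0" "c 2 z = 1"
    by (rule obtain_point)
  have z': "b 1 z = x" "c 1 z = y" by (simp_all add: b1 c1 z)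
  \<comment> \<open>Here X is the a_1-component of the direction; B and D have first-order terms X x
    and X y, and V v = 0 makes them compatible.\<close>
  obtain X where X: "X * x = B v" "X * y = D v"
  proof (cases "x = 0")
    case False
    then have "y * (B v / x) = D v" using v(2) by (simp add: V_def field_simps)
    then show ?thesis using False by (intro that[of "B v / x"]) (simp_all add: mult.commute)
  next
    case True
    then have "y \<noteq> 0" using xy by simp
    then have "B v = 0" using v(2) True unfolding V_def by simp
    then show ?thesis using \<open>y \<noteq> 0\<close> True by (intro that[of "D v / y"]) simp_all
  qed
  obtain w where w: "a 0 w = 0" "a 1 w = X" "b 0 w = A v" "b 2 w = 0" "c 0 w = C v" "c 2 w = 0"
    by (rule obtain_point)
  have w': "b 1 w = y1 * A v" "c 1 w = z1 * C v" by (simp_all add: b1 c1 w)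
  have zp: "z \<in> mproj P111" by (simp add: mem_mproj_z z)
  have "join_coords z v \<in> graph_closure P111 P3 \<phi>"
    by (rule graph_closure_limit_coords[OF zp v(1), where w=w and pA=0 and pB="[:X * y1 * A v:]" and pC=0 and pD="[:X * z1 * C v:]"])
      (simp_all add: A_phi B_phi C_phi D_phi lf_add z w z' w' X[symmetric] algebra_simps)
  moreover have "z \<in> zero_locus P111 {fa 1, fb 0, fc 0}"
    using zp by (simp add: zero_locus_def peval_facform z z')
  ultimately show "\<exists>z\<in>zero_locus P111 {fa 1, fb 0, fc 0}. join_coords z v \<in> graph_closure P111 P3 \<phi>" by blast
next
  fix z v assume z: "z \<in> zero_locus P111 {fa 1, fb 0, fc 0}"
    and graph: "join_coords z v \<in> graph_closure P111 P3 \<phi>"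
  have "a 1 z = 0" "a 0 z \<noteq> 0" using z by (auto simp: zero_locus_def peval_facform mem_mproj_z)
  then show "V v = 0" using graph_closure_UV[OF graph] by simp
qed

text \<open>The position (p : q) on the base line gives one ruling of the quadric, and the normal
  direction, with b_2 and c_2 moving by n and m, gives the other.\<close>

lemma blows_up_line:
  "blows_up_to P111 P3 \<phi> {fb 2, fc 2} {v. v \<noteq> 0 \<and> Q v = 0}"
proof (rule blows_up_toI)
  fix z assume "z \<in> zero_locus P111 {fb 2, fc 2}"
  then show "f z = 0"
    by (simp add: zero_locus_def peval_facform f_eq_0_iff)
next
  fix v assume v: "v \<noteq> 0" "Q v = 0"
  obtain p q m n where pq: "A v = p * m" "B v = y1 * q * m" "C v = p * n" "D v = z1 * q * n"
    by (rule quadric_param[OF v(2)])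
  have pq0: "p \<noteq> 0 \<or> q \<noteq> 0" using v(1) pq by (auto simp: coords_zero_iff)
  obtain z where z: "a 0 z = p" "a 1 z = q" "b 0 z = 1" "b 2 z = 0" "c 0 z = 1" "c 2 z = 0"
    by (rule obtain_point)
  have z': "b 1 z = y1" "c 1 z = z1" by (simp_all add: b1 c1 z)
  obtain w where w: "a 0 w = 0" "a 1 w = 0" "b 0 w = 0" "b 2 w = n" "c 0 w = 0" "c 2 w = m"
    by (rule obtain_point)
  have w': "b 1 w = x * n" "c 1 w = y * m" by (simp_all add: b1 c1 w)
  have zp: "z \<in> mproj P111" using pq0 by (simp add: mem_mproj_z z)
  have "join_coords z v \<in> graph_closure P111 P3 \<phi>"
    by (rule graph_closure_limit_coords[OF zp v(1), where w=w and pA=0 and pB="[:q * x * n * m:]" and pC=0 and pD="[:q * y * n * m:]"])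
      (use pq in \<open>simp_all add: A_phi B_phi C_phi D_phi lf_add z w z' w' algebra_simps\<close>)
  moreover have "z \<in> zero_locus P111 {fb 2, fc 2}"
    using zp by (simp add: zero_locus_def peval_facform z z')
  ultimately show "\<exists>z\<in>zero_locus P111 {fb 2, fc 2}. join_coords z v \<in> graph_closure P111 P3 \<phi>" by blast
next
  fix z v assume z: "z \<in> zero_locus P111 {fb 2, fc 2}"
    and graph: "join_coords z v \<in> graph_closure P111 P3 \<phi>"
  have z': "b 2 z = 0" "c 2 z = 0" "a 0 z \<noteq> 0 \<or> a 1 z \<noteq> 0" "b 0 z \<noteq> 0" "c 0 z \<noteq> 0"
    using z by (auto simp: zero_locus_def peval_facform mem_mproj_z)
  \<comment> \<open>On the graph both terms equal a_0 a_1 b_0 b_1 c_2. Over the base line b_1 = y_1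
    b_0 with b_0 nonzero, so b_0 cancels; the analogous relation for C and D follows, and the two
    together imply Q = 0.\<close>
  let ?h = "lfJ 0 (\<alpha> 1) * lfJ 1 (\<beta> 1) * linJ nA - lfJ 0 (\<alpha> 0) * lfJ 1 (\<beta> 0) * linJ nB"
  have "peval ?h (join_coords z v) = 0"
  proof (rule graph_closure_equation[OF graph])
    show "multihom (map_sum P111 P3) (\<lambda>k. (if k = Inl 0 then 1 else 0) + (if k = Inl 1 then 1 else 0) + (if k = Inr () then 1 else 0)) ?h"
      by (intro multihom_diff multihom_mult multihom_join)
    show "peval ?h (join_coords z' (f z')) = 0" for z' by (simp add: A_phi B_phi)
  qed
  then have h1: "y1 * a 1 z * A v = a 0 z * B v" using z' by (simp add: b1 mult_ac)
  let ?h = "lfJ 0 (\<alpha> 1) * lfJ 2 (\<gamma> 1) * linJ nC - lfJ 0 (\<alpha> 0) * lfJ 2 (\<gamma> 0) * linJ nD"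
  have "peval ?h (join_coords z v) = 0"
  proof (rule graph_closure_equation[OF graph])
    show "multihom (map_sum P111 P3) (\<lambda>k. (if k = Inl 0 then 1 else 0) + (if k = Inl 2 then 1 else 0) + (if k = Inr () then 1 else 0)) ?h"
      by (intro multihom_diff multihom_mult multihom_join)
    show "peval ?h (join_coords z' (f z')) = 0" for z' by (simp add: C_phi D_phi)
  qed
  then have h2: "z1 * a 1 z * C v = a 0 z * D v" using z' by (simp add: c1 mult_ac)
  have "a 0 z * Q v = 0" "a 1 z * Q v = 0" using h1 h2 unfolding Q_def by algebra+
  then show "Q v = 0" using z'(3) by auto
qed

end

section \<open>Reduction to the normal form\<close>

lemma cdot_cvec: "cdot (cvec n) (cvec v) = of_real (n \<bullet> v)"
  by (simp add: cdot_def cvec_def inner_vec_def)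

lemma peval_linform: "peval (linform n) v = cdot (cvec n) v"
  by (simp add: linform_def peval_sum cdot_def cvec_def)

lemma cvec_eq_0_iff: "cvec n = 0 \<longleftrightarrow> n = 0"
  by (simp add: cvec_def vec_eq_iff)

lemma mem_plane_of: "v \<in> plane_of n \<longleftrightarrow> v \<noteq> 0 \<and> cdot (cvec n) v = 0"
  by (simp add: plane_of_def zero_locus_def mem_mproj_P3 peval_linform)

lemma multihom_trilin: "multihom P111 (\<lambda>_. 1) (trilin w P i)"
proof -
  have *: "multihom P111 (\<lambda>b. if b = fst v then 1 else 0) (Var v)" for v :: "3 \<times> 2"
    by (rule multihom_Var)
  have "multihom P111 (\<lambda>_. 1) (Const k * Var (0, i') * Var (1, j) * Var (2, l))" for k i' j l
  proof -
    have "multihom P111 (\<lambda>b. (if b = 0 then 1 else 0) + (if b = 1 then 1 else 0) + (if b = 2 then 1 else 0))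
        (Const k * (Var (0, i') * Var (1, j) * Var (2, l)))"
      using *[of "(0, i')"] *[of "(1, j)"] *[of "(2, l)"]
      by (intro multihom_Const_mult multihom_mult) simp_all
    moreover have "(\<lambda>b::3. (if b = 0 then 1 else 0) + (if b = 1 then 1 else 0) + (if b = 2 then 1 else (0::nat))) = (\<lambda>_. 1)"
      using all_three[of "\<lambda>b. (if b = 0 then 1 else 0) + (if b = 1 then 1 else 0) + (if b = 2 then 1 else (0::nat)) = 1"]
      by auto
    ultimately show ?thesis by (simp add: mult.assoc)
  qed
  then show ?thesis
    unfolding trilin_def by (intro multihom_sum)
qed

section \<open>Binary linear forms and the trilinear map in separate arguments\<close>

definition ev2 :: "real^2 \<Rightarrow> (2 \<Rightarrow> complex) \<Rightarrow> complex" where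
  "ev2 v s = of_real (v $ 0) * s 0 + of_real (v $ 1) * s 1"

abbreviation unit2 :: "2 \<Rightarrow> 2 \<Rightarrow> complex" where
  "unit2 i \<equiv> (\<lambda>j. if j = i then 1 else 0)"

text \<open>Homogeneous coordinates of the zero on the projective line of the linear form with
  coefficients \<open>v\<close>.\<close>

definition perp :: "real^2 \<Rightarrow> 2 \<Rightarrow> complex" where
  "perp v = (\<lambda>i. if i = 0 then - of_real (v $ 1) else of_real (v $ 0))"

lemma ev2_perp: "ev2 u (perp v) = - of_real (det2 u v)"
  by (simp add: ev2_def perp_def det2_def)

lemma ev2_perp_self [simp]: "ev2 v (perp v) = 0"
  by (simp add: ev2_def perp_def)

lemma ev2_unit2 [simp]: "ev2 v (unit2 i) = of_real (v $ i)"
  using all_two[of "\<lambda>i. ev2 v (unit2 i) = of_real (v $ i)"] by (simp add: ev2_def)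

lemma ev2_eq_0_imp:
  assumes "ev2 v s = 0" "v $ 0 \<noteq> 0"
  obtains k where "s = (\<lambda>i. k * perp v i)"
proof
  have "\<forall>i. s i = s 1 / of_real (v $ 0) * perp v i"
    unfolding all_two using assms by (simp add: ev2_def perp_def field_simps eq_neg_iff_add_eq_0)
  then show "s = (\<lambda>i. s 1 / of_real (v $ 0) * perp v i)" by blast
qed

lemma lf_ev2: "lf b v z = ev2 v (\<lambda>e. z $ (b, e))"
  by (simp add: lf_def ev2_def)

definition trivec :: "weights \<Rightarrow> ctrl \<Rightarrow> 2 \<Rightarrow> 2 \<Rightarrow> 2 \<Rightarrow> complex^4" where
  "trivec w P i j k = of_real (w i j k) *s cvec (P i j k)"

definition Fv :: "weights \<Rightarrow> ctrl \<Rightarrow> (2 \<Rightarrow> complex) \<Rightarrow> (2 \<Rightarrow> complex) \<Rightarrow> (2 \<Rightarrow> complex) \<Rightarrow> complex^4" where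
  "Fv w P s t u = (\<Sum>i\<in>UNIV. \<Sum>j\<in>UNIV. \<Sum>k\<in>UNIV. (s i * t j * u k) *s trivec w P i j k)"

lemma polymap_trilin: "polymap (trilin w P) z = Fv w P (\<lambda>i. z $ (0, i)) (\<lambda>i. z $ (1, i)) (\<lambda>i. z $ (2, i))"
  by (simp add: vec_eq_iff polymap_def trilin_def peval_sum Fv_def trivec_def cvec_def mult_ac)

definition mkpt :: "(2 \<Rightarrow> complex) \<Rightarrow> (2 \<Rightarrow> complex) \<Rightarrow> (2 \<Rightarrow> complex) \<Rightarrow> complex^(3 \<times> 2)" where
  "mkpt s t u = (\<chi> v. if fst v = 0 then s (snd v) else if fst v = 1 then t (snd v) else u (snd v))"

lemma mkpt_nth [simp]: "mkpt s t u $ (0, i) = s i" "mkpt s t u $ (1, i) = t i" "mkpt s t u $ (2, i) = u i"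
  by (simp_all add: mkpt_def)

lemma polymap_mkpt: "polymap (trilin w P) (mkpt s t u) = Fv w P s t u"
  by (simp add: polymap_trilin)

lemma Fv_linear:
  "Fv w P (\<lambda>i. c * s i + d * s' i) t u = c *s Fv w P s t u + d *s Fv w P s' t u"
  "Fv w P s (\<lambda>i. c * t i + d * t' i) u = c *s Fv w P s t u + d *s Fv w P s t' u"
  "Fv w P s t (\<lambda>i. c * u i + d * u' i) = c *s Fv w P s t u + d *s Fv w P s t u'"
  by (simp_all add: Fv_def sum_two vec_eq_iff algebra_simps)

lemma Fv_scale:
  "Fv w P (\<lambda>i. c * s i) t u = c *s Fv w P s t u"
  "Fv w P s (\<lambda>i. c * t i) u = c *s Fv w P s t u"
  "Fv w P s t (\<lambda>i. c * u i) = c *s Fv w P s t u"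
  using Fv_linear[where d=0 and c=c] by simp_all

lemma Fv_unit:
  "Fv w P (unit2 i) (unit2 j) (unit2 k) = trivec w P i j k"
  "Fv w P s (unit2 j) (unit2 k) = s 0 *s trivec w P 0 j k + s 1 *s trivec w P 1 j k"
  "Fv w P (unit2 i) t (unit2 k) = t 0 *s trivec w P i 0 k + t 1 *s trivec w P i 1 k"
  "Fv w P (unit2 i) (unit2 j) u = u 0 *s trivec w P i j 0 + u 1 *s trivec w P i j 1"
proof -
  have cases: "i = 0 \<or> i = 1" for i :: 2 using all_two[of "\<lambda>i. i = 0 \<or> i = 1"] by simp
  show *: "Fv w P s (unit2 j) (unit2 k) = s 0 *s trivec w P 0 j k + s 1 *s trivec w P 1 j k" for s
    using cases[of j] cases[of k] by (auto simp: Fv_def sum_two)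
  show "Fv w P (unit2 i) (unit2 j) (unit2 k) = trivec w P i j k"
    using cases[of i] by (auto simp: *)
  show "Fv w P (unit2 i) t (unit2 k) = t 0 *s trivec w P i 0 k + t 1 *s trivec w P i 1 k"
    using cases[of i] cases[of k] by (auto simp: Fv_def sum_two)
  show "Fv w P (unit2 i) (unit2 j) u = u 0 *s trivec w P i j 0 + u 1 *s trivec w P i j 1"
    using cases[of j] cases[of i] by (auto simp: Fv_def sum_two)
qed

lemma cdot_Fv:
  assumes "\<And>i j k. cdot N (trivec w P i j k) = K * of_real (a $ i) * of_real (b $ j) * of_real (c $ k)"
  shows "cdot N (Fv w P s t u) = K * ev2 a s * ev2 b t * ev2 c u"
  by (simp add: Fv_def sum_two assms ev2_def algebra_simps)

subsection \<open>Boundary surfaces\<close>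

text \<open>Points of the closure come from arguments in the product with nonzero image. Elsewhere
  the image is the zero vector, since a vanishing block kills the trilinear map, and a form of
  positive degree vanishes at the origin.\<close>

lemma slice_in_surface:
  assumes "z $ (b, 1 - e) = 0" "multihom P3 (\<lambda>_. Suc d) F" "surface_of F = bsurface w P b e"
  shows "peval F (polymap (trilin w P) z) = 0"
proof (cases "polymap (trilin w P) z = 0")
  case True
  have "peval F (\<chi> v. 0 * (0 :: complex^4) $ v) = 0"
    using peval_scale[OF assms(2), of "\<lambda>_. 0" 0] by simp
  moreover have "(\<chi> v. 0 * (0 :: complex^4) $ v) = 0" by (simp add: vec_eq_iff)
  ultimately show ?thesis using True by simp
next
  case False
  have "z \<in> mproj P111"
  proof (rule ccontr)
    assume "z \<notin> mproj P111"
    then obtain b' where b': "z $ (b', 0) = 0" "z $ (b', 1) = 0" by (auto simp: mem_mproj_P111)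
    have "b' = 0 \<or> b' = 1 \<or> b' = 2" using all_three[of "\<lambda>b. b = 0 \<or> b = 1 \<or> b = 2"] by simp
    then have "polymap (trilin w P) z = 0"
      using b' by (auto simp: polymap_trilin Fv_def sum_two)
    with False show False by simp
  qed
  then have "polymap (trilin w P) z \<in> bsurface w P b e"
    unfolding bsurface_def zariski_closure_def using False assms(1) by (auto simp: mem_mproj_P3)
  then show ?thesis unfolding assms(3)[symmetric] by (simp add: mem_surface_of)
qed

lemma bsurface_subset_plane:
  assumes "\<And>z. z $ (b, 1 - e) = 0 \<Longrightarrow> cdot n (polymap (trilin w P) z) = 0" "v \<in> bsurface w P b e"
  shows "cdot n v = 0"
proof -
  have "zariski_closed P3 (zero_locus P3 {lincp n})"
    by (rule zariski_closed_single[OF multihom_lincp])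
  moreover have "{polymap (trilin w P) z | z. z \<in> mproj P111 \<and> z $ (b, 1 - e) = 0 \<and>
      polymap (trilin w P) z \<in> mproj P3} \<subseteq> zero_locus P3 {lincp n}"
    using assms(1) by (auto simp: zero_locus_def)
  ultimately have "v \<in> zero_locus P3 {lincp n}"
    using assms(2) unfolding bsurface_def zariski_closure_def by blast
  then show ?thesis by (simp add: zero_locus_def)
qed

text \<open>A linear form that vanishes on the slice vanishes on its closure, and a smooth quadric
  lies in no plane.\<close>

lemma quadric_slice_annihilator:
  assumes "smooth_surface 2 (bsurface w P b e)"
    "\<And>z. z $ (b, 1 - e) = 0 \<Longrightarrow> cdot n (polymap (trilin w P) z) = 0"
  shows "n = 0"
proof -
  obtain F where F: "smooth_form 2 F" "bsurface w P b e = surface_of F"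
    using assms(1) unfolding smooth_surface_def by blast
  show ?thesis
  proof (rule smooth_quadric_not_in_plane[OF F(1)])
    fix v assume "v \<in> surface_of F"
    then have "v \<in> bsurface w P b e" using F(2) by blast
    then show "cdot n v = 0" using bsurface_subset_plane[of b e n w P v] assms(2) by blast
  qed
qed

text \<open>\<open>F\<close> is known only through its zero set and could a priori be zero.
  Comparison with a smooth form \<open>F'\<close> of the same zero set excludes this; a form
  vanishing on the whole plane is then a multiple of \<open>m\<close>.\<close>

lemma plane_slice_annihilator:
  assumes "smooth_surface 1 (bsurface w P b e)" "multihom P3 (\<lambda>_. 1) F" "surface_of F = bsurface w P b e"
    "\<And>v. peval F v = cdot m v"
  shows "m \<noteq> 0"
    and "(\<And>z. z $ (b, 1 - e) = 0 \<Longrightarrow> cdot n (polymap (trilin w P) z) = 0) \<Longrightarrow> \<exists>k. n = k *s m"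
proof -
  obtain F' where F': "smooth_form 1 F'" "bsurface w P b e = surface_of F'"
    using assms(1) unfolding smooth_surface_def by blast
  obtain m' where m': "\<And>v. peval F' v = cdot m' v"
    using F'(1) linear_form_cdot[of F'] by (auto simp: smooth_form_def)
  have "m' \<noteq> 0" by (rule smooth_form_1D[OF F'(1) m'])
  then obtain v where v: "cdot m' v \<noteq> 0" using cdot_eq_0_imp by blast
  then have "v \<notin> surface_of F" unfolding assms(3) F'(2) by (simp add: mem_surface_of m')
  moreover have "v \<noteq> 0" using v by auto
  ultimately show "m \<noteq> 0" using assms(4)[of v] by (auto simp: mem_surface_of)
  assume *: "\<And>z. z $ (b, 1 - e) = 0 \<Longrightarrow> cdot n (polymap (trilin w P) z) = 0"
  show "\<exists>k. n = k *s m"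
  proof (rule cdot_proportional)
    fix v assume "v \<noteq> 0" "cdot m v = 0"
    then have "v \<in> bsurface w P b e" by (simp add: assms(3)[symmetric] mem_surface_of assms(4))
    then show "cdot n v = 0" using bsurface_subset_plane[of b e n w P v] * by blast
  qed
qed

lemma sum_two_two: "sum g (UNIV :: (2 \<times> 2) set) = g (0, 0) + g (0, 1) + g (1, 0) + g (1, 1)"
proof -
  have "sum g (UNIV :: (2 \<times> 2) set) = (\<Sum>i\<in>UNIV. \<Sum>j\<in>UNIV. g (i, j))"
    unfolding UNIV_Times_UNIV[symmetric] by (simp add: sum.cartesian_product)
  then show ?thesis by (simp add: sum_two add.assoc)
qed

lemma four_vectors:
  fixes v :: "2 \<Rightarrow> 2 \<Rightarrow> complex^4" and d :: "2 \<Rightarrow> 2 \<Rightarrow> complex"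
  assumes "\<And>n. (\<And>i j. cdot n (v i j) = 0) \<Longrightarrow> n = 0"
  shows "d 0 0 *s v 0 0 + d 0 1 *s v 0 1 + d 1 0 *s v 1 0 + d 1 1 *s v 1 1 = 0 \<Longrightarrow> d i j = 0"
    and "\<exists>c :: 2 \<Rightarrow> 2 \<Rightarrow> complex. x = c 0 0 *s v 0 0 + c 0 1 *s v 0 1 + c 1 0 *s v 1 0 + c 1 1 *s v 1 1"
    and "\<exists>n. \<forall>i j. cdot n (v i j) = d i j"
proof -
  have ann: "\<forall>n. (\<forall>ij. cdot n (case ij of (i, j) \<Rightarrow> v i j) = 0) \<longrightarrow> n = 0"
    using assms by auto
  have card: "CARD(2 \<times> 2) = CARD(4)" by simp
  note L = annihilator_iff_independent[OF card, where v="\<lambda>ij. case ij of (i, j) \<Rightarrow> v i j"]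
  show "\<exists>n. \<forall>i j. cdot n (v i j) = d i j"
    using L(3)[OF ann, of "\<lambda>ij. case ij of (i, j) \<Rightarrow> d i j"] by auto
  obtain c where "x = (\<Sum>ij\<in>UNIV. c ij *s (case ij of (i, j) \<Rightarrow> v i j))"
    using L(2)[OF ann, of x] by blast
  then have "x = c (0,0) *s v 0 0 + c (0,1) *s v 0 1 + c (1,0) *s v 1 0 + c (1,1) *s v 1 1"
    by (simp add: sum_two_two)
  then show "\<exists>c :: 2 \<Rightarrow> 2 \<Rightarrow> complex. x = c 0 0 *s v 0 0 + c 0 1 *s v 0 1 + c 1 0 *s v 1 0 + c 1 1 *s v 1 1"
    by (intro exI[of _ "\<lambda>i j. c (i, j)"])
  assume "d 0 0 *s v 0 0 + d 0 1 *s v 0 1 + d 1 0 *s v 1 0 + d 1 1 *s v 1 1 = 0"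
  then have "(\<Sum>ij\<in>UNIV. (case ij of (i, j) \<Rightarrow> d i j) *s (case ij of (i, j) \<Rightarrow> v i j)) = 0"
    by (simp add: sum_two_two)
  then have "(\<lambda>ij. case ij of (i, j) \<Rightarrow> d i j) (i, j) = 0" using L(1) ann by blast
  then show "d i j = 0" by simp
qed

lemma four_vectors_dependent:
  fixes v :: "2 \<Rightarrow> 2 \<Rightarrow> complex^4"
  assumes "n \<noteq> 0" "\<And>i j. cdot n (v i j) = 0"
  obtains d :: "2 \<Rightarrow> 2 \<Rightarrow> complex" and i j where "d 0 0 *s v 0 0 + d 0 1 *s v 0 1 + d 1 0 *s v 1 0 + d 1 1 *s v 1 1 = 0" "d i j \<noteq> 0"
proof -
  have "\<not> (\<forall>n. (\<forall>ij. cdot n (case ij of (i, j) \<Rightarrow> v i j) = 0) \<longrightarrow> n = 0)"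
    using assms by auto
  have card: "CARD(2 \<times> 2) = CARD(4)" by simp
  note L = annihilator_iff_independent(1)[OF card, where v="\<lambda>ij. case ij of (i, j) \<Rightarrow> v i j"]
  obtain c ij where c: "(\<Sum>ij\<in>UNIV. c ij *s (case ij of (i, j) \<Rightarrow> v i j)) = 0" "c ij \<noteq> 0"
    using assms L by auto
  show ?thesis
    by (rule that[of "\<lambda>i j. c (i, j)" "fst ij" "snd ij"]) (use c in \<open>simp_all add: sum_two_two\<close>)
qed

subsection \<open>The scaffold configuration\<close>

lemma sbilinear_polarize:
  assumes "sbilinear B"
  shows "2 * B x y = B (x + y) (x + y) - B x x - B y y"
  using sbilinear_sym[OF assms, of y x] by (simp add: sbilinearD[OF assms])

text \<open>The first identity polarises the vanishing in s at fixed u; the second polarises the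
  first in u.\<close>

lemma polarize_bilinear_family:
  assumes "sbilinear B" "\<And>s u. B (\<Phi> s u) (\<Phi> s u) = 0"
    and "\<And>s s' u. \<Phi> (\<lambda>i. s i + s' i) u = \<Phi> s u + \<Phi> s' u" "\<And>s u u'. \<Phi> s (\<lambda>i. u i + u' i) = \<Phi> s u + \<Phi> s u'"
  shows "B (\<Phi> s u) (\<Phi> s' u) = 0"
    and "B (\<Phi> s u) (\<Phi> s' u') + B (\<Phi> s u') (\<Phi> s' u) = 0"
proof -
  have *: "B (\<Phi> s u) (\<Phi> s' u) = 0" for u
    using sbilinear_polarize[OF assms(1), of "\<Phi> s u" "\<Phi> s' u"] assms(2)[of "\<lambda>i. s i + s' i" u]
    by (simp add: assms(2,3))
  show "B (\<Phi> s u) (\<Phi> s' u) = 0" by (rule *)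
  show "B (\<Phi> s u) (\<Phi> s' u') + B (\<Phi> s u') (\<Phi> s' u) = 0"
    using *[of "\<lambda>i. u i + u' i"] *[of u] *[of u'] by (simp add: assms(4) sbilinearD[OF assms(1)] add.commute)
qed

lemma two_cases: "(i::2) = 0 \<or> i = 1"
  using all_two[of "\<lambda>i. i = 0 \<or> i = 1"] by simp

text \<open>Serves to reduce an argument to the zero of b_2 or c_2 and one fixed unit
  vector.\<close>

lemma perp_unit_basis:
  assumes "v $ 0 \<noteq> 0"
  shows "u = (\<lambda>i. (u 1 / of_real (v $ 0)) * perp v i + (ev2 v u / of_real (v $ 0)) * unit2 0 i)"
proof -
  have "\<forall>i. u i = (u 1 / of_real (v $ 0)) * perp v i + (ev2 v u / of_real (v $ 0)) * unit2 0 i"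
    unfolding all_two using assms by (simp add: perp_def ev2_def field_simps)
  then show ?thesis by blast
qed

lemma perp_perp_basis:
  assumes "det2 a b \<noteq> 0"
  shows "u = (\<lambda>i. (ev2 b u / ev2 b (perp a)) * perp a i + (ev2 a u / ev2 a (perp b)) * perp b i)"
proof -
  have d: "complex_of_real (a $ 0) * of_real (b $ 1) - of_real (a $ 1) * of_real (b $ 0) \<noteq> 0"
    by (rule det2_complex[OF assms])
  let ?d = "complex_of_real (a $ 0) * of_real (b $ 1) - of_real (a $ 1) * of_real (b $ 0)"
  have e: "ev2 b (perp a) = ?d" "ev2 a (perp b) = - ?d" by (simp_all add: ev2_def perp_def)
  have "\<forall>i. u i * ?d = ev2 b u * perp a i - ev2 a u * perp b i"
    unfolding all_two by (simp add: perp_def ev2_def algebra_simps)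
  have "u i = (ev2 b u / ev2 b (perp a)) * perp a i + (ev2 a u / ev2 a (perp b)) * perp b i" for i
  proof -
    have "x * k = A * s - B * t \<Longrightarrow> k \<noteq> 0 \<Longrightarrow> x = (A / k) * s + (B / (- k)) * t" for x k A B s t :: complex
      by (simp add: field_simps)
    with \<open>\<forall>i. u i * ?d = _ i\<close> d show ?thesis unfolding e by blast
  qed
  then show ?thesis by blast
qed

text \<open>Embeds the two values of l into the three indices of beta and gamma, where index 2 is
  shared by both lines.\<close>

definition line_index :: "2 \<Rightarrow> 3" where "line_index l = (if l = 0 then 0 else 1)"

locale scaffold_config =
  fixes w :: weights and P :: ctrl
    and r :: "2 \<Rightarrow> (complex^4) set"
    and \<sigma> \<tau> \<upsilon> :: "2 \<Rightarrow> 4 cpoly" and q :: "4 cpoly"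
    and \<pi> \<theta> \<rho> :: "2 \<Rightarrow> real^4"
    and lam :: "2 \<Rightarrow> real^2" and \<mu> \<nu> :: "real^2"
    and \<alpha> :: "2 \<Rightarrow> real^2" and \<beta> \<gamma> :: "3 \<Rightarrow> real^2"
    and \<kappa> :: real
  assumes scaffold: "scaffold w P r"
    and sigma: "\<And>i. multihom P3 (\<lambda>_. 1) (\<sigma> i)" "\<And>i. surface_of (\<sigma> i) = Sigma_surface w P i"
    and tau: "\<And>j. multihom P3 (\<lambda>_. 2) (\<tau> j)" "\<And>j. surface_of (\<tau> j) = T_surface w P j"
    and upsilon: "\<And>k. multihom P3 (\<lambda>_. 2) (\<upsilon> k)" "\<And>k. surface_of (\<upsilon> k) = Y_surface w P k"
    and pi: "\<And>i. \<pi> i \<noteq> 0" "\<And>i. r i \<subseteq> plane_of (\<pi> i)"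
    and lam: "\<And>i. linform (\<pi> i) = rconst (lam i $ 0) * \<sigma> 0 + rconst (lam i $ 1) * \<sigma> 1"
    and theta: "\<And>j. y_line P \<union> r j \<subseteq> plane_of (\<theta> j)"
    and rho: "\<And>k. z_line P \<union> r k \<subseteq> plane_of (\<rho> k)"
    and Q: "smooth_form 2 q"
    and mu: "q = rconst (\<mu> $ 0) * \<tau> 0 + rconst (\<mu> $ 1) * \<tau> 1"
    and nu: "q = rconst (\<nu> $ 0) * \<upsilon> 0 + rconst (\<nu> $ 1) * \<upsilon> 1"
    and kappa: "\<kappa> \<noteq> 0"
    and weights:
      "\<And>l i j k. \<kappa> * w i j k = \<alpha> l $ i * \<beta> (line_index l) $ j * \<gamma> 2 $ k * Delta (\<theta> l) (P i j k)"
      "\<And>l i j k. \<kappa> * w i j k = \<alpha> l $ i * \<beta> 2 $ j * \<gamma> (line_index l) $ k * Delta (\<rho> l) (P i j k)"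
begin

abbreviation "al l i \<equiv> complex_of_real (\<alpha> l $ i)"
abbreviation "be l i \<equiv> complex_of_real (\<beta> l $ i)"
abbreviation "ga l i \<equiv> complex_of_real (\<gamma> l $ i)"
abbreviation "p \<equiv> trivec w P"
abbreviation "F \<equiv> Fv w P"

lemma cdot_F: "cdot n (F s t u) = (\<Sum>i\<in>UNIV. \<Sum>j\<in>UNIV. \<Sum>k\<in>UNIV. s i * t j * u k * cdot n (p i j k))"
  by (simp add: Fv_def cdot_sum)

text \<open>The slice consists of combinations of its four corners, so a plane through the corners
  would contain the quadric.\<close>

lemma T_ann:
  assumes "\<And>i k. cdot n (p i j k) = 0"
  shows "n = 0"
proof (rule quadric_slice_annihilator[of w P 1 j])
  show "smooth_surface 2 (T_surface w P j)" using scaffold by (simp add: scaffold_def)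
  fix z :: "complex^(3 \<times> 2)" assume "z $ (1, 1 - j) = 0"
  then show "cdot n (polymap (trilin w P) z) = 0"
    using two_cases[of j] assms by (auto simp: polymap_trilin cdot_F sum_two)
qed

lemma Y_ann:
  assumes "\<And>i j. cdot n (p i j k) = 0"
  shows "n = 0"
proof (rule quadric_slice_annihilator[of w P 2 k])
  show "smooth_surface 2 (Y_surface w P k)" using scaffold by (simp add: scaffold_def)
  fix z :: "complex^(3 \<times> 2)" assume "z $ (2, 1 - k) = 0"
  then show "cdot n (polymap (trilin w P) z) = 0"
    using two_cases[of k] assms by (auto simp: polymap_trilin cdot_F sum_two)
qed

definition sg :: "2 \<Rightarrow> complex^4" where "sg i = (SOME n. \<forall>v. peval (\<sigma> i) v = cdot n v)"

lemma peval_sigma: "peval (\<sigma> i) v = cdot (sg i) v"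
proof -
  have "\<exists>n. \<forall>v. peval (\<sigma> i) v = cdot n v" using linear_form_cdot[OF sigma(1)] by metis
  from someI_ex[OF this] show ?thesis unfolding sg_def by blast
qed

lemma sg_nonzero: "sg i \<noteq> 0"
  and S_ann: "(\<And>j k. cdot n (p i j k) = 0) \<Longrightarrow> \<exists>k. n = k *s sg i"
proof -
  have sm: "smooth_surface 1 (Sigma_surface w P i)" using scaffold by (simp add: scaffold_def)
  note L = plane_slice_annihilator[OF sm sigma(1) sigma(2) peval_sigma]
  show "sg i \<noteq> 0" by (rule L(1))
  assume *: "\<And>j k. cdot n (p i j k) = 0"
  show "\<exists>k. n = k *s sg i"
  proof (rule L(2))
    fix z :: "complex^(3 \<times> 2)" assume "z $ (0, 1 - i) = 0"
    then show "cdot n (polymap (trilin w P) z) = 0"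
      using two_cases[of i] * by (auto simp: polymap_trilin cdot_F sum_two)
  qed
qed

lemma sg_p: "cdot (sg i) (p i j k) = 0"
proof -
  have "peval (\<sigma> i) (polymap (trilin w P) (mkpt (unit2 i) (unit2 j) (unit2 k))) = 0"
    by (rule slice_in_surface[where d=0, OF _ _ sigma(2)]) (use two_cases[of i] sigma(1) in auto)
  then show ?thesis by (simp add: polymap_mkpt Fv_unit peval_sigma)
qed

lemma tau_slice: "peval (\<tau> j) (F s (unit2 j) u) = 0"
proof -
  have "peval (\<tau> j) (polymap (trilin w P) (mkpt s (unit2 j) u)) = 0"
    by (rule slice_in_surface[where d=1, OF _ _ tau(2)]) (use two_cases[of j] tau(1) in \<open>auto simp: numeral_2_eq_2\<close>)
  then show ?thesis by (simp add: polymap_mkpt)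
qed

lemma upsilon_slice: "peval (\<upsilon> k) (F s t (unit2 k)) = 0"
proof -
  have "peval (\<upsilon> k) (polymap (trilin w P) (mkpt s t (unit2 k))) = 0"
    by (rule slice_in_surface[where d=1, OF _ _ upsilon(2)]) (use two_cases[of k] upsilon(1) in \<open>auto simp: numeral_2_eq_2\<close>)
  then show ?thesis by (simp add: polymap_mkpt)
qed

lemma T_independent:
  fixes d :: "2 \<Rightarrow> 2 \<Rightarrow> complex"
  shows "d 0 0 *s p 0 j 0 + d 0 1 *s p 0 j 1 + d 1 0 *s p 1 j 0 + d 1 1 *s p 1 j 1 = 0 \<Longrightarrow> d i k = 0"
  using four_vectors(1)[of "\<lambda>i k. p i j k" d i k] T_ann by blast

lemma Y_independent:
  fixes d :: "2 \<Rightarrow> 2 \<Rightarrow> complex"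
  shows "d 0 0 *s p 0 0 k + d 0 1 *s p 0 1 k + d 1 0 *s p 1 0 k + d 1 1 *s p 1 1 k = 0 \<Longrightarrow> d i j = 0"
  using four_vectors(1)[of "\<lambda>i j. p i j k" d i j] Y_ann by blast

lemma F_T_eq_0: "F s (unit2 j) u = 0 \<Longrightarrow> s i * u k = 0"
  by (rule T_independent[of "\<lambda>i k. s i * u k" j])
    (use two_cases[of j] in \<open>auto simp: Fv_def sum_two add.assoc\<close>)

lemma F_Y_eq_0: "F s t (unit2 k) = 0 \<Longrightarrow> s i * t j = 0"
  by (rule Y_independent[of "\<lambda>i j. s i * t j" k])
    (use two_cases[of k] in \<open>auto simp: Fv_def sum_two add.assoc\<close>)

text \<open>A zero weight would make the four corners of a quadric boundary surface
  dependent.\<close>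

lemma w_nonzero: "w i j k \<noteq> 0"
proof
  assume "w i j k = 0"
  then have "F (unit2 i) (unit2 j) (unit2 k) = 0" by (simp add: Fv_unit(1) trivec_def)
  from F_T_eq_0[OF this, of i k] show False by simp
qed

lemma entries_nonzero [simp]:
  "\<alpha> l $ i \<noteq> 0" "\<beta> (line_index l) $ j \<noteq> 0" "\<gamma> (line_index l) $ k \<noteq> 0" "\<beta> 2 $ j \<noteq> 0" "\<gamma> 2 $ k \<noteq> 0"
  using weights(1)[of i j k l] weights(2)[of i j k l] kappa w_nonzero[of i j k] by auto

section \<open>Pullbacks of the planes Theta_l and P_l\<close>

definition th where "th l = of_real \<kappa> *s cvec (\<theta> l)"
definition rh where "rh l = of_real \<kappa> *s cvec (\<rho> l)"

text \<open>The weight contains the reciprocal of the scalar product with theta_l, so the contracted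
  tensor is a product over i, j, k and its trilinear form splits into linear factors.\<close>

lemma cdot_th: "cdot (th l) (F s t u) = ev2 (\<alpha> l) s * ev2 (\<beta> (line_index l)) t * ev2 (\<gamma> 2) u"
proof -
  have "cdot (th l) (p i j k) = 1 * al l i * be (line_index l) j * ga 2 k" for i j k
  proof -
    \<comment> \<open>Division by zero yields 0, so a vanishing scalar product would force a zero
      weight.\<close>
    have "\<theta> l \<bullet> P i j k \<noteq> 0"
      using weights(1)[of i j k l] kappa w_nonzero[of i j k] by (auto simp: Delta_def)
    then have "w i j k * (\<kappa> * (\<theta> l \<bullet> P i j k)) = \<alpha> l $ i * (\<beta> (line_index l) $ j * \<gamma> 2 $ k)"
      using weights(1)[of i j k l] by (simp add: Delta_def field_simps)
    then show ?thesis
      unfolding th_def trivec_def by (simp add: cdot_cvec mult.assoc flip: of_real_mult)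
  qed
  then show ?thesis by (subst cdot_Fv[where K=1]) simp_all
qed

lemma cdot_rh: "cdot (rh l) (F s t u) = ev2 (\<alpha> l) s * ev2 (\<beta> 2) t * ev2 (\<gamma> (line_index l)) u"
proof -
  have "cdot (rh l) (p i j k) = 1 * al l i * be 2 j * ga (line_index l) k" for i j k
  proof -
    have "\<rho> l \<bullet> P i j k \<noteq> 0"
      using weights(2)[of i j k l] kappa w_nonzero[of i j k] by (auto simp: Delta_def)
    then have "w i j k * (\<kappa> * (\<rho> l \<bullet> P i j k)) = \<alpha> l $ i * (\<beta> 2 $ j * \<gamma> (line_index l) $ k)"
      using weights(2)[of i j k l] by (simp add: Delta_def field_simps)
    then show ?thesis
      unfolding rh_def trivec_def by (simp add: cdot_cvec mult.assoc flip: of_real_mult)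
  qed
  then show ?thesis by (subst cdot_Fv[where K=1]) simp_all
qed

lemma th_zero_iff: "cdot (th l) v = 0 \<longleftrightarrow> cdot (cvec (\<theta> l)) v = 0"
  and rh_zero_iff: "cdot (rh l) v = 0 \<longleftrightarrow> cdot (cvec (\<rho> l)) v = 0"
  using kappa by (simp_all add: th_def rh_def)

lemma u_line_memI:
  assumes "v \<noteq> 0" "v = c *s p i j 0 + d *s p i j 1"
  shows "v \<in> u_line P i j"
proof -
  have "v = (c * of_real (w i j 0)) *s cvec (P i j 0) + (d * of_real (w i j 1)) *s cvec (P i j 1)"
    using assms(2) by (simp add: trivec_def)
  then show ?thesis unfolding u_line_def pspan_def span_pair using assms(1) by blast
qed

lemma t_line_memI:
  assumes "v \<noteq> 0" "v = c *s p i 0 k + d *s p i 1 k"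
  shows "v \<in> t_line P i k"
proof -
  have "v = (c * of_real (w i 0 k)) *s cvec (P i 0 k) + (d * of_real (w i 1 k)) *s cvec (P i 1 k)"
    using assms(2) by (simp add: trivec_def)
  then show ?thesis unfolding t_line_def pspan_def span_pair using assms(1) by blast
qed

lemma y_line_memI: "v \<in> u_line P i 0 \<Longrightarrow> v \<in> u_line P i 1 \<Longrightarrow> v \<in> y_line P"
  using two_cases[of i] by (auto simp: y_line_def pspan_def u_line_def intro: vec.span_base)

lemma z_line_memI: "v \<in> t_line P i 0 \<Longrightarrow> v \<in> t_line P i 1 \<Longrightarrow> v \<in> z_line P"
  using two_cases[of i] by (auto simp: z_line_def pspan_def t_line_def intro: vec.span_base)

text \<open>The points \<open>u\<^sub>i\<^sub>0 \<inter> u\<^sub>i\<^sub>1\<close> lie on \<open>\<theta>\<^sub>l\<close> and \<open>t\<^sub>i\<^sub>0 \<inter> t\<^sub>i\<^sub>1\<close> on \<open>\<rho>\<^sub>l\<close>; this forces the linear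
  relation between the corners of the plane \<open>\<Sigma>\<^sub>i\<close> to have rank one.\<close>

lemma corner_relation_y:
  fixes d :: "2 \<Rightarrow> 2 \<Rightarrow> complex"
  assumes "d 0 0 *s p i 0 0 + d 0 1 *s p i 0 1 + d 1 0 *s p i 1 0 + d 1 1 *s p i 1 1 = 0"
  shows "d j 0 * ga 2 0 + d j 1 * ga 2 1 = 0"
proof -
  let ?v = "\<lambda>j. d j 0 *s p i j 0 + d j 1 *s p i j 1"
  have v: "?v j = F (unit2 i) (unit2 j) (d j)" for j by (simp add: Fv_unit)
  have sum: "?v 0 + ?v 1 = 0" using assms by (simp add: add.assoc)
  show ?thesis
  proof (cases "?v 0 = 0")
    case True
    then have "?v j = 0" using sum two_cases[of j] by auto
    then have "d j k = 0" for k using F_T_eq_0[of "unit2 i" j "d j" i k] v[of j] by simp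
    then show ?thesis by simp
  next
    case False
    \<comment> \<open>The relation makes \<open>?v 0 = - ?v 1\<close> a common point of the two
      u-lines, hence a point of the line y and of the plane of \<open>\<theta> 0\<close>.\<close>
    then have "?v 0 \<in> u_line P i 0" by (rule u_line_memI) simp
    moreover have "?v 0 = - ?v 1" using sum by (simp only: eq_neg_iff_add_eq_0)
    then have "?v 0 = (- d 1 0) *s p i 1 0 + (- d 1 1) *s p i 1 1"
      by (simp add: vec_eq_iff)
    then have "?v 0 \<in> u_line P i 1" using False by (rule u_line_memI[rotated])
    ultimately have "?v 0 \<in> plane_of (\<theta> 0)" using theta[of 0] y_line_memI by blast
    then have "cdot (th 0) (?v 0) = 0" unfolding mem_plane_of th_zero_iff by blast
    moreover from this have "cdot (th 0) (?v 1) = 0"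
      using arg_cong[OF sum, of "cdot (th 0)"] by simp
    ultimately have "cdot (th 0) (?v j) = 0" using two_cases[of j] by auto
    then have "al 0 i * be (line_index 0) j * ev2 (\<gamma> 2) (d j) = 0"
      unfolding v cdot_th by simp
    then have "ev2 (\<gamma> 2) (d j) = 0" by simp
    then show ?thesis by (simp add: ev2_def mult.commute)
  qed
qed

lemma corner_relation_z:
  fixes d :: "2 \<Rightarrow> 2 \<Rightarrow> complex"
  assumes "d 0 0 *s p i 0 0 + d 0 1 *s p i 0 1 + d 1 0 *s p i 1 0 + d 1 1 *s p i 1 1 = 0"
  shows "d 0 k * be 2 0 + d 1 k * be 2 1 = 0"
proof -
  let ?v = "\<lambda>k. d 0 k *s p i 0 k + d 1 k *s p i 1 k"
  have v: "?v k = F (unit2 i) (\<lambda>j. d j k) (unit2 k)" for k by (simp add: Fv_unit)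
  have sum: "?v 0 + ?v 1 = 0" using assms by (simp add: add_ac)
  show ?thesis
  proof (cases "?v 0 = 0")
    case True
    then have "?v k = 0" using sum two_cases[of k] by auto
    then have "d j k = 0" for j using F_Y_eq_0[of "unit2 i" "\<lambda>j. d j k" k i j] v[of k] by simp
    then show ?thesis by simp
  next
    case False
    then have "?v 0 \<in> t_line P i 0" by (rule t_line_memI) simp
    moreover have "?v 0 = - ?v 1" using sum by (simp only: eq_neg_iff_add_eq_0)
    then have "?v 0 = (- d 0 1) *s p i 0 1 + (- d 1 1) *s p i 1 1"
      by (simp add: vec_eq_iff)
    then have "?v 0 \<in> t_line P i 1" using False by (rule t_line_memI[rotated])
    ultimately have "?v 0 \<in> plane_of (\<rho> 0)" using rho[of 0] z_line_memI by blast
    then have "cdot (rh 0) (?v 0) = 0" unfolding mem_plane_of rh_zero_iff by blast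
    moreover from this have "cdot (rh 0) (?v 1) = 0"
      using arg_cong[OF sum, of "cdot (rh 0)"] by simp
    ultimately have "cdot (rh 0) (?v k) = 0" using two_cases[of k] by auto
    then have "al 0 i * ev2 (\<beta> 2) (\<lambda>j. d j k) * ga (line_index 0) k = 0"
      unfolding v cdot_rh by simp
    then have "ev2 (\<beta> 2) (\<lambda>j. d j k) = 0" by simp
    then show ?thesis by (simp add: ev2_def mult.commute)
  qed
qed

section \<open>The base line b_2 = c_2 = 0\<close>

abbreviation "t2 \<equiv> perp (\<beta> 2)"
abbreviation "u2 \<equiv> perp (\<gamma> 2)"

text \<open>The corners of the plane Sigma_i satisfy a linear relation d. Its rows are killed by
  gamma_2 and its columns by beta_2, so d is a multiple of the tensor of the zeros \<open>t2\<close>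
  and \<open>u2\<close>. The relation itself then says that F vanishes there.\<close>

lemma base_line: "F s t2 u2 = 0"
proof -
  have unit: "F (unit2 i) t2 u2 = 0" for i
  proof -
    obtain d :: "2 \<Rightarrow> 2 \<Rightarrow> complex" and j k where d: "d 0 0 *s p i 0 0 + d 0 1 *s p i 0 1 + d 1 0 *s p i 1 0 + d 1 1 *s p i 1 1 = 0"
      "d j k \<noteq> 0"
      using four_vectors_dependent[OF sg_nonzero[of i], of "\<lambda>j k. p i j k", OF sg_p] by blast
    note Y = corner_relation_y[of d i 0, OF d(1)] corner_relation_y[of d i 1, OF d(1)]
    note Z = corner_relation_z[of d i 0, OF d(1)] corner_relation_z[of d i 1, OF d(1)]
    have nz: "be 2 j \<noteq> 0" "ga 2 k \<noteq> 0" for j k by simp_all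
    have d11: "d 1 1 \<noteq> 0"
    proof
      assume "d 1 1 = 0"
      then have "d 1 0 = 0" "d 0 1 = 0" using Y(2) Z(2) nz by simp_all
      moreover from this have "d 0 0 = 0" using Y(1) nz by simp
      ultimately show False using d(2) two_cases[of j] two_cases[of k] \<open>d 1 1 = 0\<close> by auto
    qed
    \<comment> \<open>Entry by entry, \<open>d 1 1\<close> times the tensor of \<open>t2\<close> and
      \<open>u2\<close> is \<open>be 2 0 * ga 2 0\<close> times d.\<close>
    have e: "d 1 1 * be 2 1 * ga 2 1 = be 2 0 * ga 2 0 * d 0 0" "- d 1 1 * be 2 1 * ga 2 0 = be 2 0 * ga 2 0 * d 0 1"
      "- d 1 1 * be 2 0 * ga 2 1 = be 2 0 * ga 2 0 * d 1 0"
      using Y Z by algebra+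
    have "d 1 1 *s F (unit2 i) t2 u2 = (d 1 1 * be 2 1 * ga 2 1) *s p i 0 0 + (- d 1 1 * be 2 1 * ga 2 0) *s p i 0 1
      + (- d 1 1 * be 2 0 * ga 2 1) *s p i 1 0 + (d 1 1 * be 2 0 * ga 2 0) *s p i 1 1"
      using two_cases[of i] by (auto simp: Fv_def sum_two perp_def vec_eq_iff algebra_simps)
    also have "\<dots> = (be 2 0 * ga 2 0) *s (d 0 0 *s p i 0 0 + d 0 1 *s p i 0 1 + d 1 0 *s p i 1 0 + d 1 1 *s p i 1 1)"
      unfolding e by (simp add: vec_eq_iff algebra_simps)
    finally have "d 1 1 *s F (unit2 i) t2 u2 = 0" unfolding d(1) by simp
    then show ?thesis using d11 by (simp add: vector_mul_eq_0)
  qed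
  have "F s t2 u2 = s 0 *s F (unit2 0) t2 u2 + s 1 *s F (unit2 1) t2 u2"
    by (simp add: Fv_def sum_two vec_eq_iff algebra_simps)
  then show ?thesis by (simp add: unit)
qed

section \<open>The lines r_l as images of a_l = 0\<close>

abbreviation "S \<equiv> \<lambda>l. perp (\<alpha> l)"

definition V where "V l = insert 0 (r l)"

lemma V_subspace: "vec.subspace (V l)" "vec.dim (V l) = 2" "r l = V l - {0}"
proof -
  have "is_line (r l)" using scaffold by (simp add: scaffold_def)
  then obtain W where W: "vec.subspace W" "vec.dim W = 2" "r l = W - {0}"
    unfolding is_line_def by blast
  moreover have "V l = W" using vec.subspace_0[OF W(1)] W(3) by (auto simp: V_def)
  ultimately show "vec.subspace (V l)" "vec.dim (V l) = 2" "r l = V l - {0}" by simp_all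
qed

lemma V_planes: "v \<in> V l \<Longrightarrow> cdot (th l) v = 0" "v \<in> V l \<Longrightarrow> cdot (rh l) v = 0"
  using theta[of l] rho[of l] unfolding V_def th_zero_iff rh_zero_iff by (auto simp: mem_plane_of subset_iff)

text \<open>The common point of r_l and s_jk has the form F s e_j e_k. It lies on Theta_l, whose
  pullback contains a_l and otherwise nonzero factors there, so s is the zero of a_l.\<close>

lemma corner_in_V: "F (S l) (unit2 j) (unit2 k) \<in> V l"
proof -
  have "r l \<inter> s_line P j k \<noteq> {}" using scaffold by (simp add: scaffold_def)
  then obtain v where v: "v \<in> r l" "v \<in> s_line P j k" by blast
  obtain c d where cd: "v = c *s cvec (P 0 j k) + d *s cvec (P 1 j k)" and "v \<noteq> 0"
    using v(2) unfolding s_line_def pspan_def span_pair by auto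
  define s where "s = (\<lambda>i::2. if i = 0 then c / of_real (w 0 j k) else d / of_real (w 1 j k))"
  have vF: "v = F s (unit2 j) (unit2 k)"
    unfolding cd Fv_unit trivec_def s_def using w_nonzero by simp
  have "v \<in> V l" using v(1) by (simp add: V_def)
  then have "cdot (th l) v = 0" by (rule V_planes)
  then have "ev2 (\<alpha> l) s = 0" unfolding vF cdot_th by simp
  then obtain c' where c': "s = (\<lambda>i. c' * perp (\<alpha> l) i)"
    by (rule ev2_eq_0_imp) simp
  have *: "v = c' *s F (S l) (unit2 j) (unit2 k)" unfolding vF c' Fv_scale ..
  then have "c' \<noteq> 0" using \<open>v \<noteq> 0\<close> by auto
  then have "F (S l) (unit2 j) (unit2 k) = inverse c' *s v" unfolding * by simp
  then show ?thesis using vec.subspace_scale[OF V_subspace(1) \<open>v \<in> V l\<close>] by simp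
qed

lemma F_S_in_V: "F (S l) t u \<in> V l"
proof -
  have "F (S l) t u = (t 0 * u 0) *s F (S l) (unit2 0) (unit2 0) + (t 0 * u 1) *s F (S l) (unit2 0) (unit2 1)
    + (t 1 * u 0) *s F (S l) (unit2 1) (unit2 0) + (t 1 * u 1) *s F (S l) (unit2 1) (unit2 1)"
    by (simp add: Fv_def sum_two vec_eq_iff algebra_simps)
  then show ?thesis
    by (simp only:) (intro vec.subspace_add[OF V_subspace(1)] vec.subspace_scale[OF V_subspace(1)] corner_in_V)
qed

text \<open>The corners with k = 0 and k = 1 are independent in a space of dimension two, so they
  span it; in particular r_l lies on every T_j.\<close>

lemma V_T_slice:
  assumes "v \<in> V l"
  obtains u where "v = F (S l) (unit2 j) u"
proof -
  have "\<exists>c d. v = c *s F (S l) (unit2 j) (unit2 0) + d *s F (S l) (unit2 j) (unit2 1)"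
  proof (rule subspace_dim2_pair[OF V_subspace(1,2) F_S_in_V F_S_in_V _ assms])
    fix c d assume "c *s F (S l) (unit2 j) (unit2 0) + d *s F (S l) (unit2 j) (unit2 1) = 0"
    then have "F (S l) (unit2 j) (\<lambda>i. c * unit2 0 i + d * unit2 1 i) = 0" unfolding Fv_linear .
    from F_T_eq_0[OF this, of 1 0] F_T_eq_0[OF this, of 1 1]
    show "c = 0 \<and> d = 0" by (simp add: perp_def)
  qed
  then obtain c d where "v = F (S l) (unit2 j) (\<lambda>i. c * unit2 0 i + d * unit2 1 i)"
    unfolding Fv_linear(3) by blast
  then show ?thesis by (rule that)
qed

text \<open>If a_0 and a_1 had the same zero, r_0 and r_1 would be the same image.\<close>

lemma det_alpha: "det2 (\<alpha> 0) (\<alpha> 1) \<noteq> 0"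
proof
  assume "det2 (\<alpha> 0) (\<alpha> 1) = 0"
  then have "ev2 (\<alpha> 0) (perp (\<alpha> 1)) = 0" by (simp add: ev2_perp)
  then obtain c where c: "S 1 = (\<lambda>i. c * S 0 i)" by (rule ev2_eq_0_imp) simp
  have "V 1 \<subseteq> V 0"
  proof
    fix v assume "v \<in> V 1"
    then obtain u where "v = F (S 1) (unit2 0) u" using V_T_slice by blast
    then have "v = c *s F (S 0) (unit2 0) u" unfolding c Fv_scale .
    then show "v \<in> V 0" using vec.subspace_scale[OF V_subspace(1) F_S_in_V] by blast
  qed
  moreover have "S 1 1 = c * S 0 1" using c by metis
  then have "c \<noteq> 0" by (auto simp: perp_def)
  have "V 0 \<subseteq> V 1"
  proof
    fix v assume "v \<in> V 0"
    then obtain u where "v = F (S 0) (unit2 0) u" using V_T_slice by blast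
    then have "v = inverse c *s F (S 1) (unit2 0) u" unfolding c Fv_scale using \<open>c \<noteq> 0\<close> by simp
    then show "v \<in> V 1" using vec.subspace_scale[OF V_subspace(1) F_S_in_V] by blast
  qed
  ultimately have "r 0 = r 1" using V_subspace(3) by auto
  then show False using scaffold by (simp add: scaffold_def)
qed

end

subsection \<open>The quadric forces the normal form\<close>

lemma two_minus_minus [simp]: "1 - (1 - l) = (l::2)"
  by simp

lemma sbilinear_combination:
  assumes "sbilinear B" "sbilinear B0" "sbilinear B1" "\<And>x. B x x = c0 * B0 x x + c1 * B1 x x"
  shows "B x y = c0 * B0 x y + c1 * B1 x y"
proof -
  have "2 * B x y = 2 * (c0 * B0 x y + c1 * B1 x y)"
    using sbilinear_polarize[OF assms(1), of x y] sbilinear_polarize[OF assms(2), of x y]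
      sbilinear_polarize[OF assms(3), of x y] assms(4)[of "x + y"] assms(4)[of x] assms(4)[of y]
    by algebra
  then show ?thesis by (simp only: mult_cancel_left) simp
qed

context scaffold_config
begin

text \<open>\<open>Z l\<close>, \<open>Y l\<close>, \<open>K l\<close> are representatives of points
  of r_{1-l}: \<open>Z l\<close> is where it meets the line y, \<open>Y l\<close> where it meets the
  line z, \<open>K l\<close> where it meets s_00. The argument \<open>unit2 0\<close> in
  \<open>Z\<close> and \<open>Y\<close> only fixes a scalar, as F vanishes on the base line.\<close>

definition Z where "Z l = F (S (1 - l)) (unit2 0) u2"
definition Y where "Y l = F (S (1 - l)) t2 (unit2 0)"
definition K where "K l = F (S (1 - l)) (unit2 0) (unit2 0)"

lemma ZYK_in_V: "Z l \<in> V (1 - l)" "Y l \<in> V (1 - l)" "K l \<in> V (1 - l)"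
  by (simp_all add: Z_def Y_def K_def F_S_in_V)

lemma F_split_t: "F s t u = (t 1 / be 2 0) *s F s t2 u + (ev2 (\<beta> 2) t / be 2 0) *s F s (unit2 0) u"
  by (subst perp_unit_basis[of "\<beta> 2" t]) (simp_all only: Fv_linear entries_nonzero not_False_eq_True)

lemma F_split_u: "F s t u = (u 1 / ga 2 0) *s F s t u2 + (ev2 (\<gamma> 2) u / ga 2 0) *s F s t (unit2 0)"
  by (subst perp_unit_basis[of "\<gamma> 2" u]) (simp_all only: Fv_linear entries_nonzero not_False_eq_True)

lemma F_split_s: "F s t u = (ev2 (\<alpha> 1) s / ev2 (\<alpha> 1) (S 0)) *s F (S 0) t u + (ev2 (\<alpha> 0) s / ev2 (\<alpha> 0) (S 1)) *s F (S 1) t u"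
  by (subst perp_perp_basis[OF det_alpha, of s]) (simp only: Fv_linear)

definition ZK :: "2 \<Rightarrow> 2 \<Rightarrow> complex^4" where "ZK l e = (if e = 0 then Z l else K l)"

lemma ZK_simps [simp]: "ZK l 0 = Z l" "ZK l 1 = K l"
  by (simp_all add: ZK_def)

text \<open>With s running through the zeros of a_0 and a_1 and u through \<open>u2\<close> and
  \<open>unit2 0\<close>, these four vectors span the slice t = e_0, which spans C^4.\<close>

lemma ZK_ann:
  assumes "\<And>l e. cdot n (ZK l e) = 0"
  shows "n = 0"
proof -
  have ZK: "cdot n (Z l) = 0" "cdot n (K l) = 0" for l
    using assms[of l 0] assms[of l 1] by simp_all
  have "cdot n (F (S (1 - l)) (unit2 0) u) = 0" for l u
    using ZK[of l] by (subst F_split_u) (simp add: Z_def K_def)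
  from this[of 0] this[of 1] have "cdot n (F (S 1) (unit2 0) u) = 0" "cdot n (F (S 0) (unit2 0) u) = 0" for u
    by simp_all
  then have "cdot n (F s (unit2 0) u) = 0" for s u
    by (subst F_split_s) simp
  from this[of "unit2 i" "unit2 k" for i k] show "n = 0"
    by (intro T_ann[of n 0]) (simp add: Fv_unit(1))
qed

lemma ZK_basis_independent:
  "d 0 *s Z 0 + e 0 *s K 0 + d 1 *s Z 1 + e 1 *s K 1 = 0 \<Longrightarrow> d (l::2) = 0 \<and> e (l::2) = 0"
  using four_vectors(1)[of ZK "\<lambda>l i. if i = 0 then d l else e l" l 0, OF ZK_ann]
    four_vectors(1)[of ZK "\<lambda>l i. if i = 0 then d l else e l" l 1, OF ZK_ann] by simp

lemma ZK_span: obtains d e where "v = d 0 *s Z 0 + e 0 *s K 0 + d (1::2) *s Z 1 + e (1::2) *s K 1"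
proof -
  obtain c :: "2 \<Rightarrow> 2 \<Rightarrow> complex" where "v = c 0 0 *s ZK 0 0 + c 0 1 *s ZK 0 1 + c 1 0 *s ZK 1 0 + c 1 1 *s ZK 1 1"
    using four_vectors(2)[of ZK v, OF ZK_ann] by blast
  then show ?thesis by (intro that[of "\<lambda>l. c l 0" "\<lambda>l. c l 1"]) simp
qed

lemma ZK_dual: "\<exists>n. (\<forall>l. cdot n (Z l) = d l) \<and> (\<forall>l. cdot n (K l) = e l)"
proof -
  obtain n where n: "\<And>l i. cdot n (ZK l i) = (if i = 0 then d l else e l)"
    using four_vectors(3)[of ZK "\<lambda>l i. if i = 0 then d l else e l", OF ZK_ann] by blast
  show ?thesis by (rule exI[of _ n]) (use n[of _ 0] n[of _ 1] in simp_all)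
qed

lemma ZK_independent: "c *s Z l + d *s K l = 0 \<Longrightarrow> c = 0 \<and> d = 0"
  using ZK_basis_independent[of "\<lambda>i. if i = l then c else 0" "\<lambda>i. if i = l then d else 0" l] two_cases[of l]
  by auto

lemma YK_independent: "c *s Y l + d *s K l = 0 \<Longrightarrow> c = 0 \<and> d = 0"
proof -
  assume "c *s Y l + d *s K l = 0"
  then have "F (S (1 - l)) (\<lambda>i. c * t2 i + d * unit2 0 i) (unit2 0) = 0"
    unfolding Fv_linear Y_def K_def .
  from F_Y_eq_0[OF this, of 0 0] F_Y_eq_0[OF this, of 0 1] show ?thesis by (simp add: perp_def)
qed

lemma Z_nonzero: "Z l \<noteq> 0" using ZK_independent[of 1 l 0] by auto

lemma Y_expand_ex: "\<exists>g h. Y l = g *s Z l + h *s K l"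
  by (rule subspace_dim2_pair[OF V_subspace(1,2) ZYK_in_V(1,3) ZK_independent ZYK_in_V(2)])

definition gY where "gY l = (SOME g. \<exists>h. Y l = g *s Z l + h *s K l)"
definition hY where "hY l = (SOME h. Y l = gY l *s Z l + h *s K l)"

lemma Y_expand: "Y l = gY l *s Z l + hY l *s K l"
proof -
  have "\<exists>h. Y l = gY l *s Z l + h *s K l" unfolding gY_def by (rule someI_ex[OF Y_expand_ex])
  then show ?thesis unfolding hY_def by (rule someI_ex)
qed

lemma gY_nonzero: "gY l \<noteq> 0"
proof
  assume "gY l = 0"
  then have "1 *s Y l + (- hY l) *s K l = 0" using Y_expand[of l] by (simp add: vec_eq_iff)
  then show False using YK_independent[of 1 l "- hY l"] by simp
qed

lemma obtain_bilinear_forms: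
  obtains Bq Bt Bu where "sbilinear Bq" "\<And>x. peval q x = Bq x x"
    "\<And>j. sbilinear (Bt j)" "\<And>j x. peval (\<tau> j) x = Bt j x x"
    "\<And>k. sbilinear (Bu k)" "\<And>k x. peval (\<upsilon> k) x = Bu k x x"
proof -
  obtain Bq where q: "sbilinear Bq" "\<And>x. peval q x = Bq x x"
    using Q quadratic_form_sbilinear[of q] by (auto simp: smooth_form_def)
  have "\<forall>j. \<exists>B. sbilinear B \<and> (\<forall>x. peval (\<tau> j) x = B x x)"
    using quadratic_form_sbilinear[OF tau(1)] by metis
  then obtain Bt where t: "\<And>j. sbilinear (Bt j)" "\<And>j x. peval (\<tau> j) x = Bt j x x" by metis
  have "\<forall>j. \<exists>B. sbilinear B \<and> (\<forall>x. peval (\<upsilon> j) x = B x x)"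
    using quadratic_form_sbilinear[OF upsilon(1)] by metis
  then obtain Bu where u: "\<And>j. sbilinear (Bu j)" "\<And>j x. peval (\<upsilon> j) x = Bu j x x" by metis
  show ?thesis by (rule that[OF q t u])
qed

text \<open>If \<open>Y\<^sub>l\<close> and \<open>Z\<^sub>l\<close> were proportional, \<open>Q\<close> would be singular at \<open>Z\<^sub>l\<close>: it contains
  \<open>r\<^sub>0\<close>, \<open>r\<^sub>1\<close> and the lines through \<open>Z\<^sub>0, Z\<^sub>1\<close> and through \<open>Y\<^sub>0, Y\<^sub>1\<close>.  When both pairs are
  proportional, the tangential relations of the two pencils give the missing equation.\<close>

lemma hY_nonzero: "hY l \<noteq> 0"
proof
  assume h0: "hY l = 0"
  let ?m = "1 - l"
  obtain Bq Bt Bu where q: "sbilinear Bq" "\<And>x. peval q x = Bq x x"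
    and t: "\<And>j. sbilinear (Bt j)" "\<And>j x. peval (\<tau> j) x = Bt j x x"
    and u: "\<And>k. sbilinear (Bu k)" "\<And>k x. peval (\<upsilon> k) x = Bu k x x"
    using obtain_bilinear_forms by blast
  have qt: "Bq x y = of_real (\<mu> $ 0) * Bt 0 x y + of_real (\<mu> $ 1) * Bt 1 x y" for x y
    by (rule sbilinear_combination[OF q(1) t(1) t(1)], unfold q(2)[symmetric] t(2)[symmetric], subst mu) simp
  have qu: "Bq x y = of_real (\<nu> $ 0) * Bu 0 x y + of_real (\<nu> $ 1) * Bu 1 x y" for x y
    by (rule sbilinear_combination[OF q(1) u(1) u(1)], unfold q(2)[symmetric] u(2)[symmetric], subst nu) simp
  have Fadd: "F (\<lambda>i. s i + s' i) t u = F s t u + F s' t u" "F s (\<lambda>i. t i + t' i) u = F s t u + F s t' u"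
    "F s t (\<lambda>i. u i + u' i) = F s t u + F s t u'" for s s' t t' u u'
    using Fv_linear[where c=1 and d=1] by simp_all
  have tp: "Bt j (F s (unit2 j) u) (F s' (unit2 j) u) = 0"
    "Bt j (F s (unit2 j) u) (F s' (unit2 j) u') + Bt j (F s (unit2 j) u') (F s' (unit2 j) u) = 0" for j s s' u u'
    by (rule polarize_bilinear_family[where \<Phi>="\<lambda>s u. F s (unit2 j) u", OF t(1)];
        simp only: Fadd t(2)[symmetric] tau_slice)+
  have up: "Bu k (F s t (unit2 k)) (F s' t (unit2 k)) = 0"
    "Bu k (F s t (unit2 k)) (F s' t' (unit2 k)) + Bu k (F s t' (unit2 k)) (F s' t (unit2 k)) = 0" for k s s' t t'
    by (rule polarize_bilinear_family[where \<Phi>="\<lambda>s t. F s t (unit2 k)", OF u(1)];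
        simp only: Fadd u(2)[symmetric] upsilon_slice)+
  \<comment> \<open>Both vectors come from the slice t = e_j with the same s, where the second polar
    relation is twice \<open>Bt j x y\<close>.\<close>
  have Vt: "Bt j x y = 0" if xy: "x \<in> V i" "y \<in> V i" for i j x y
  proof -
    obtain a where a: "x = F (S i) (unit2 j) a" using V_T_slice[OF xy(1)] by blast
    obtain b where b: "y = F (S i) (unit2 j) b" using V_T_slice[OF xy(2)] by blast
    have "Bt j x y + Bt j y x = 0" unfolding a b by (rule tp(2))
    then show ?thesis using sbilinear_sym[OF t(1)[of j], of x y] by simp
  qed
  then have Vq: "Bq x y = 0" if "x \<in> V i" "y \<in> V i" for i x y
    using that by (simp add: qt)
  have nz: "be 2 j / be 2 0 \<noteq> 0" "ga 2 k / ga 2 0 \<noteq> 0" for j k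
    by simp_all
  \<comment> \<open>At c_2 = 0 the component of t along \<open>t2\<close> contributes nothing, so a
    change of t only rescales.\<close>
  have tZ: "F s (unit2 j) u2 = (be 2 j / be 2 0) *s F s (unit2 0) u2" for s j
    using F_split_t[of s "unit2 j" u2] by (simp add: base_line)
  have uY: "F s t2 (unit2 k) = (ga 2 k / ga 2 0) *s F s t2 (unit2 0)" for s k
    using F_split_u[of s t2 "unit2 k"] by (simp add: base_line)
  have tZZ: "Bt j (Z l) (Z ?m) = 0" for j
    using tp(1)[of j "S (1 - l)" u2 "S l"] nz(1)[of j]
    unfolding tZ[of "S (1 - l)" j] tZ[of "S l" j] by (simp add: sbilinearD[OF t(1)] Z_def)
  have uYY: "Bu k (Y l) (Y ?m) = 0" for k
    using up(1)[of k "S (1 - l)" t2 "S l"] nz(2)[of k]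
    unfolding uY[of "S (1 - l)" k] uY[of "S l" k] by (simp add: sbilinearD[OF u(1)] Y_def)
  have ZZ: "Bq (Z l) (Z ?m) = 0" and YY: "Bq (Y l) (Y ?m) = 0"
    by (simp add: qt tZZ, simp add: qu uYY)
  note bq = sbilinearD[OF q(1)]
  \<comment> \<open>Z_l is orthogonal to itself, to K_l and to Z_{1-l}; orthogonality to K_{1-l}
    would complete a basis and put it in the radical.\<close>
  have singular: False if "Bq (Z l) (K ?m) = 0"
  proof -
    have "Bq (Z l) (Z l) = 0" "Bq (Z l) (K l) = 0" by (rule Vq[OF ZYK_in_V(1) ZYK_in_V(1)], rule Vq[OF ZYK_in_V(1) ZYK_in_V(3)])
    moreover obtain x where x: "Bq (Z l) x \<noteq> 0"
      using smooth_form_2D[OF Q q Z_nonzero \<open>Bq (Z l) (Z l) = 0\<close>] by blast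
    obtain d e where "x = d 0 *s Z 0 + e 0 *s K 0 + d (1::2) *s Z 1 + e (1::2) *s K 1" by (rule ZK_span)
    ultimately have "Bq (Z l) x = 0"
      using that ZZ two_cases[of l] by (auto simp: bq)
    with x show False ..
  qed
  have Yl: "Y l = gY l *s Z l" using Y_expand[of l] h0 by simp
  \<comment> \<open>Expanding the pairing of Y_l with Y_{1-l} leaves only this term, which forces
    the other pair to be proportional too.\<close>
  have "gY l * (hY ?m * Bq (Z l) (K ?m)) = 0"
    using YY unfolding Yl Y_expand[of ?m] by (auto simp: bq ZZ)
  then have h1: "hY ?m = 0" using gY_nonzero singular by auto
  have Ym: "Y ?m = gY ?m *s Z ?m" using Y_expand[of ?m] h1 by simp
  have "Bt j (Z l) (K ?m) + Bt j (K l) (Z ?m) = 0" for j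
  proof -
    obtain c c' where c': "c' \<noteq> 0"
      and FK: "\<And>i. F (S (1 - i)) (unit2 j) (unit2 0) = c *s Y i + c' *s K i"
      and FZ: "\<And>i. F (S (1 - i)) (unit2 j) u2 = c' *s Z i"
    proof (rule that)
      show "F (S (1 - i)) (unit2 j) (unit2 0) = (unit2 j 1 / be 2 0) *s Y i
          + (be 2 j / be 2 0) *s K i" for i
        using F_split_t[of "S (1 - i)" "unit2 j" "unit2 0"] by (simp add: Y_def K_def)
      show "F (S (1 - i)) (unit2 j) u2 = (be 2 j / be 2 0) *s Z i" for i
        unfolding Z_def by (rule tZ)
    qed (rule nz)
    have "Bt j (c' *s Z l) (c *s Y ?m + c' *s K ?m) + Bt j (c *s Y l + c' *s K l) (c' *s Z ?m) = 0"
      using tp(2)[of j "S (1 - l)" u2 "S (1 - ?m)" "unit2 0"] unfolding FK FZ .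
    then have "c' * c' * (Bt j (Z l) (K ?m) + Bt j (K l) (Z ?m)) = 0"
      unfolding Yl Ym by (simp only: sbilinearD[OF t(1)] tZZ) (simp add: algebra_simps)
    then show ?thesis using c' by (simp only: mult_eq_0_iff) blast
  qed
  from this[of 0] this[of 1] have eq1: "Bq (Z l) (K ?m) + Bq (K l) (Z ?m) = 0"
    unfolding qt by algebra
  have "Bu k (Y l) (K ?m) + Bu k (K l) (Y ?m) = 0" for k
  proof -
    obtain c c' where c': "c' \<noteq> 0"
      and FK: "\<And>i. F (S (1 - i)) (unit2 0) (unit2 k) = c *s Z i + c' *s K i"
      and FY: "\<And>i. F (S (1 - i)) t2 (unit2 k) = c' *s Y i"
    proof (rule that)
      show "F (S (1 - i)) (unit2 0) (unit2 k) = (unit2 k 1 / ga 2 0) *s Z i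
          + (ga 2 k / ga 2 0) *s K i" for i
        using F_split_u[of "S (1 - i)" "unit2 0" "unit2 k"] by (simp add: Z_def K_def)
      show "F (S (1 - i)) t2 (unit2 k) = (ga 2 k / ga 2 0) *s Y i" for i
        unfolding Y_def by (rule uY)
    qed (rule nz)
    have "gY l * (gY ?m * Bu k (Z l) (Z ?m)) = 0"
      using uYY[of k] unfolding Yl Ym by (auto simp: sbilinearD[OF u(1)])
    then have uZZ: "Bu k (Z l) (Z ?m) = 0" using gY_nonzero by simp
    have "Bu k (c' *s Y l) (c *s Z ?m + c' *s K ?m) + Bu k (c *s Z l + c' *s K l) (c' *s Y ?m) = 0"
      using up(2)[of k "S (1 - l)" t2 "S (1 - ?m)" "unit2 0"] unfolding FK FY .
    then have "c' * c' * (Bu k (Y l) (K ?m) + Bu k (K l) (Y ?m)) = 0"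
      unfolding Yl Ym by (simp only: sbilinearD[OF u(1)] uZZ) (simp add: algebra_simps)
    then show ?thesis using c' by (simp only: mult_eq_0_iff) blast
  qed
  from this[of 0] this[of 1] have "Bq (Y l) (K ?m) + Bq (K l) (Y ?m) = 0"
    unfolding qu by algebra
  then have "gY l * Bq (Z l) (K ?m) + gY ?m * Bq (K l) (Z ?m) = 0"
    unfolding Yl Ym by (simp add: bq)
  \<comment> \<open>Two linear equations in the pairings of Z_l with K_m and of K_l with Z_m; their
    determinant is the difference of the two factors g.\<close>
  then have "(gY l - gY ?m) * Bq (Z l) (K ?m) = 0"
    using eq1 by algebra
  then have gg: "gY l = gY ?m" using singular by auto
  have Yi: "Y i = gY l *s Z i" for i
    using Yl Ym gg two_cases[of i] two_cases[of l] by auto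
  let ?c0 = "ev2 (\<alpha> 0) (unit2 0) / ev2 (\<alpha> 0) (S 1)" and ?c1 = "ev2 (\<alpha> 1) (unit2 0) / ev2 (\<alpha> 1) (S 0)"
  have c0: "?c0 \<noteq> 0" using det_alpha by (simp add: ev2_perp)
  have Fp: "p 0 j k = ?c1 *s F (S 0) (unit2 j) (unit2 k) + ?c0 *s F (S 1) (unit2 j) (unit2 k)" for j k
    using F_split_s[of "unit2 0" "unit2 j" "unit2 k"] by (simp add: Fv_unit(1))
  \<comment> \<open>With equal factors g, the coefficients d and e do not depend on i. The corners
    of Sigma_0 then fill at most a two-dimensional space, although its annihilator should be a
    line.\<close>
  have Fjk: "\<exists>d e. \<forall>i. F (S (1 - i)) (unit2 j) (unit2 k) = d *s Z i + e *s K i" for j k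
  proof -
    have gen: "\<exists>d e. \<forall>i. c1 *s (c2 *s Y i) + c3 *s (c4 *s Z i + c2 *s K i) = d *s Z i + e *s K i"
      for c1 c2 c3 c4
    proof -
      have "c1 *s (c2 *s (g *s z)) + c3 *s (c4 *s z + c2 *s k) = (c1 * c2 * g + c3 * c4) *s z + (c3 * c2) *s k"
        for g and z k :: "complex^4"
        by (simp add: vec_eq_iff algebra_simps)
      then show ?thesis unfolding Yi by blast
    qed
    have main: "F (S (1 - i)) (unit2 j) (unit2 k) =
        (unit2 j 1 / be 2 0) *s ((ga 2 k / ga 2 0) *s Y i)
        + (be 2 j / be 2 0) *s ((unit2 k 1 / ga 2 0) *s Z i
          + (ga 2 k / ga 2 0) *s K i)" for i
    proof -
      have e1: "F (S (1 - i)) (unit2 0) (unit2 k) = (unit2 k 1 / ga 2 0) *s Z i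
          + (ga 2 k / ga 2 0) *s K i"
        using F_split_u[of "S (1 - i)" "unit2 0" "unit2 k"] unfolding Z_def[symmetric] K_def[symmetric] ev2_unit2 .
      have e2: "F (S (1 - i)) t2 (unit2 k) = (ga 2 k / ga 2 0) *s Y i"
        unfolding Y_def by (rule uY)
      show ?thesis
        using F_split_t[of "S (1 - i)" "unit2 j" "unit2 k"] unfolding ev2_unit2 e1 e2 .
    qed
    show ?thesis unfolding main by (rule gen)
  qed
  \<comment> \<open>\<open>D\<close> is orthogonal to the coefficients of \<open>p 0 j k\<close> in
    the two lines, so \<open>n\<close> and \<open>n'\<close> are independent functionals that vanish
    on all corners of Sigma_0.\<close>
  define D where "D = (\<lambda>i::2. if i = 0 then ?c1 else - ?c0)"
  have D: "D 0 = ?c1" "D 1 = - ?c0" by (simp_all add: D_def)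
  obtain n where n: "\<And>i. cdot n (Z i) = D i" "\<And>i. cdot n (K i) = 0"
    using ZK_dual[of D "\<lambda>_. 0"] by auto
  obtain n' where n': "\<And>i. cdot n' (K i) = D i" "\<And>i. cdot n' (Z i) = 0"
    using ZK_dual[of "\<lambda>_. 0" D] by auto
  have "cdot n (p 0 j k) = 0 \<and> cdot n' (p 0 j k) = 0" for j k
  proof -
    obtain d e where de: "\<And>i. F (S (1 - i)) (unit2 j) (unit2 k) = d *s Z i + e *s K i"
      using Fjk by blast
    have "F (S 0) (unit2 j) (unit2 k) = d *s Z 1 + e *s K 1" "F (S 1) (unit2 j) (unit2 k) = d *s Z 0 + e *s K 0"
      using de[of 1] de[of 0] by simp_all
    then show ?thesis unfolding Fp by (simp add: n n' D del: ev2_unit2)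
  qed
  then obtain k k' where k: "n = k *s sg 0" "n' = k' *s sg 0"
    using S_ann[of n 0] S_ann[of n' 0] by blast
  have "k * cdot (sg 0) (K 1) = 0" "k * cdot (sg 0) (Z 1) \<noteq> 0" "k' * cdot (sg 0) (K 1) \<noteq> 0"
    using n[of 1] n'[of 1] c0 unfolding k D by (simp_all del: ev2_unit2)
  then show False by auto
qed

text \<open>theta_l vanishes at Z_l and not at K_l, so it does not vanish at Y_l = g Z_l + h K_l;
  its value there contains beta_l evaluated at the zero of b_2. For rho_l, the roles of Y_l and Z_l
  are exchanged.\<close>

lemma det_beta_gamma: "det2 (\<beta> (line_index l)) (\<beta> 2) \<noteq> 0" "det2 (\<gamma> (line_index l)) (\<gamma> 2) \<noteq> 0"
proof -
  have "det2 (\<alpha> 1) (\<alpha> 0) \<noteq> 0" using det_alpha by (simp add: det2_def mult.commute)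
  then have aS: "ev2 (\<alpha> l) (S (1 - l)) \<noteq> 0"
    using det_alpha two_cases[of l] by (auto simp: ev2_perp)
  have "cdot (th l) (Z l) = 0" by (simp add: Z_def cdot_th)
  moreover have "cdot (th l) (K l) \<noteq> 0" using aS by (simp add: K_def cdot_th)
  ultimately have "cdot (th l) (Y l) \<noteq> 0"
    by (subst Y_expand) (simp add: hY_nonzero)
  then show "det2 (\<beta> (line_index l)) (\<beta> 2) \<noteq> 0" by (auto simp: Y_def cdot_th ev2_perp)
  have "cdot (rh l) (Y l) = 0" by (simp add: Y_def cdot_rh)
  moreover have "cdot (rh l) (K l) \<noteq> 0" using aS by (simp add: K_def cdot_rh)
  ultimately have "cdot (rh l) (Z l) \<noteq> 0"
    using hY_nonzero[of l] by (subst (asm) Y_expand) auto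
  then show "det2 (\<gamma> (line_index l)) (\<gamma> 2) \<noteq> 0" by (auto simp: Z_def cdot_rh ev2_perp)
qed

end

lemma cdot_commute: "cdot m n = cdot n m"
  by (simp add: cdot_def mult.commute)

lemma line_index_simps [simp]: "line_index 0 = 0" "line_index 1 = 1"
  by (simp_all add: line_index_def)

lemma det2_combination:
  assumes "det2 u v \<noteq> 0"
  shows "w $ i = det2 w v / det2 u v * u $ i + det2 u w / det2 u v * v $ i"
proof -
  have "\<forall>i. w $ i * det2 u v = det2 w v * u $ i + det2 u w * v $ i"
    unfolding all_two by (simp add: det2_def algebra_simps)
  then have "w $ i * det2 u v = det2 w v * u $ i + det2 u w * v $ i" by blast
  then show ?thesis using assms by (simp add: field_simps)
qed

lemma lf_combination:
  assumes "det2 u v \<noteq> 0"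
  shows "lf b w z = of_real (det2 w v / det2 u v) * lf b u z + of_real (det2 u w / det2 u v) * lf b v z"
proof -
  have "complex_of_real (w $ i) = of_real (det2 w v / det2 u v) * of_real (u $ i) + of_real (det2 u w / det2 u v) * of_real (v $ i)" for i
    by (subst det2_combination[OF assms, of w i]) simp
  from this[of 0] this[of 1] show ?thesis unfolding lf_def by algebra
qed

text \<open>The vectors \<open>v\<close> below run over the image of a slice \<open>t = e\<^sub>j\<close> of the map in normal form, and over
  that of a slice \<open>u = e\<^sub>k\<close> after the exchange of \<open>A\<close> with \<open>C\<close> and of \<open>B\<close> with \<open>D\<close>.\<close>

lemma quadric_block:
  fixes eA eB eC eD :: "complex^4"
  assumes G: "sbilinear G"
    and van: "\<And>p0 p1 r0 r2 v. v = (p0 * b0 * r2) *s eA + (p1 * b1 * r2) *s eB + (p0 * b2 * r0) *s eC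
      + (p1 * b2 * (z1 * r0 + y * r2)) *s eD \<Longrightarrow> G v v = 0"
    and nz: "b0 \<noteq> 0" "b1 \<noteq> 0" "b2 \<noteq> 0" "z1 \<noteq> 0"
  shows "\<exists>m. \<forall>v A B C D. v = A *s eA + B *s eB + C *s eC + D *s eD \<longrightarrow>
    G v v = m * (b1 * A * D - b2 * y * A * B - b0 * z1 * B * C)"
proof -
  have expand: "G v v = A * A * G eA eA + B * B * G eB eB + C * C * G eC eC + D * D * G eD eD
    + 2 * (A * B * G eA eB + A * C * G eA eC + A * D * G eA eD + B * C * G eB eC + B * D * G eB eD + C * D * G eC eD)"
    if "v = A *s eA + B *s eB + C *s eC + D *s eD" for v A B C D
    unfolding that sbilinearD[OF G]
      sbilinear_sym[OF G, of eB eA] sbilinear_sym[OF G, of eC eA] sbilinear_sym[OF G, of eD eA]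
      sbilinear_sym[OF G, of eC eB] sbilinear_sym[OF G, of eD eB] sbilinear_sym[OF G, of eD eC]
    by (simp add: algebra_simps)
  have eq: "(p0 * b0 * r2) * (p0 * b0 * r2) * G eA eA + (p1 * b1 * r2) * (p1 * b1 * r2) * G eB eB
    + (p0 * b2 * r0) * (p0 * b2 * r0) * G eC eC
    + (p1 * b2 * (z1 * r0 + y * r2)) * (p1 * b2 * (z1 * r0 + y * r2)) * G eD eD
    + 2 * ((p0 * b0 * r2) * (p1 * b1 * r2) * G eA eB + (p0 * b0 * r2) * (p0 * b2 * r0) * G eA eC
      + (p0 * b0 * r2) * (p1 * b2 * (z1 * r0 + y * r2)) * G eA eD + (p1 * b1 * r2) * (p0 * b2 * r0) * G eB eC
      + (p1 * b1 * r2) * (p1 * b2 * (z1 * r0 + y * r2)) * G eB eD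
      + (p0 * b2 * r0) * (p1 * b2 * (z1 * r0 + y * r2)) * G eC eD) = 0" for p0 p1 r0 r2
    using van[OF refl, of p0 r2 p1 r0] unfolding expand[OF refl] .
  \<comment> \<open>The arguments of \<open>eq\<close> stand in the order \<open>p0\<close>,
    \<open>r2\<close>, \<open>p1\<close>, \<open>r0\<close>. Values 0 and 1 isolate the ten
    coefficients of the quadratic form one after another.\<close>
  have AA: "G eA eA = 0" using eq[of 1 1 0 0] nz by simp
  have CC: "G eC eC = 0" using eq[of 1 0 0 1] nz by simp
  have AC: "G eA eC = 0" using eq[of 1 1 0 1] nz by (simp add: AA CC)
  have DD: "G eD eD = 0" using eq[of 0 0 1 1] nz by simp
  have "b1 * b1 * G eB eB + 2 * (b1 * b2 * y * G eB eD) = 0"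
    using eq[of 0 1 1 0] by (simp add: DD mult_ac)
  moreover have "b1 * b1 * G eB eB + 2 * (b1 * b2 * (z1 + y) * G eB eD) = 0"
    using eq[of 0 1 1 1] by (simp add: DD mult_ac)
  ultimately have "2 * b1 * b2 * z1 * G eB eD = 0" by algebra
  then have BD: "G eB eD = 0" using nz by simp
  have BB: "G eB eB = 0" using eq[of 0 1 1 0] nz by (simp add: DD BD)
  note zero = AA BB CC DD AC BD
  have CD: "G eC eD = 0" using eq[of 1 0 1 1] nz by (simp add: zero)
  have "2 * b0 * (b1 * G eA eB + b2 * y * G eA eD) = 0"
    using eq[of 1 1 1 0] by (simp add: zero algebra_simps)
  then have AB: "b1 * G eA eB + b2 * y * G eA eD = 0" using nz by simp
  have "2 * b2 * (b0 * z1 * G eA eD + b1 * G eB eC) + 2 * b0 * (b1 * G eA eB + b2 * y * G eA eD) = 0"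
    using eq[of 1 1 1 1] by (simp add: zero CD algebra_simps)
  then have BC: "b0 * z1 * G eA eD + b1 * G eB eC = 0" using nz AB by simp
  show ?thesis
  proof (intro exI allI impI)
    fix v A B C D assume v: "v = A *s eA + B *s eB + C *s eC + D *s eD"
    have "G v v = 2 * (A * B * G eA eB + A * D * G eA eD + B * C * G eB eC)"
      unfolding expand[OF v] zero CD by simp
    moreover have "G eA eB = - b2 * y * G eA eD / b1" "G eB eC = - b0 * z1 * G eA eD / b1"
      using AB BC nz by (simp_all add: field_simps eq_neg_iff_add_eq_0)
    moreover have "2 * (A * B * (- b2 * y * g / b1) + A * D * g + B * C * (- b0 * z1 * g / b1))
        = (2 * g / b1) * (b1 * A * D - b2 * y * A * B - b0 * z1 * B * C)" for g
      using nz(2) by (simp add: field_simps)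
    ultimately show "G v v = (2 * G eA eD / b1) * (b1 * A * D - b2 * y * A * B - b0 * z1 * B * C)"
      by (simp only:)
  qed
qed

section \<open>Independence of the four planes and passage to the normal form\<close>

context scaffold_config
begin

lemma rh_Z: "cdot (rh l) (Z l) \<noteq> 0" and th_Y: "cdot (th l) (Y l) \<noteq> 0" and th_K: "cdot (th l) (K l) \<noteq> 0"
proof -
  have "det2 (\<alpha> 1) (\<alpha> 0) \<noteq> 0" using det_alpha by (simp add: det2_def mult.commute)
  then have aS: "ev2 (\<alpha> l) (S (1 - l)) \<noteq> 0"
    using det_alpha two_cases[of l] by (auto simp: ev2_perp)
  show "cdot (rh l) (Z l) \<noteq> 0" "cdot (th l) (Y l) \<noteq> 0" "cdot (th l) (K l) \<noteq> 0"
    using aS det_beta_gamma by (simp_all add: Z_def Y_def K_def cdot_rh cdot_th ev2_perp)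
qed

lemma th_rh_zero:
  "cdot (th l) (Z l) = 0" "cdot (rh l) (Y l) = 0"
  "cdot (th l) (Z (1 - l)) = 0" "cdot (th l) (K (1 - l)) = 0" "cdot (th l) (Y (1 - l)) = 0"
  "cdot (rh l) (Z (1 - l)) = 0" "cdot (rh l) (K (1 - l)) = 0" "cdot (rh l) (Y (1 - l)) = 0"
  by (simp_all add: Z_def Y_def K_def cdot_rh cdot_th)

text \<open>On the basis Z_l, K_l the system is triangular: theta_l sees only K_l, and once this
  coefficient is gone rho_l sees only Z_l.\<close>

lemma th_rh_injective:
  assumes "\<And>l. cdot (th l) v = 0" "\<And>l. cdot (rh l) v = 0"
  shows "v = 0"
proof -
  obtain d e where v: "v = d 0 *s Z 0 + e 0 *s K 0 + d (1::2) *s Z 1 + e (1::2) *s K 1" by (rule ZK_span)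
  have "e 0 = 0" using assms(1)[of 0] th_K[of 0] th_rh_zero(1,3,4)[of 0] unfolding v by simp
  moreover have "e 1 = 0" using assms(1)[of 1] th_K[of 1] th_rh_zero(1,3,4)[of 1] unfolding v by simp
  moreover have "d 0 = 0" using assms(2)[of 0] rh_Z[of 0] th_rh_zero(6,7)[of 0] \<open>e 0 = 0\<close> unfolding v by simp
  moreover have "d 1 = 0" using assms(2)[of 1] rh_Z[of 1] th_rh_zero(6,7)[of 1] \<open>e 1 = 0\<close> unfolding v by simp
  ultimately show ?thesis unfolding v by simp
qed

lemma cdot_th_p: "cdot (th l) (p i j k) = al l i * be (line_index l) j * ga 2 k"
  and cdot_rh_p: "cdot (rh l) (p i j k) = al l i * be 2 j * ga (line_index l) k"
  using cdot_th[of l "unit2 i" "unit2 j" "unit2 k"] cdot_rh[of l "unit2 i" "unit2 j" "unit2 k"]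
  by (simp_all add: Fv_unit(1))

lemma ex_normal_form:
  "\<exists>eA eB eC eD x y y1 z1. normal_form (trilin w P) \<alpha> \<beta> \<gamma> (th 0) (th 1) (rh 0) (rh 1) eA eB eC eD x y y1 z1"
proof -
  let ?v = "\<lambda>l e::2. if e = 0 then th l else rh l"
  have ann: "n = 0" if n: "\<And>l e. cdot n (?v l e) = 0" for n
  proof (rule th_rh_injective)
    show "cdot (th l) n = 0" "cdot (rh l) n = 0" for l
      using n[of 0 l] n[of 1 l] by (simp_all add: cdot_commute[of _ n])
  qed
  have "\<exists>n. cdot (th 0) n = d 0 0 \<and> cdot (th 1) n = d 1 0 \<and> cdot (rh 0) n = d 0 1 \<and> cdot (rh 1) n = d 1 1"
    for d :: "2 \<Rightarrow> 2 \<Rightarrow> complex"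
  proof -
    obtain n where n: "\<And>l e. cdot n (?v l e) = d l e" using four_vectors(3)[of ?v d, OF ann] by blast
    show ?thesis
      using n[of 0 0] n[of 1 0] n[of 0 1] n[of 1 1] by (intro exI[of _ n]) (simp add: cdot_commute[of _ n])
  qed
  note dual = this
  obtain eA where A: "cdot (th 0) eA = 1" "cdot (th 1) eA = 0" "cdot (rh 0) eA = 0" "cdot (rh 1) eA = 0"
    using dual[of "\<lambda>l e. if l = 0 \<and> e = 0 then 1 else 0"] by auto
  obtain eB where B: "cdot (th 0) eB = 0" "cdot (th 1) eB = 1" "cdot (rh 0) eB = 0" "cdot (rh 1) eB = 0"
    using dual[of "\<lambda>l e. if l = 1 \<and> e = 0 then 1 else 0"] by auto
  obtain eC where C: "cdot (th 0) eC = 0" "cdot (th 1) eC = 0" "cdot (rh 0) eC = 1" "cdot (rh 1) eC = 0"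
    using dual[of "\<lambda>l e. if l = 0 \<and> e = 1 then 1 else 0"] by auto
  obtain eD where D: "cdot (th 0) eD = 0" "cdot (th 1) eD = 0" "cdot (rh 0) eD = 0" "cdot (rh 1) eD = 1"
    using dual[of "\<lambda>l e. if l = 1 \<and> e = 1 then 1 else 0"] by auto
  have expand: "v = cdot (th 0) v *s eA + cdot (th 1) v *s eB + cdot (rh 0) v *s eC + cdot (rh 1) v *s eD" for v
  proof -
    have "v - (cdot (th 0) v *s eA + cdot (th 1) v *s eB + cdot (rh 0) v *s eC + cdot (rh 1) v *s eD) = 0"
      (is "?d = 0")
    proof (rule th_rh_injective)
      show "cdot (th l) ?d = 0" "cdot (rh l) ?d = 0" for l
        using two_cases[of l] by (auto simp: A B C D)
    qed
    then show ?thesis by simp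
  qed
  have db: "det2 (\<beta> 0) (\<beta> 2) \<noteq> 0" "det2 (\<beta> 1) (\<beta> 2) \<noteq> 0" and dc: "det2 (\<gamma> 0) (\<gamma> 2) \<noteq> 0" "det2 (\<gamma> 1) (\<gamma> 2) \<noteq> 0"
    using det_beta_gamma[of 0] det_beta_gamma[of 1] by simp_all
  \<comment> \<open>If x = y = 0, the forms k_1 alpha_10 A - alpha_00 B and k_2 alpha_10 C -
    alpha_00 D vanish on all corners of Sigma_0 (first index of alpha for the line here), but they
    are independent.\<close>
  have xy: "det2 (\<beta> 0) (\<beta> 1) \<noteq> 0 \<or> det2 (\<gamma> 0) (\<gamma> 1) \<noteq> 0"
  proof (rule ccontr)
    assume "\<not> ?thesis"
    then have 0: "det2 (\<beta> 0) (\<beta> 1) = 0" "det2 (\<gamma> 0) (\<gamma> 1) = 0" by auto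
    define k1 k2 where k: "k1 = complex_of_real (det2 (\<beta> 1) (\<beta> 2) / det2 (\<beta> 0) (\<beta> 2))"
      "k2 = complex_of_real (det2 (\<gamma> 1) (\<gamma> 2) / det2 (\<gamma> 0) (\<gamma> 2))"
    have k0: "k1 \<noteq> 0" "k2 \<noteq> 0" using db dc by (simp_all add: k)
    have b: "be 1 j = k1 * be 0 j" for j
      by (subst det2_combination[OF db(1), of "\<beta> 1" j]) (simp add: 0 k)
    have c: "ga 1 j = k2 * ga 0 j" for j
      by (subst det2_combination[OF dc(1), of "\<gamma> 1" j]) (simp add: 0 k)
    let ?n1 = "(al 1 0 * k1) *s th 0 - al 0 0 *s th 1"
    let ?n2 = "(al 1 0 * k2) *s rh 0 - al 0 0 *s rh 1"
    obtain m1 where m1: "?n1 = m1 *s sg 0"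
      using S_ann[of ?n1 0] by (auto simp: cdot_th_p b)
    obtain m2 where m2: "?n2 = m2 *s sg 0"
      using S_ann[of ?n2 0] by (auto simp: cdot_rh_p c)
    have "cdot ?n1 eA \<noteq> 0" "cdot ?n1 eC = 0" "cdot ?n2 eC \<noteq> 0" using k0 by (simp_all add: A C)
    then show False unfolding m1 m2 by simp
  qed
  have "normal_form (trilin w P) \<alpha> \<beta> \<gamma> (th 0) (th 1) (rh 0) (rh 1) eA eB eC eD
    (of_real (det2 (\<beta> 0) (\<beta> 1) / det2 (\<beta> 0) (\<beta> 2))) (of_real (det2 (\<gamma> 0) (\<gamma> 1) / det2 (\<gamma> 0) (\<gamma> 2)))
    (of_real (det2 (\<beta> 1) (\<beta> 2) / det2 (\<beta> 0) (\<beta> 2))) (of_real (det2 (\<gamma> 1) (\<gamma> 2) / det2 (\<gamma> 0) (\<gamma> 2)))"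
  proof
    show "multihom P111 (\<lambda>_. 1) (trilin w P i)" for i by (rule multihom_trilin)
    fix z
    show "cdot (th 0) (polymap (trilin w P) z) = lf 0 (\<alpha> 0) z * lf 1 (\<beta> 0) z * lf 2 (\<gamma> 2) z"
      "cdot (th 1) (polymap (trilin w P) z) = lf 0 (\<alpha> 1) z * lf 1 (\<beta> 1) z * lf 2 (\<gamma> 2) z"
      "cdot (rh 0) (polymap (trilin w P) z) = lf 0 (\<alpha> 0) z * lf 1 (\<beta> 2) z * lf 2 (\<gamma> 0) z"
      "cdot (rh 1) (polymap (trilin w P) z) = lf 0 (\<alpha> 1) z * lf 1 (\<beta> 2) z * lf 2 (\<gamma> 1) z"
      by (simp_all add: polymap_trilin cdot_th cdot_rh lf_ev2)
    show "lf 1 (\<beta> 1) z = of_real (det2 (\<beta> 1) (\<beta> 2) / det2 (\<beta> 0) (\<beta> 2)) * lf 1 (\<beta> 0) z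
        + of_real (det2 (\<beta> 0) (\<beta> 1) / det2 (\<beta> 0) (\<beta> 2)) * lf 1 (\<beta> 2) z"
      by (rule lf_combination[OF db(1)])
    show "lf 2 (\<gamma> 1) z = of_real (det2 (\<gamma> 1) (\<gamma> 2) / det2 (\<gamma> 0) (\<gamma> 2)) * lf 2 (\<gamma> 0) z
        + of_real (det2 (\<gamma> 0) (\<gamma> 1) / det2 (\<gamma> 0) (\<gamma> 2)) * lf 2 (\<gamma> 2) z"
      by (rule lf_combination[OF dc(1)])
  next
    show "v = cdot (th 0) v *s eA + cdot (th 1) v *s eB + cdot (rh 0) v *s eC + cdot (rh 1) v *s eD" for v
      by (rule expand)
  qed (rule A B C D det_alpha db(1) dc(1) | use db dc xy in simp)+
  then show ?thesis by (intro exI)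
qed

end

section \<open>The given surfaces and lines in the coordinates A, B, C, D\<close>

locale scaffold_normal =
  scaffold_config w P r \<sigma> \<tau> \<upsilon> q \<pi> \<theta> \<rho> lam \<mu> \<nu> \<alpha> \<beta> \<gamma> \<kappa> +
  nf: normal_form "trilin w P" \<alpha> \<beta> \<gamma> "scaffold_config.th \<theta> \<kappa> 0" "scaffold_config.th \<theta> \<kappa> 1"
    "scaffold_config.rh \<rho> \<kappa> 0" "scaffold_config.rh \<rho> \<kappa> 1" eA eB eC eD x y y1 z1
  for w P r \<sigma> \<tau> \<upsilon> q \<pi> \<theta> \<rho> lam \<mu> \<nu> \<alpha> \<beta> \<gamma> \<kappa> eA eB eC eD x y y1 z1
begin

text \<open>At s = e_i the forms a_0 and a_1 take the values \<open>al 0 i\<close> and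
  \<open>al 1 i\<close>, so this combination of the pullbacks a_0 E and a_1 E vanishes on the
  corners of Sigma_i, which determine the plane form up to a scalar.\<close>

lemma sigma_form: "\<exists>k. k \<noteq> 0 \<and> (\<forall>v. peval (\<sigma> i) v = k * (al 1 i * nf.U v - al 0 i * nf.V v))"
proof -
  let ?n = "al 1 i *s ((y * y1) *s th 0 - (x * z1) *s rh 0) - al 0 i *s (y *s th 1 - x *s rh 1)"
  have n: "cdot ?n v = al 1 i * nf.U v - al 0 i * nf.V v" for v
    by (simp add: nf.U_def nf.V_def algebra_simps)
  have "cdot ?n (p i j k) = 0" for j k
  proof -
    let ?z = "mkpt (unit2 i) (unit2 j) (unit2 k)"
    have a: "lf 0 (\<alpha> l) ?z = al l i" for l by (simp add: lf_ev2)
    have "p i j k = nf.f ?z" by (simp add: polymap_mkpt Fv_unit(1))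
    then show ?thesis unfolding n by (simp add: nf.U_f nf.V_f a del: lf_ev2)
  qed
  then obtain c where c: "?n = c *s sg i" using S_ann by blast
  have "cdot ?n eA \<noteq> 0 \<or> cdot ?n eC \<noteq> 0"
    using nf.xy nf.y1 nf.z1 by (auto simp: nf.dual)
  then have "c \<noteq> 0" unfolding c by auto
  have "peval (\<sigma> i) v = (1 / c) * cdot ?n v" for v
    unfolding c peval_sigma using \<open>c \<noteq> 0\<close> by simp
  then show ?thesis using \<open>c \<noteq> 0\<close> unfolding n by (intro exI[of _ "1 / c"]) simp
qed

lemma beta_gamma_nonzero: "\<beta> 0 $ j \<noteq> 0" "\<beta> 1 $ j \<noteq> 0" "\<gamma> 0 $ j \<noteq> 0" "\<gamma> 1 $ j \<noteq> 0"
  using entries_nonzero(2)[of 0 j] entries_nonzero(2)[of 1 j] entries_nonzero(3)[of 0 j] entries_nonzero(3)[of 1 j]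
  by (simp_all del: entries_nonzero)

lemma b1_coord: "be 1 j = y1 * be 0 j + x * be 2 j"
  using nf.b1[of "mkpt (unit2 0) (unit2 j) (unit2 0)"] by (simp add: lf_ev2)

lemma c1_coord: "ga 1 k = z1 * ga 0 k + y * ga 2 k"
  using nf.c1[of "mkpt (unit2 0) (unit2 0) (unit2 k)"] by (simp add: lf_ev2)

lemma obtain_pair:
  assumes "det2 u v \<noteq> 0"
  obtains s where "ev2 u s = a" "ev2 v s = b"
proof -
  obtain r :: "2 \<Rightarrow> complex" where "of_real (u $ 0) * r 0 + of_real (u $ 1) * r 1 = a"
    "of_real (v $ 0) * r 0 + of_real (v $ 1) * r 1 = b"
    by (rule lf_solve[OF assms])
  then show ?thesis by (intro that[of r]) (simp_all add: ev2_def)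
qed

text \<open>The proportion (b_0 : b_2) = (AV : Q), taken at t = e_j and cleared of
  denominators.\<close>

abbreviation "T_pencil j v \<equiv> be 0 j * nf.Q v - be 2 j * (nf.A v * nf.V v)"
abbreviation "Y_pencil k v \<equiv> ga 0 k * nf.Q v - ga 2 k * (nf.C v * nf.V v)"

lemma tau_form: "\<exists>m. \<forall>v. peval (\<tau> j) v = m * T_pencil j v"
proof -
  obtain G where G: "sbilinear G" "\<And>x. peval (\<tau> j) x = G x x" using quadratic_form_sbilinear[OF tau(1)] by blast
  \<comment> \<open>The parameters are the values of a_0, a_1 and c_0, c_2, so the vector is the
    image of an arbitrary point of the slice.\<close>
  have van: "G v v = 0" if v: "v = (p0 * be 0 j * r2) *s eA + (p1 * be 1 j * r2) *s eB + (p0 * be 2 j * r0) *s eC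
      + (p1 * be 2 j * (z1 * r0 + y * r2)) *s eD" for p0 p1 r0 r2 v
  proof -
    obtain s where s: "ev2 (\<alpha> 0) s = p0" "ev2 (\<alpha> 1) s = p1" by (rule obtain_pair[OF nf.det(1)])
    obtain u where u: "ev2 (\<gamma> 0) u = r0" "ev2 (\<gamma> 2) u = r2" by (rule obtain_pair[OF nf.det(3)])
    have u1: "ev2 (\<gamma> 1) u = z1 * r0 + y * r2"
      using nf.c1[of "mkpt s (unit2 j) u"] by (simp add: lf_ev2 u)
    have "v = F s (unit2 j) u"
      unfolding v
      by (rule nf.eq_by_coords) (simp_all add: nf.dual cdot_th cdot_rh s u u1)
    then show ?thesis using tau_slice[of j s u] G(2) by simp
  qed
  have nz: "be 0 j \<noteq> 0" "be 1 j \<noteq> 0" "be 2 j \<noteq> 0" using beta_gamma_nonzero by simp_all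
  have "\<exists>m. \<forall>v A B C D. v = A *s eA + B *s eB + C *s eC + D *s eD \<longrightarrow>
      G v v = m * (be 1 j * A * D - be 2 j * y * A * B - be 0 j * z1 * B * C)"
    by (rule quadric_block[OF G(1) _ nz nf.z1]) (rule van)
  then obtain m where m: "\<And>v A B C D. v = A *s eA + B *s eB + C *s eC + D *s eD \<Longrightarrow>
      G v v = m * (be 1 j * A * D - be 2 j * y * A * B - be 0 j * z1 * B * C)"
    by metis
  have "peval (\<tau> j) v = m * T_pencil j v" for v
    unfolding G(2) m[OF nf.expand[of v]] b1_coord nf.Q_def nf.V_def by (simp add: algebra_simps)
  then show ?thesis by blast
qed

lemma upsilon_form: "\<exists>m. \<forall>v. peval (\<upsilon> k) v = m * Y_pencil k v"
proof -
  obtain G where G: "sbilinear G" "\<And>x. peval (\<upsilon> k) x = G x x" using quadratic_form_sbilinear[OF upsilon(1)] by blast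
  have van: "G v v = 0" if v: "v = (p0 * ga 0 k * r2) *s eC + (p1 * ga 1 k * r2) *s eD + (p0 * ga 2 k * r0) *s eA
      + (p1 * ga 2 k * (y1 * r0 + x * r2)) *s eB" for p0 p1 r0 r2 v
  proof -
    obtain s where s: "ev2 (\<alpha> 0) s = p0" "ev2 (\<alpha> 1) s = p1" by (rule obtain_pair[OF nf.det(1)])
    obtain t where t: "ev2 (\<beta> 0) t = r0" "ev2 (\<beta> 2) t = r2" by (rule obtain_pair[OF nf.det(2)])
    have t1: "ev2 (\<beta> 1) t = y1 * r0 + x * r2"
      using nf.b1[of "mkpt s t (unit2 k)"] by (simp add: lf_ev2 t)
    have "v = F s t (unit2 k)"
      unfolding v
      by (rule nf.eq_by_coords) (simp_all add: nf.dual cdot_th cdot_rh s t t1)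
    then show ?thesis using upsilon_slice[of k s t] G(2) by simp
  qed
  have nz: "ga 0 k \<noteq> 0" "ga 1 k \<noteq> 0" "ga 2 k \<noteq> 0" using beta_gamma_nonzero by simp_all
  have "\<exists>m. \<forall>v A B C D. v = A *s eC + B *s eD + C *s eA + D *s eB \<longrightarrow>
      G v v = m * (ga 1 k * A * D - ga 2 k * x * A * B - ga 0 k * y1 * B * C)"
    by (rule quadric_block[OF G(1) _ nz nf.y1]) (rule van)
  then obtain m where m: "\<And>v A B C D. v = A *s eC + B *s eD + C *s eA + D *s eB \<Longrightarrow>
      G v v = m * (ga 1 k * A * D - ga 2 k * x * A * B - ga 0 k * y1 * B * C)"
    by metis
  \<comment> \<open>The exchange of A with C and of B with D exchanges the two products in Q, hence
    the sign.\<close>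
  have "peval (\<upsilon> k) v = (- m) * Y_pencil k v" for v
  proof -
    have "v = nf.C v *s eC + nf.D v *s eD + nf.A v *s eA + nf.B v *s eB"
      by (subst nf.expand[of v]) (simp only: add_ac)
    then show ?thesis
      unfolding G(2) by (subst m, assumption) (simp add: c1_coord nf.Q_def nf.V_def algebra_simps)
  qed
  then show ?thesis by blast
qed

end

context scaffold_normal
begin

lemma VQ_basis:
  "nf.V (eA + eB) = y" "nf.Q (eA + eB) = 0"
  "nf.V (eC + eD) = - x" "nf.Q (eC + eD) = 0" "nf.V (eA + eD) = - x" "nf.Q (eA + eD) = y1"
  "nf.V (eB + eC) = y" "nf.Q (eB + eC) = - z1"
  by (simp_all add: nf.V_def nf.Q_def nf.dual)

text \<open>A member of the T-pencil is kQ - k_A AV and one of the Y-pencil is lQ - l_C CV.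
  Comparing them at the four vectors of \<open>VQ_basis\<close> kills k_A and l_C, so the common
  member is a multiple of Q; the relations among the coefficients record how it arises in each
  pencil.\<close>

lemma quadric_forms:
  obtains k m0 m1 n0 n1 where "k \<noteq> 0" "\<And>v. peval q v = k * nf.Q v"
    "\<And>v. of_real (\<mu> $ 0) * peval (\<tau> 0) v = m0 * T_pencil 0 v"
    "\<And>v. of_real (\<mu> $ 1) * peval (\<tau> 1) v = m1 * T_pencil 1 v"
    "m0 * be 2 0 + m1 * be 2 1 = 0"
    "m0 * be 0 0 + m1 * be 0 1 = k"
    "\<And>v. of_real (\<nu> $ 0) * peval (\<upsilon> 0) v = n0 * Y_pencil 0 v"
    "\<And>v. of_real (\<nu> $ 1) * peval (\<upsilon> 1) v = n1 * Y_pencil 1 v"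
    "n0 * ga 2 0 + n1 * ga 2 1 = 0"
    "n0 * ga 0 0 + n1 * ga 0 1 = k"
proof -
  obtain m0' where m0': "\<And>v. peval (\<tau> 0) v = m0' * T_pencil 0 v"
    using tau_form[of 0] by blast
  obtain m1' where m1': "\<And>v. peval (\<tau> 1) v = m1' * T_pencil 1 v"
    using tau_form[of 1] by blast
  obtain n0' where n0': "\<And>v. peval (\<upsilon> 0) v = n0' * Y_pencil 0 v"
    using upsilon_form[of 0] by blast
  obtain n1' where n1': "\<And>v. peval (\<upsilon> 1) v = n1' * Y_pencil 1 v"
    using upsilon_form[of 1] by blast
  define m0 m1 n0 n1 where mn: "m0 = of_real (\<mu> $ 0) * m0'" "m1 = of_real (\<mu> $ 1) * m1'"
    "n0 = of_real (\<nu> $ 0) * n0'" "n1 = of_real (\<nu> $ 1) * n1'"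
  define k kA l lC where kl: "k = m0 * be 0 0 + m1 * be 0 1"
    "kA = m0 * be 2 0 + m1 * be 2 1"
    "l = n0 * ga 0 0 + n1 * ga 0 1"
    "lC = n0 * ga 2 0 + n1 * ga 2 1"
  have q1: "peval q v = k * nf.Q v - kA * (nf.A v * nf.V v)" for v
    by (subst mu) (simp add: m0' m1' mn kl algebra_simps)
  have q2: "peval q v = l * nf.Q v - lC * (nf.C v * nf.V v)" for v
    by (subst nu) (simp add: n0' n1' mn kl algebra_simps)
  have e: "k * nf.Q v - kA * (nf.A v * nf.V v) = l * nf.Q v - lC * (nf.C v * nf.V v)" for v
    using q1[of v] q2[of v] by simp
  have e1: "kA * y = 0" using e[of "eA + eB"] by (simp only: VQ_basis) (simp add: nf.dual)
  have e2: "lC * x = 0" using e[of "eC + eD"] by (simp only: VQ_basis) (simp add: nf.dual)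
  have e3: "k * y1 + kA * x = l * y1" using e[of "eA + eD"] by (simp only: VQ_basis) (simp add: nf.dual)
  have e4: "k * z1 = l * z1 + lC * y" using e[of "eB + eC"] by (simp only: VQ_basis) (simp add: nf.dual algebra_simps)
  have kA: "kA = 0 \<and> lC = 0 \<and> k = l"
  proof (cases "x = 0")
    case True
    then have "y \<noteq> 0" using nf.xy by simp
    then show ?thesis using e1 e3 e4 True nf.y1 by auto
  next
    case False
    then show ?thesis using e2 e3 e4 nf.z1 by auto
  qed
  \<comment> \<open>Otherwise q would be the zero form, whose polar form has every vector in its
    radical.\<close>
  have "k \<noteq> 0"
  proof
    assume "k = 0"
    then have q0: "peval q v = 0" for v using q1[of v] kA by simp
    obtain B where B: "sbilinear B" "\<And>x. peval q x = B x x"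
      using Q quadratic_form_sbilinear[of q] by (auto simp: smooth_form_def)
    have "eA \<noteq> 0" using nf.dual(1) by auto
    then obtain u where "B eA u \<noteq> 0" using smooth_form_2D[OF Q B] q0 B(2) by metis
    moreover have "2 * B eA u = 0" using sbilinear_polarize[OF B(1), of eA u] q0 B(2) by simp
    ultimately show False by simp
  qed
  moreover have "peval q v = k * nf.Q v" for v using q1[of v] kA by simp
  moreover have "of_real (\<mu> $ 0) * peval (\<tau> 0) v = m0 * T_pencil 0 v" for v
    by (simp add: m0' mn)
  moreover have "of_real (\<mu> $ 1) * peval (\<tau> 1) v = m1 * T_pencil 1 v" for v
    by (simp add: m1' mn)
  moreover have "m0 * be 2 0 + m1 * be 2 1 = 0" using kA kl(2) by simp
  moreover have "of_real (\<nu> $ 0) * peval (\<upsilon> 0) v = n0 * Y_pencil 0 v" for v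
    by (simp add: n0' mn)
  moreover have "of_real (\<nu> $ 1) * peval (\<upsilon> 1) v = n1 * Y_pencil 1 v" for v
    by (simp add: n1' mn)
  moreover have "n0 * ga 2 0 + n1 * ga 2 1 = 0" using kA kl(4) by simp
  moreover have "n0 * ga 0 0 + n1 * ga 0 1 = k" using kA kl(3) by simp
  ultimately show ?thesis using kl(1) by (intro that[of k m0 m1 n0 n1]) simp_all
qed

text \<open>Each plane of the pencil is cU + dV. On r_0, spanned by Y_1 and Z_1, U vanishes and V
  takes the values y B(Y_1) and - x D(Z_1), not both zero; containing r_0 therefore leaves only U.
  For r_1 the roles of U and V are exchanged.\<close>

lemma pi_forms:
  obtains k0 k1 where "k0 \<noteq> 0" "\<And>v. cdot (cvec (\<pi> 0)) v = k0 * nf.U v"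
    "k1 \<noteq> 0" "\<And>v. cdot (cvec (\<pi> 1)) v = k1 * nf.V v"
proof -
  have lams: "cdot (cvec (\<pi> i)) v = of_real (lam i $ 0) * peval (\<sigma> 0) v + of_real (lam i $ 1) * peval (\<sigma> 1) v" for i v
    using arg_cong[OF lam[of i], of "\<lambda>p. peval p v"] by (simp add: peval_linform)
  obtain s0 where s0: "\<And>v. peval (\<sigma> 0) v = s0 * (al 1 0 * nf.U v - al 0 0 * nf.V v)"
    using sigma_form[of 0] by blast
  obtain s1 where s1: "\<And>v. peval (\<sigma> 1) v = s1 * (al 1 1 * nf.U v - al 0 1 * nf.V v)"
    using sigma_form[of 1] by blast
  have "\<exists>c d. \<forall>v. cdot (cvec (\<pi> i)) v = c * nf.U v + d * nf.V v" for i
  proof (intro exI allI)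
    fix v
    show "cdot (cvec (\<pi> i)) v
      = (of_real (lam i $ 0) * s0 * al 1 0 + of_real (lam i $ 1) * s1 * al 1 1) * nf.U v
        + (- of_real (lam i $ 0) * s0 * al 0 0 - of_real (lam i $ 1) * s1 * al 0 1) * nf.V v"
      unfolding lams s0 s1 by (simp add: algebra_simps)
  qed
  then obtain c d where cd: "\<And>i v. cdot (cvec (\<pi> i)) v = c i * nf.U v + d i * nf.V v" by metis
  have YZ: "cdot (cvec (\<pi> (1 - i))) (Y i) = 0" "cdot (cvec (\<pi> (1 - i))) (Z i) = 0" for i
    using ZYK_in_V(1,2)[of i] pi(2)[of "1 - i"] by (auto simp: V_def mem_plane_of subset_iff)
  have nz: "cvec (\<pi> i) \<noteq> 0" for i using pi(1) by (simp add: cvec_eq_0_iff)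
  have coords: "nf.U (Y 1) = 0" "nf.U (Z 1) = 0" "nf.V (Y 1) = y * nf.B (Y 1)" "nf.V (Z 1) = - x * nf.D (Z 1)"
    "nf.V (Y 0) = 0" "nf.V (Z 0) = 0" "nf.U (Y 0) = y * y1 * nf.A (Y 0)" "nf.U (Z 0) = - x * z1 * nf.C (Z 0)"
    using th_rh_zero[of 0] th_rh_zero[of 1] by (simp_all add: nf.U_def nf.V_def)
  have "d 0 * (y * nf.B (Y 1)) = 0" "d 0 * (x * nf.D (Z 1)) = 0"
    using YZ[of 1] by (simp_all add: cd coords)
  then have d0: "d 0 = 0" using th_Y[of 1] rh_Z[of 1] nf.xy by auto
  have "c 1 * (y * y1 * nf.A (Y 0)) = 0" "c 1 * (x * z1 * nf.C (Z 0)) = 0"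
    using YZ[of 0] by (simp_all add: cd coords)
  then have c1: "c 1 = 0" using th_Y[of 0] rh_Z[of 0] nf.xy nf.y1 nf.z1 by auto
  have "c 0 \<noteq> 0"
  proof
    assume "c 0 = 0"
    then have "cdot (cvec (\<pi> 0)) v = 0" for v by (simp add: cd d0)
    then show False using nz cdot_eq_0_imp by blast
  qed
  moreover have "d 1 \<noteq> 0"
  proof
    assume "d 1 = 0"
    then have "cdot (cvec (\<pi> 1)) v = 0" for v by (simp add: cd c1)
    then show False using nz cdot_eq_0_imp by blast
  qed
  ultimately show ?thesis
    by (intro that[of "c 0" "d 1"]) (simp_all add: cd d0 c1)
qed

text \<open>On A = C = 0 the coordinates B and D remain; Y_1 carries only B and Z_1 only D, so these
  two vectors of V_0 span the line.\<close>

lemma r_lines: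
  "r 0 = {v. v \<noteq> 0 \<and> nf.A v = 0 \<and> nf.C v = 0}" "r 1 = {v. v \<noteq> 0 \<and> nf.B v = 0 \<and> nf.D v = 0}"
proof -
  have "v \<in> V 0 \<longleftrightarrow> nf.A v = 0 \<and> nf.C v = 0" for v
  proof
    assume "nf.A v = 0 \<and> nf.C v = 0"
    then have "v = (nf.B v / nf.B (Y 1)) *s Y 1 + (nf.D v / nf.D (Z 1)) *s Z 1"
      using th_Y[of 1] rh_Z[of 1] th_rh_zero[of 0] th_rh_zero[of 1] by (intro nf.eq_by_coords) simp_all
    moreover have "Y 1 \<in> V 0" "Z 1 \<in> V 0" using ZYK_in_V[of 1] by simp_all
    ultimately show "v \<in> V 0"
      using vec.subspace_add[OF V_subspace(1)] vec.subspace_scale[OF V_subspace(1)] by metis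
  qed (simp add: V_planes)
  then show "r 0 = {v. v \<noteq> 0 \<and> nf.A v = 0 \<and> nf.C v = 0}" unfolding V_subspace(3)[of 0] by blast
  have "v \<in> V 1 \<longleftrightarrow> nf.B v = 0 \<and> nf.D v = 0" for v
  proof
    assume "nf.B v = 0 \<and> nf.D v = 0"
    then have "v = (nf.A v / nf.A (Y 0)) *s Y 0 + (nf.C v / nf.C (Z 0)) *s Z 0"
      using th_Y[of 0] rh_Z[of 0] th_rh_zero[of 0] th_rh_zero[of 1] by (intro nf.eq_by_coords) simp_all
    moreover have "Y 0 \<in> V 1" "Z 0 \<in> V 1" using ZYK_in_V[of 0] by simp_all
    ultimately show "v \<in> V 1"
      using vec.subspace_add[OF V_subspace(1)] vec.subspace_scale[OF V_subspace(1)] by metis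
  qed (simp add: V_planes)
  then show "r 1 = {v. v \<noteq> 0 \<and> nf.B v = 0 \<and> nf.D v = 0}" unfolding V_subspace(3)[of 1] by blast
qed

lemma s_line_eq: "ell w P = {v. v \<noteq> 0 \<and> nf.U v = 0 \<and> nf.V v = 0}"
proof -
  obtain s0 where s0: "s0 \<noteq> 0" "\<And>v. peval (\<sigma> 0) v = s0 * (al 1 0 * nf.U v - al 0 0 * nf.V v)"
    using sigma_form[of 0] by blast
  obtain s1 where s1: "s1 \<noteq> 0" "\<And>v. peval (\<sigma> 1) v = s1 * (al 1 1 * nf.U v - al 0 1 * nf.V v)"
    using sigma_form[of 1] by blast
  have d: "al 0 0 * al 1 1 - al 0 1 * al 1 0 \<noteq> 0"
    by (rule det2_complex[OF det_alpha])
  have eq: "peval (\<sigma> 0) v = 0 \<and> peval (\<sigma> 1) v = 0 \<longleftrightarrow> nf.U v = 0 \<and> nf.V v = 0" for v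
  proof
    assume "peval (\<sigma> 0) v = 0 \<and> peval (\<sigma> 1) v = 0"
    then have e: "al 1 0 * nf.U v - al 0 0 * nf.V v = 0" "al 1 1 * nf.U v - al 0 1 * nf.V v = 0"
      using s0 s1 by simp_all
    have "(al 0 0 * al 1 1 - al 0 1 * al 1 0) * nf.U v = 0"
      "(al 0 0 * al 1 1 - al 0 1 * al 1 0) * nf.V v = 0"
      using e by algebra+
    then show "nf.U v = 0 \<and> nf.V v = 0" using d by (simp only: mult_eq_0_iff) blast
  qed (simp add: s0(2) s1(2))
  have "v \<in> ell w P \<longleftrightarrow> v \<noteq> 0 \<and> nf.U v = 0 \<and> nf.V v = 0" for v
    unfolding ell_def sigma(2)[symmetric] Int_iff mem_surface_of eq[symmetric] by blast
  then show ?thesis by blast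
qed

lemma span_pair_det:
  assumes "G \<in> vec.span W" "H \<in> vec.span W" "v = c *s G + d *s H"
  shows "v \<in> vec.span W"
  unfolding assms(3) by (intro vec.span_add vec.span_scale assms)

lemma y_line_eq: "y_line P = {v. v \<noteq> 0 \<and> nf.A v = 0 \<and> nf.B v = 0}"
proof
  show "y_line P \<subseteq> {v. v \<noteq> 0 \<and> nf.A v = 0 \<and> nf.B v = 0}"
    using theta[of 0] theta[of 1] unfolding th_zero_iff by (auto simp: mem_plane_of subset_iff)
  show "{v. v \<noteq> 0 \<and> nf.A v = 0 \<and> nf.B v = 0} \<subseteq> y_line P"
  proof clarify
    fix v assume v: "v \<noteq> 0" "nf.A v = 0" "nf.B v = 0"
    let ?G = "\<lambda>i. F (unit2 i) (unit2 0) u2"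
    have G: "?G i \<in> y_line P" for i
    proof -
      have nz: "?G i \<noteq> 0" using F_T_eq_0[of "unit2 i" 0 u2 i 1] by (auto simp: perp_def)
      show ?thesis
      proof (rule y_line_memI[of _ i])
        show "?G i \<in> u_line P i 0" by (rule u_line_memI[OF nz Fv_unit(4)])
        let ?k = "be 2 1 / be 2 0"
        \<comment> \<open>At c_2 = 0 the point does not depend on t, so it lies on both
          u-lines.\<close>
        have "F (unit2 i) (unit2 1) u2 = ?k *s ?G i"
          using F_split_t[of "unit2 i" "unit2 1" u2] by (simp add: base_line)
        then have "?G i = inverse ?k *s (u2 0 *s p i 1 0 + u2 1 *s p i 1 1)"
          unfolding Fv_unit(4)[of w P i 1, symmetric] by simp
        then have "?G i = (inverse ?k * u2 0) *s p i 1 0 + (inverse ?k * u2 1) *s p i 1 1"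
          by (simp only: vector_add_ldistrib vector_smult_assoc)
        then show "?G i \<in> u_line P i 1" by (rule u_line_memI[OF nz])
      qed
    qed
    let ?W = "(u_line P 0 0 \<inter> u_line P 0 1) \<union> (u_line P 1 0 \<inter> u_line P 1 1)"
    have W: "?G i \<in> vec.span ?W" for i using G[of i] by (simp add: y_line_def pspan_def)
    let ?k = "be 2 0" and ?c = "\<lambda>l. ev2 (\<gamma> l) u2"
    have c: "?c 0 \<noteq> 0" "?c 1 \<noteq> 0" using det_beta_gamma(2)[of 0] det_beta_gamma(2)[of 1] by (simp_all add: ev2_perp)
    \<comment> \<open>The two values are solved from C(v) = a_0 b_2 c_0 and D(v) = a_1 b_2 c_1 at t
      = e_0, u = \<open>u2\<close>; c_0 and c_1 are nonzero at the zero of c_2.\<close>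
    obtain s where s: "ev2 (\<alpha> 0) s = nf.C v / (?k * ?c 0)" "ev2 (\<alpha> 1) s = nf.D v / (?k * ?c 1)"
      by (rule obtain_pair[OF det_alpha])
    have "v = F s (unit2 0) u2"
      by (rule nf.eq_by_coords) (use v c s in \<open>simp_all add: cdot_th cdot_rh\<close>)
    also have "F s (unit2 0) u2 = s 0 *s ?G 0 + s 1 *s ?G 1"
      by (simp add: Fv_def sum_two vec_eq_iff algebra_simps)
    finally have "v \<in> vec.span ?W" by (rule span_pair_det[OF W W])
    then show "v \<in> y_line P" using v(1) by (simp add: y_line_def pspan_def)
  qed
qed

lemma z_line_eq: "z_line P = {v. v \<noteq> 0 \<and> nf.C v = 0 \<and> nf.D v = 0}"
proof
  show "z_line P \<subseteq> {v. v \<noteq> 0 \<and> nf.C v = 0 \<and> nf.D v = 0}"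
    using rho[of 0] rho[of 1] unfolding rh_zero_iff by (auto simp: mem_plane_of subset_iff)
  show "{v. v \<noteq> 0 \<and> nf.C v = 0 \<and> nf.D v = 0} \<subseteq> z_line P"
  proof clarify
    fix v assume v: "v \<noteq> 0" "nf.C v = 0" "nf.D v = 0"
    let ?G = "\<lambda>i. F (unit2 i) t2 (unit2 0)"
    have G: "?G i \<in> z_line P" for i
    proof -
      have nz: "?G i \<noteq> 0" using F_Y_eq_0[of "unit2 i" t2 0 i 1] by (auto simp: perp_def)
      show ?thesis
      proof (rule z_line_memI[of _ i])
        show "?G i \<in> t_line P i 0" by (rule t_line_memI[OF nz Fv_unit(3)])
        let ?k = "ga 2 1 / ga 2 0"
        have "F (unit2 i) t2 (unit2 1) = ?k *s ?G i"
          using F_split_u[of "unit2 i" t2 "unit2 1"] by (simp add: base_line)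
        then have "?G i = inverse ?k *s (t2 0 *s p i 0 1 + t2 1 *s p i 1 1)"
          unfolding Fv_unit(3)[of w P i _ 1, symmetric] by simp
        then have "?G i = (inverse ?k * t2 0) *s p i 0 1 + (inverse ?k * t2 1) *s p i 1 1"
          by (simp only: vector_add_ldistrib vector_smult_assoc)
        then show "?G i \<in> t_line P i 1" by (rule t_line_memI[OF nz])
      qed
    qed
    let ?W = "(t_line P 0 0 \<inter> t_line P 0 1) \<union> (t_line P 1 0 \<inter> t_line P 1 1)"
    have W: "?G i \<in> vec.span ?W" for i using G[of i] by (simp add: z_line_def pspan_def)
    let ?k = "ga 2 0" and ?b = "\<lambda>l. ev2 (\<beta> l) t2"
    have b: "?b 0 \<noteq> 0" "?b 1 \<noteq> 0" using det_beta_gamma(1)[of 0] det_beta_gamma(1)[of 1] by (simp_all add: ev2_perp)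
    obtain s where s: "ev2 (\<alpha> 0) s = nf.A v / (?k * ?b 0)" "ev2 (\<alpha> 1) s = nf.B v / (?k * ?b 1)"
      by (rule obtain_pair[OF det_alpha])
    have "v = F s t2 (unit2 0)"
      by (rule nf.eq_by_coords) (use v b s in \<open>simp_all add: cdot_th cdot_rh\<close>)
    also have "F s t2 (unit2 0) = s 0 *s ?G 0 + s 1 *s ?G 1"
      by (simp add: Fv_def sum_two vec_eq_iff algebra_simps)
    finally have "v \<in> vec.span ?W" by (rule span_pair_det[OF W W])
    then show "v \<in> z_line P" using v(1) by (simp add: z_line_def pspan_def)
  qed
qed

end

text \<open>The hypotheses say that the pencil members b_j u - a_j v, weighted by L_j, add up to k
  u; this is the normalisation by lambda, mu or nu. The conclusions evaluate the linear forms (a_0,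
  a_1) and (b_0, b_1) at the coordinates which \<open>inv_factor\<close> builds from these members,
  and find them proportional to (u, v).\<close>

lemma pencil_block:
  fixes L0 L1 :: complex
  assumes "L0 * a0 + L1 * a1 = 0" "L0 * b0 + L1 * b1 = k"
  shows "a0 * (a1 * (L1 * (b1 * u - a1 * v))) + a1 * (a0 * (L0 * (b0 * u - a0 * v))) = a0 * a1 * k * u"
    and "b0 * (a1 * (L1 * (b1 * u - a1 * v))) + b1 * (a0 * (L0 * (b0 * u - a0 * v))) = a0 * a1 * k * v"
proof -
  have "a0 * (a1 * (L1 * (b1 * u - a1 * v))) + a1 * (a0 * (L0 * (b0 * u - a0 * v)))
      = a0 * a1 * (L0 * b0 + L1 * b1) * u - a0 * a1 * (L0 * a0 + L1 * a1) * v"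
    by (simp add: algebra_simps)
  then show "a0 * (a1 * (L1 * (b1 * u - a1 * v))) + a1 * (a0 * (L0 * (b0 * u - a0 * v))) = a0 * a1 * k * u"
    by (simp add: assms)
  have "b0 * (a1 * (L1 * (b1 * u - a1 * v))) + b1 * (a0 * (L0 * (b0 * u - a0 * v)))
      = b0 * b1 * (L0 * a0 + L1 * a1) * u - (b0 * a1 + b1 * a0) * (L0 * a0 + L1 * a1) * v
        + a0 * a1 * (L0 * b0 + L1 * b1) * v"
    by (simp add: algebra_simps)
  then show "b0 * (a1 * (L1 * (b1 * u - a1 * v))) + b1 * (a0 * (L0 * (b0 * u - a0 * v))) = a0 * a1 * k * v"
    by (simp add: assms)
qed

section \<open>The inverse map and its base locus in terms of the given forms\<close>

context scaffold_normal
begin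

lemma inverse_family_forms:
  "nf.inverse_family (inv_forms (\<alpha> i) (lam i) \<sigma> (\<beta> 2) \<mu> \<tau> (\<gamma> 2) \<nu> \<upsilon>)" (is "nf.inverse_family ?\<psi>")
proof -
  have hom: "\<exists>d. \<forall>w. fst w = b \<longrightarrow> multihom P3 d (?\<psi> w)" for b :: 3
  proof (intro exI allI impI)
    fix w' :: "3 \<times> 2" assume "fst w' = b"
    then obtain e where "w' = (b, e)" by (metis prod.collapse)
    then show "multihom P3 (\<lambda>_. if b = 0 then 1 else 2) (?\<psi> w')"
      using sigma(1) tau(1) upsilon(1) by (simp add: inv_forms_def inv_factor_def multihom_Const_mult)
  qed
  have coords: "polymap ?\<psi> v $ (0, e) = of_real (\<alpha> i $ (1 - e) * lam i $ (1 - e)) * peval (\<sigma> (1 - e)) v"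
    "polymap ?\<psi> v $ (1, e) = of_real (\<beta> 2 $ (1 - e) * \<mu> $ (1 - e)) * peval (\<tau> (1 - e)) v"
    "polymap ?\<psi> v $ (2, e) = of_real (\<gamma> 2 $ (1 - e) * \<nu> $ (1 - e)) * peval (\<upsilon> (1 - e)) v" for e v
    by (simp_all add: polymap_def inv_forms_def inv_factor_def)
  obtain k0 k1 where k: "k0 \<noteq> 0" "\<And>v. cdot (cvec (\<pi> 0)) v = k0 * nf.U v"
    "k1 \<noteq> 0" "\<And>v. cdot (cvec (\<pi> 1)) v = k1 * nf.V v" using pi_forms by blast
  obtain s0 where s0: "\<And>v. peval (\<sigma> 0) v = s0 * (al 1 0 * nf.U v - al 0 0 * nf.V v)"
    using sigma_form[of 0] by blast
  obtain s1 where s1: "\<And>v. peval (\<sigma> 1) v = s1 * (al 1 1 * nf.U v - al 0 1 * nf.V v)"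
    using sigma_form[of 1] by blast
  define L0 L1 where L: "L0 = of_real (lam i $ 0) * s0" "L1 = of_real (lam i $ 1) * s1"
  have lams: "cdot (cvec (\<pi> i)) v = L0 * (al 1 0 * nf.U v - al 0 0 * nf.V v) + L1 * (al 1 1 * nf.U v - al 0 1 * nf.V v)" for v
    using arg_cong[OF lam[of i], of "\<lambda>p. peval p v"] by (simp add: peval_linform s0 s1 L mult_ac)
  obtain eU eV where e: "nf.U eU \<noteq> 0" "nf.V eU = 0" "nf.U eV = 0" "nf.V eV \<noteq> 0" by (rule nf.UV_lines)
  have sblock: "nf.a l (polymap ?\<psi> v) = al l 0 * (al i 1 * (L1 * (al 1 1 * nf.U v - al 0 1 * nf.V v)))
    + al l 1 * (al i 0 * (L0 * (al 1 0 * nf.U v - al 0 0 * nf.V v)))" for l v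
    by (simp add: lf_def coords s0 s1 L mult_ac)
  have "\<exists>K. K \<noteq> 0 \<and> (\<forall>v. nf.a 0 (polymap ?\<psi> v) = K * nf.U v \<and> nf.a 1 (polymap ?\<psi> v) = K * nf.V v)"
  proof (cases "i = 0")
    case True
    have "L0 * (al 1 0 * nf.U v - al 0 0 * nf.V v) + L1 * (al 1 1 * nf.U v - al 0 1 * nf.V v) = k0 * nf.U v" for v
      using lams[of v] k(2)[of v] True by simp
    \<comment> \<open>At \<open>eU\<close> only U survives and at \<open>eV\<close> only V, so the
      coefficients of U and V can be compared separately.\<close>
    from this[of eU] this[of eV] have "(L0 * al 1 0 + L1 * al 1 1) * nf.U eU = k0 * nf.U eU"
      "(L0 * al 0 0 + L1 * al 0 1) * nf.V eV = 0"
      using e by (simp_all add: algebra_simps eq_neg_iff_add_eq_0 neg_eq_iff_add_eq_0)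
    then have r: "L0 * al 1 0 + L1 * al 1 1 = k0" "L0 * al 0 0 + L1 * al 0 1 = 0"
      using e by (simp_all only: mult_cancel_right mult_eq_0_iff) simp_all
    have "nf.a 0 (polymap ?\<psi> v) = (al 0 0 * al 0 1 * k0) * nf.U v"
      "nf.a 1 (polymap ?\<psi> v) = (al 0 0 * al 0 1 * k0) * nf.V v" for v
      unfolding sblock unfolding True by (rule pencil_block[OF r(2,1)])+
    then show ?thesis using k(1) by (intro exI[of _ "al 0 0 * al 0 1 * k0"]) simp
  next
    case False
    then have True: "i = 1" using two_cases[of i] by simp
    have "L0 * (al 1 0 * nf.U v - al 0 0 * nf.V v) + L1 * (al 1 1 * nf.U v - al 0 1 * nf.V v) = k1 * nf.V v" for v
      using lams[of v] k(4)[of v] True by simp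
    from this[of eU] this[of eV] have "(L0 * al 1 0 + L1 * al 1 1) * nf.U eU = 0"
      "(- L0 * al 0 0 - L1 * al 0 1) * nf.V eV = k1 * nf.V eV"
      using e by (simp_all add: algebra_simps)
    then have r: "L0 * al 1 0 + L1 * al 1 1 = 0" "- L0 * al 0 0 - L1 * al 0 1 = k1"
      using e by (simp_all only: mult_cancel_right mult_eq_0_iff) simp_all
    \<comment> \<open>The plane of \<open>\<pi> 1\<close> is V = 0, so U and V exchange roles in the
      pencil and each L_j changes sign.\<close>
    have r': "- L0 * al 1 0 + - L1 * al 1 1 = 0" "- L0 * al 0 0 + - L1 * al 0 1 = k1"
      using r by (simp_all add: neg_eq_iff_add_eq_0 eq_neg_iff_add_eq_0 algebra_simps)
    have minus: "- L * (c * nf.V v - d * nf.U v) = L * (d * nf.U v - c * nf.V v)" for L c d v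
      by (simp add: algebra_simps)
    have "nf.a 0 (polymap ?\<psi> v) = (al 1 0 * al 1 1 * k1) * nf.U v"
      "nf.a 1 (polymap ?\<psi> v) = (al 1 0 * al 1 1 * k1) * nf.V v" for v
      unfolding sblock unfolding True
      using pencil_block[OF r', of "nf.V v" "nf.U v"] unfolding minus by blast+
    then show ?thesis using k(3) by (intro exI[of _ "al 1 0 * al 1 1 * k1"]) simp
  qed
  then obtain K where K: "K \<noteq> 0" "\<And>v. nf.a 0 (polymap ?\<psi> v) = K * nf.U v" "\<And>v. nf.a 1 (polymap ?\<psi> v) = K * nf.V v"
    by blast
  obtain k m0 m1 n0 n1 where kq: "k \<noteq> 0"
    and T0: "\<And>v. of_real (\<mu> $ 0) * peval (\<tau> 0) v = m0 * T_pencil 0 v"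
    and T1: "\<And>v. of_real (\<mu> $ 1) * peval (\<tau> 1) v = m1 * T_pencil 1 v"
    and m: "m0 * be 2 0 + m1 * be 2 1 = 0" "m0 * be 0 0 + m1 * be 0 1 = k"
    and Y0: "\<And>v. of_real (\<nu> $ 0) * peval (\<upsilon> 0) v = n0 * Y_pencil 0 v"
    and Y1: "\<And>v. of_real (\<nu> $ 1) * peval (\<upsilon> 1) v = n1 * Y_pencil 1 v"
    and n: "n0 * ga 2 0 + n1 * ga 2 1 = 0" "n0 * ga 0 0 + n1 * ga 0 1 = k"
    by (rule quadric_forms) (rule that; blast)
  have tblock: "nf.b l (polymap ?\<psi> v) = be l 0 * (be 2 1 * (of_real (\<mu> $ 1) * peval (\<tau> 1) v))
    + be l 1 * (be 2 0 * (of_real (\<mu> $ 0) * peval (\<tau> 0) v))" for l v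
    by (simp add: lf_def coords mult.assoc)
  have ublock: "nf.c l (polymap ?\<psi> v) = ga l 0 * (ga 2 1 * (of_real (\<nu> $ 1) * peval (\<upsilon> 1) v))
    + ga l 1 * (ga 2 0 * (of_real (\<nu> $ 0) * peval (\<upsilon> 0) v))" for l v
    by (simp add: lf_def coords mult.assoc)
  have t: "nf.b 0 (polymap ?\<psi> v) = (be 2 0 * be 2 1 * k) * (nf.A v * nf.V v)"
    "nf.b 2 (polymap ?\<psi> v) = (be 2 0 * be 2 1 * k) * nf.Q v" for v
    unfolding tblock T0 T1 by (rule pencil_block[OF m])+
  have u: "nf.c 0 (polymap ?\<psi> v) = (ga 2 0 * ga 2 1 * k) * (nf.C v * nf.V v)"
    "nf.c 2 (polymap ?\<psi> v) = (ga 2 0 * ga 2 1 * k) * nf.Q v" for v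
    unfolding ublock Y0 Y1 by (rule pencil_block[OF n])+
  have nz: "be 2 0 * be 2 1 * k \<noteq> 0" "ga 2 0 * ga 2 1 * k \<noteq> 0" using kq by simp_all
  show ?thesis
    unfolding nf.inverse_family_def
  proof (rule conjI)
    show "\<forall>b. \<exists>d. \<forall>w. fst w = b \<longrightarrow> multihom P3 d (?\<psi> w)"
      using hom by (rule allI)
    show "\<exists>k0 k1 k2. k0 \<noteq> 0 \<and> k1 \<noteq> 0 \<and> k2 \<noteq> 0 \<and> (\<forall>v.
        nf.a 0 (polymap ?\<psi> v) = k0 * nf.U v \<and> nf.a 1 (polymap ?\<psi> v) = k0 * nf.V v \<and>
        nf.b 0 (polymap ?\<psi> v) = k1 * (nf.A v * nf.V v) \<and> nf.b 2 (polymap ?\<psi> v) = k1 * nf.Q v \<and>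
        nf.c 0 (polymap ?\<psi> v) = k2 * (nf.C v * nf.V v) \<and> nf.c 2 (polymap ?\<psi> v) = k2 * nf.Q v)"
      by (rule exI[of _ K], rule exI[of _ "be 2 0 * be 2 1 * k"], rule exI[of _ "ga 2 0 * ga 2 1 * k"])
        (intro conjI allI K t u nz)
  qed
qed

lemma indeterminacy_forms:
  "indeterminacy_locus P3 P111 (inv_forms (\<alpha> i) (lam i) \<sigma> (\<beta> 2) \<mu> \<tau> (\<gamma> 2) \<nu> \<upsilon>)
    = ell w P \<union> r 0 \<union> r 1 \<union> y_line P \<union> z_line P"
  unfolding nf.indeterminacy_normal[OF inverse_family_forms] nf.base_locus_lines
    s_line_eq r_lines y_line_eq z_line_eq ..

lemma surfaces:
  "plane_of (\<pi> 0) = {v. v \<noteq> 0 \<and> nf.U v = 0}" "plane_of (\<pi> 1) = {v. v \<noteq> 0 \<and> nf.V v = 0}"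
  "surface_of q = {v. v \<noteq> 0 \<and> nf.Q v = 0}"
proof -
  obtain k0 k1 where k: "k0 \<noteq> 0" "\<And>v. cdot (cvec (\<pi> 0)) v = k0 * nf.U v"
    "k1 \<noteq> 0" "\<And>v. cdot (cvec (\<pi> 1)) v = k1 * nf.V v" using pi_forms by blast
  show "plane_of (\<pi> 0) = {v. v \<noteq> 0 \<and> nf.U v = 0}" "plane_of (\<pi> 1) = {v. v \<noteq> 0 \<and> nf.V v = 0}"
    using k(1,3) by (auto simp: mem_plane_of k(2,4))
  obtain k where "k \<noteq> 0" "\<And>v. peval q v = k * nf.Q v"
    by (rule quadric_forms) (rule that; blast)
  then show "surface_of q = {v. v \<noteq> 0 \<and> nf.Q v = 0}" by (auto simp: mem_surface_of)
qed

end

theorem theorem5p10: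
  fixes w :: weights and P :: ctrl
    and r :: "2 \<Rightarrow> (complex^4) set"
    and \<sigma> \<tau> \<upsilon> :: "2 \<Rightarrow> 4 cpoly" and q :: "4 cpoly"
    and \<pi> \<theta> \<rho> :: "2 \<Rightarrow> real^4"
    and lam :: "2 \<Rightarrow> real^2" and \<mu> \<nu> :: "real^2"
    and \<alpha> :: "2 \<Rightarrow> real^2" and \<beta> \<gamma> :: "3 \<Rightarrow> real^2"
    and \<kappa> :: real
  defines "s \<equiv> ell w P" and "y \<equiv> y_line P" and "z \<equiv> z_line P"
    and "\<phi> \<equiv> trilin w P"
    and "\<psi> \<equiv> (\<lambda>i. inv_forms (\<alpha> i) (lam i) \<sigma> (\<beta> 2) \<mu> \<tau> (\<gamma> 2) \<nu> \<upsilon>)"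
    and "a \<equiv> (\<lambda>m. facform 0 (\<alpha> m))"
    and "b \<equiv> (\<lambda>m. facform 1 (\<beta> m))"
    and "c \<equiv> (\<lambda>m. facform 2 (\<gamma> m))"
  assumes control_points: "\<And>i j k. P i j k $ 0 = 1"
    and nondegenerate: "nondegenerate w P"
    and scaffold: "scaffold w P r"
    (* defining forms of the boundary surfaces *)
    and sigma: "\<And>i. multihom P3 (\<lambda>_. 1) (\<sigma> i)" "\<And>i. surface_of (\<sigma> i) = Sigma_surface w P i"
    and tau: "\<And>j. multihom P3 (\<lambda>_. 2) (\<tau> j)" "\<And>j. surface_of (\<tau> j) = T_surface w P j"
    and upsilon: "\<And>k. multihom P3 (\<lambda>_. 2) (\<upsilon> k)" "\<And>k. surface_of (\<upsilon> k) = Y_surface w P k"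
    (* the planes Pi_i, Theta_j, P_k and (lambda_{0i} : lambda_{1i}) *)
    and pi: "\<And>i. \<pi> i \<noteq> 0" "\<And>i. s \<union> r i \<subseteq> plane_of (\<pi> i)"
    and lam: "\<And>i. linform (\<pi> i) = rconst (lam i $ 0) * \<sigma> 0 + rconst (lam i $ 1) * \<sigma> 1"
    and theta: "\<And>j. \<theta> j \<noteq> 0" "\<And>j. y \<union> r j \<subseteq> plane_of (\<theta> j)"
    and rho: "\<And>k. \<rho> k \<noteq> 0" "\<And>k. z \<union> r k \<subseteq> plane_of (\<rho> k)"
    (* the smooth quadric Q *)
    and Q: "smooth_form 2 q" "s \<union> y \<union> z \<subseteq> surface_of q"
    and mu: "q = rconst (\<mu> $ 0) * \<tau> 0 + rconst (\<mu> $ 1) * \<tau> 1"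
    and nu: "q = rconst (\<nu> $ 0) * \<upsilon> 0 + rconst (\<nu> $ 1) * \<upsilon> 1"
    (* the weights, up to the nonzero scalar kappa *)
    and points: "\<And>m. \<alpha> m \<noteq> 0" "\<And>m. \<beta> m \<noteq> 0" "\<And>m. \<gamma> m \<noteq> 0"
    and kappa: "\<kappa> \<noteq> 0"
    and weights:
      "\<And>i j k. \<kappa> * w i j k = \<alpha> 0 $ i * \<beta> 0 $ j * \<gamma> 2 $ k * Delta (\<theta> 0) (P i j k)"
      "\<And>i j k. \<kappa> * w i j k = \<alpha> 1 $ i * \<beta> 1 $ j * \<gamma> 2 $ k * Delta (\<theta> 1) (P i j k)"
      "\<And>i j k. \<kappa> * w i j k = \<alpha> 0 $ i * \<beta> 2 $ j * \<gamma> 0 $ k * Delta (\<rho> 0) (P i j k)"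
      "\<And>i j k. \<kappa> * w i j k = \<alpha> 1 $ i * \<beta> 2 $ j * \<gamma> 1 $ k * Delta (\<rho> 1) (P i j k)"
  shows "(\<forall>i. birational_inverse P111 P3 \<phi> (\<psi> i)) \<and>
    same_subscheme P111 (gen_ideal (range \<phi>))
      (gen_ideal {a 0, b 1, c 1} \<inter> gen_ideal {a 1, b 0, c 0} \<inter> gen_ideal {b 2, c 2}) \<and>
    (\<forall>i. indeterminacy_locus P3 P111 (\<psi> i) = s \<union> r 0 \<union> r 1 \<union> y \<union> z) \<and>
    blows_up_to P111 P3 \<phi> {a 0, b 1, c 1} (plane_of (\<pi> 0)) \<and>
    blows_up_to P111 P3 \<phi> {a 1, b 0, c 0} (plane_of (\<pi> 1)) \<and>
    blows_up_to P111 P3 \<phi> {b 2, c 2} (surface_of q)"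
proof -
  have "scaffold_config w P r \<sigma> \<tau> \<upsilon> q \<pi> \<theta> \<rho> lam \<mu> \<nu> \<alpha> \<beta> \<gamma> \<kappa>"
  proof
    fix l i j k
    show "\<kappa> * w i j k = \<alpha> l $ i * \<beta> (line_index l) $ j * \<gamma> 2 $ k * Delta (\<theta> l) (P i j k)"
      using weights(1,2)[of i j k] two_cases[of l] by auto
    show "\<kappa> * w i j k = \<alpha> l $ i * \<beta> 2 $ j * \<gamma> (line_index l) $ k * Delta (\<rho> l) (P i j k)"
      using weights(3,4)[of i j k] two_cases[of l] by auto
  next
    show "r i \<subseteq> plane_of (\<pi> i)" for i using pi(2)[of i] by blast
  qed (fact scaffold sigma tau upsilon pi(1) lam theta(2)[unfolded y_def] rho(2)[unfolded z_def] Q(1) mu nu kappa)+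
  then interpret scaffold_config w P r \<sigma> \<tau> \<upsilon> q \<pi> \<theta> \<rho> lam \<mu> \<nu> \<alpha> \<beta> \<gamma> \<kappa> .
  obtain eA eB eC eD x' y' y1 z1
    where "normal_form (trilin w P) \<alpha> \<beta> \<gamma> (th 0) (th 1) (rh 0) (rh 1) eA eB eC eD x' y' y1 z1"
    using ex_normal_form by blast
  then interpret N: scaffold_normal w P r \<sigma> \<tau> \<upsilon> q \<pi> \<theta> \<rho> lam \<mu> \<nu> \<alpha> \<beta> \<gamma> \<kappa> eA eB eC eD x' y' y1 z1
    by (intro scaffold_normal.intro scaffold_config_axioms)
  show ?thesis
    unfolding s_def y_def z_def \<phi>_def \<psi>_def a_def b_def c_def
    unfolding N.surfaces
    using N.nf.birational_inverse_normal[OF N.inverse_family_forms] N.nf.base_scheme N.indeterminacy_forms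
      N.nf.blows_up_point0 N.nf.blows_up_point1 N.nf.blows_up_line
    by blast
qed

end
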